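(* Suppose $\mathcal U$ and $\mathcal D$ are bounded, circular noncommutative domains (in $M(\mathbb C)^g$) which contain noncommutative neighborhoods of $0$. If $\mathcal U$ and $\mathcal D$ are freely biholomorphic, then there is a linear (free) biholomorphism $\lambda:\mathcal D\to\mathcal U$.
   Context: Let $g$ be a positive integer. $M_n(\mathbb C)^g$ denotes the $g$-tuples $X=(X_1,\dots,X_g)$ of complex $n\times n$ matrices, and $M(\mathbb C)^g=(M_n(\mathbb C)^g)_{n\in\mathbb N}$. For matrices $A,B$ of suitable size, $AXB=(AX_1B,\dots,AX_gB)$; $X\oplus Y$ is the entrywise block-diagonal direct sum. A noncommutative set is a sequence $\mathcal U=(\mathcal U(n))_n$ with $\mathcal U(n)\subseteq M_n(\mathbb C)^g$ such that $U^*XU\in\mathcal U(n)$ for every $X\in\mathcal U(n)$ and $n\times n$ unitary $U$, and $X\oplus Y\in\mathcal U(n+m)$ whenever $X\in\mathcal U(n)$, $Y\in\mathcal U(m)$. It is a noncommutative domain if each $\mathcal U(n)$ is nonempty, open and connected. For $\varepsilon>0$ the noncommutative $\varepsilon$-neighborhood of $0$ is $\mathcal N_\varepsilon=(\mathcal N_\varepsilon(n))$, $\mathcal N_\varepsilon(n)=\{X\in M_n(\mathbb C)^g:\sum_j X_jX_j^*\prec\varepsilon^2 I\}$; $\mathcal U$ contains a noncommutative neighborhood of $0$ if $\mathcal N_\varepsilon(n)\subseteq\mathcal U(n)$ for all $n$, for some $\varepsilon>0$. $\mathcal U$ is bounded if there is $C\in\mathbb R$ such that $C^2I-\sum_j X_jX_j^*\succ0$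 for every $n$ and $X\in\mathcal U(n)$. $\mathcal U$ is circular if $e^{it}X\in\mathcal U(n)$ for all $n$, $X\in\mathcal U(n)$, $t\in\mathbb R$. A free map $f:\mathcal U\to\mathcal V$ between noncommutative sets is a sequence of functions $f[n]:\mathcal U(n)\to\mathcal V(n)$ (written $f(X)=f[n](X)$) with $f(X\oplus Y)=f(X)\oplus f(Y)$ and such that $X\Gamma=\Gamma Y$ implies $f(X)\Gamma=\Gamma f(Y)$ for $X,Y\in\mathcal U(n)$ and $\Gamma$ an invertible $n\times n$ matrix. On a noncommutative domain, $f$ is a free analytic map if each $f[n]$ is analytic. A free biholomorphism $f:\mathcal U\to\mathcal V$ (domains in the same number of variables) is a free analytic map having an inverse $f^{-1}:\mathcal V\to\mathcal U$ that is also a free analytic map; $\mathcal U$ and $\mathcal V$ are freely biholomorphic if such an $f$ exists. A free map $f$ is linear if each $f[n]$ is the restriction of a $\mathbb C$-linear map. *)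

theory Defs
  imports "HOL-Analysis.Analysis" "Jordan_Normal_Form.Schur_Decomposition"
begin

text \<open>
  Tuples of \<open>g\<close> matrices are functions on a finite index type \<open>'g\<close>, so \<open>g = CARD('g) \<ge> 1\<close>.
  A sequence \<open>(U(n))\<close> indexed by the positive integers is a function on \<^typ>\<open>nat\<close> whose value
  at \<open>0\<close> is never inspected.
\<close>

type_synonym 'g mtuple = "'g \<Rightarrow> complex mat"

definition mat_tuples :: "nat \<Rightarrow> 'g mtuple set" where
  "mat_tuples n = {X. \<forall>j. X j \<in> carrier_mat n n}"

definition mult_tuple :: "complex mat \<Rightarrow> 'g mtuple \<Rightarrow> complex mat \<Rightarrow> 'g mtuple" where
  "mult_tuple A X B = (\<lambda>j. A * X j * B)"

definition dsum_mat :: "complex mat \<Rightarrow> complex mat \<Rightarrow> complex mat" where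
  "dsum_mat A B =
     four_block_mat A (0\<^sub>m (dim_row A) (dim_col B)) (0\<^sub>m (dim_row B) (dim_col A)) B"

definition dsum_tuple :: "'g mtuple \<Rightarrow> 'g mtuple \<Rightarrow> 'g mtuple" where
  "dsum_tuple X Y = (\<lambda>j. dsum_mat (X j) (Y j))"

definition unitary_mat :: "nat \<Rightarrow> complex mat \<Rightarrow> bool" where
  "unitary_mat n W \<longleftrightarrow> W \<in> carrier_mat n n \<and>
     mat_adjoint W * W = 1\<^sub>m n \<and> W * mat_adjoint W = 1\<^sub>m n"

text \<open>In the order on \<^typ>\<open>complex\<close>, \<open>0 < z\<close> means that \<open>z\<close> is real and positive.\<close>

definition pos_def_mat :: "nat \<Rightarrow> complex mat \<Rightarrow> bool" where
  "pos_def_mat n A \<longleftrightarrow> A \<in> carrier_mat n n \<and> mat_adjoint A = A \<and>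
     (\<forall>v \<in> carrier_vec n. v \<noteq> 0\<^sub>v n \<longrightarrow> 0 < (A *\<^sub>v v) \<bullet>c v)"

text \<open>The matrix \<open>\<Sum>j. X j * (X j)\<^sup>*\<close>; it is summed entrywise because matrices of
  unspecified size do not form an additive monoid.\<close>

definition row_gram :: "nat \<Rightarrow> 'g::finite mtuple \<Rightarrow> complex mat" where
  "row_gram n X = Matrix.mat n n (\<lambda>(i, k). \<Sum>j\<in>UNIV. (X j * mat_adjoint (X j)) $$ (i, k))"

definition row_gram_less :: "real \<Rightarrow> nat \<Rightarrow> 'g::finite mtuple \<Rightarrow> bool" where
  "row_gram_less r n X \<longleftrightarrow> pos_def_mat n (complex_of_real (r\<^sup>2) \<cdot>\<^sub>m 1\<^sub>m n - row_gram n X)"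

definition coords :: "nat \<Rightarrow> ('g::finite \<times> nat \<times> nat) set" where
  "coords n = UNIV \<times> {..<n} \<times> {..<n}"

definition coord :: "'g mtuple \<Rightarrow> 'g \<times> nat \<times> nat \<Rightarrow> complex" where
  "coord X = (\<lambda>(j, i, k). X j $$ (i, k))"

definition tuple_dist :: "nat \<Rightarrow> 'g::finite mtuple \<Rightarrow> 'g mtuple \<Rightarrow> real" where
  "tuple_dist n X Y = L2_set (\<lambda>p. cmod (coord X p - coord Y p)) (coords n)"

lemma finite_coords [simp]: "finite (coords n)"
  by (simp add: coords_def)

lemma Metric_space_mat_tuples:
  "Metric_space (mat_tuples n :: 'g::finite mtuple set) (tuple_dist n)"
proof
  fix X Y Z :: "'g mtuple"
  show "0 \<le> tuple_dist n X Y"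
    by (simp add: tuple_dist_def)
  show "tuple_dist n X Y = tuple_dist n Y X"
    by (simp add: tuple_dist_def norm_minus_commute)
  show "tuple_dist n X Y = 0 \<longleftrightarrow> X = Y" if "X \<in> mat_tuples n" "Y \<in> mat_tuples n"
  proof
    assume "tuple_dist n X Y = 0"
    then have "\<forall>p\<in>coords n. coord X p = coord Y p"
      by (simp add: tuple_dist_def L2_set_eq_0_iff)
    then have "X j $$ (i, k) = Y j $$ (i, k)" if "i < n" "k < n" for j i k
      using that by (auto simp: coords_def coord_def)
    moreover have "X j \<in> carrier_mat n n" "Y j \<in> carrier_mat n n" for j
      using that by (auto simp: mat_tuples_def)
    ultimately have "X j = Y j" for j
      by (metis carrier_matD(1) carrier_matD(2) eq_matI)
    then show "X = Y" by auto
  qed (simp add: tuple_dist_def L2_set_eq_0_iff)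
  have "tuple_dist n X Z \<le>
      L2_set (\<lambda>p. cmod (coord X p - coord Y p) + cmod (coord Y p - coord Z p)) (coords n)"
    unfolding tuple_dist_def by (rule L2_set_mono)
      (auto simp: dist_norm[symmetric] dist_triangle)
  also have "\<dots> \<le> tuple_dist n X Y + tuple_dist n Y Z"
    unfolding tuple_dist_def by (rule L2_set_triangle_ineq)
  finally show "tuple_dist n X Z \<le> tuple_dist n X Y + tuple_dist n Y Z" .
qed

definition tuple_topology :: "nat \<Rightarrow> 'g::finite mtuple topology" where
  "tuple_topology n = Metric_space.mtopology (mat_tuples n) (tuple_dist n)"

definition nc_set :: "(nat \<Rightarrow> 'g mtuple set) \<Rightarrow> bool" where
  "nc_set U \<longleftrightarrow>
     (\<forall>n>0. U n \<subseteq> mat_tuples n) \<and>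
     (\<forall>n>0. \<forall>X\<in>U n. \<forall>W. unitary_mat n W \<longrightarrow> mult_tuple (mat_adjoint W) X W \<in> U n) \<and>
     (\<forall>n>0. \<forall>m>0. \<forall>X\<in>U n. \<forall>Y\<in>U m. dsum_tuple X Y \<in> U (n + m))"

definition nc_domain :: "(nat \<Rightarrow> 'g::finite mtuple set) \<Rightarrow> bool" where
  "nc_domain U \<longleftrightarrow> nc_set U \<and>
     (\<forall>n>0. U n \<noteq> {} \<and> openin (tuple_topology n) (U n) \<and> connectedin (tuple_topology n) (U n))"

definition nc_nbhd :: "real \<Rightarrow> nat \<Rightarrow> 'g::finite mtuple set" where
  "nc_nbhd \<epsilon> n = {X \<in> mat_tuples n. row_gram_less \<epsilon> n X}"

definition contains_nc_nbhd_0 :: "(nat \<Rightarrow> 'g::finite mtuple set) \<Rightarrow> bool" where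
  "contains_nc_nbhd_0 U \<longleftrightarrow> (\<exists>\<epsilon>>0. \<forall>n>0. nc_nbhd \<epsilon> n \<subseteq> U n)"

definition nc_bounded :: "(nat \<Rightarrow> 'g::finite mtuple set) \<Rightarrow> bool" where
  "nc_bounded U \<longleftrightarrow> (\<exists>C::real. \<forall>n>0. \<forall>X\<in>U n. row_gram_less C n X)"

definition circular :: "(nat \<Rightarrow> 'g mtuple set) \<Rightarrow> bool" where
  "circular U \<longleftrightarrow> (\<forall>n>0. \<forall>X\<in>U n. \<forall>t::real. (\<lambda>j. exp (\<i> * complex_of_real t) \<cdot>\<^sub>m X j) \<in> U n)"

definition free_map ::
  "(nat \<Rightarrow> 'g mtuple set) \<Rightarrow> (nat \<Rightarrow> 'h mtuple set) \<Rightarrow> (nat \<Rightarrow> 'g mtuple \<Rightarrow> 'h mtuple) \<Rightarrow> bool"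
where
  "free_map U V f \<longleftrightarrow>
     (\<forall>n>0. f n ` U n \<subseteq> V n) \<and>
     (\<forall>n>0. \<forall>m>0. \<forall>X\<in>U n. \<forall>Y\<in>U m. f (n + m) (dsum_tuple X Y) = dsum_tuple (f n X) (f m Y)) \<and>
     (\<forall>n>0. \<forall>X\<in>U n. \<forall>Y\<in>U n. \<forall>\<Gamma>\<in>carrier_mat n n.
        invertible_mat \<Gamma> \<and> (\<forall>j. X j * \<Gamma> = \<Gamma> * Y j) \<longrightarrow>
        (\<forall>j. f n X j * \<Gamma> = \<Gamma> * f n Y j))"

text \<open>
  Analyticity in several complex variables: near every point of the domain, the function is the
  sum of a (necessarily absolutely convergent) power series in the matrix entries. The summation
  ranges over all multi-indices, i.e. exponent functions supported on \<^term>\<open>coords n\<close>.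
\<close>

definition multi_indices :: "nat \<Rightarrow> ('g::finite \<times> nat \<times> nat \<Rightarrow> nat) set" where
  "multi_indices n = {\<alpha>. \<forall>p. p \<notin> coords n \<longrightarrow> \<alpha> p = 0}"

definition analytic_fun :: "nat \<Rightarrow> 'g::finite mtuple set \<Rightarrow> ('g mtuple \<Rightarrow> complex) \<Rightarrow> bool" where
  "analytic_fun n S \<phi> \<longleftrightarrow>
     (\<forall>P\<in>S. \<exists>r>0. \<exists>c :: ('g \<times> nat \<times> nat \<Rightarrow> nat) \<Rightarrow> complex.
        \<forall>X\<in>S. tuple_dist n P X < r \<longrightarrow>
          ((\<lambda>\<alpha>. c \<alpha> * (\<Prod>p\<in>coords n. (coord X p - coord P p) ^ \<alpha> p)) has_sum \<phi> X)
            (multi_indices n))"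

definition analytic_tuple_map ::
  "nat \<Rightarrow> 'g::finite mtuple set \<Rightarrow> ('g mtuple \<Rightarrow> 'h::finite mtuple) \<Rightarrow> bool" where
  "analytic_tuple_map n S F \<longleftrightarrow> (\<forall>q\<in>coords n. analytic_fun n S (\<lambda>X. coord (F X) q))"

definition free_analytic_map ::
  "(nat \<Rightarrow> 'g::finite mtuple set) \<Rightarrow> (nat \<Rightarrow> 'h::finite mtuple set) \<Rightarrow>
   (nat \<Rightarrow> 'g mtuple \<Rightarrow> 'h mtuple) \<Rightarrow> bool" where
  "free_analytic_map U V f \<longleftrightarrow> free_map U V f \<and> (\<forall>n>0. analytic_tuple_map n (U n) (f n))"

definition free_biholomorphism ::
  "(nat \<Rightarrow> 'g::finite mtuple set) \<Rightarrow> (nat \<Rightarrow> 'g mtuple set) \<Rightarrow>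
   (nat \<Rightarrow> 'g mtuple \<Rightarrow> 'g mtuple) \<Rightarrow> bool" where
  "free_biholomorphism U V f \<longleftrightarrow> free_analytic_map U V f \<and>
     (\<exists>h. free_analytic_map V U h \<and>
        (\<forall>n>0. \<forall>X\<in>U n. h n (f n X) = X) \<and> (\<forall>n>0. \<forall>Y\<in>V n. f n (h n Y) = Y))"

definition freely_biholomorphic ::
  "(nat \<Rightarrow> 'g::finite mtuple set) \<Rightarrow> (nat \<Rightarrow> 'g mtuple set) \<Rightarrow> bool" where
  "freely_biholomorphic U V \<longleftrightarrow> (\<exists>f. free_biholomorphism U V f)"

definition linear_tuple_map :: "nat \<Rightarrow> ('g mtuple \<Rightarrow> 'h mtuple) \<Rightarrow> bool" where
  "linear_tuple_map n L \<longleftrightarrow>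
     (\<forall>X\<in>mat_tuples n. L X \<in> mat_tuples n) \<and>
     (\<forall>X\<in>mat_tuples n. \<forall>Y\<in>mat_tuples n. L (\<lambda>j. X j + Y j) = (\<lambda>j. L X j + L Y j)) \<and>
     (\<forall>c::complex. \<forall>X\<in>mat_tuples n. L (\<lambda>j. c \<cdot>\<^sub>m X j) = (\<lambda>j. c \<cdot>\<^sub>m L X j))"

definition levelwise_linear ::
  "(nat \<Rightarrow> 'g mtuple set) \<Rightarrow> (nat \<Rightarrow> 'g mtuple \<Rightarrow> 'h mtuple) \<Rightarrow> bool" where
  "levelwise_linear U f \<longleftrightarrow>
     (\<forall>n>0. \<exists>L. linear_tuple_map n L \<and> (\<forall>X\<in>U n. f n X = L X))"

end

(* Among all free biholomorphisms f : U -> D, with Jacobian determinant J f of the map f[1] on C^g, the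
   weight |J f (0)| exp (-|f(0)|^2) attains a positive maximum, since cluster points of the uniformly
   bounded families f and f^-1 (pointwise limits, by Tychonoff) are again free analytic maps, mutually inverse as
   soon as the limiting Jacobian does not vanish. Let f be a maximizer, h = f^-1 and q = f(0) at level 1.
   The free map f o i h(e^{it} f) is again a biholomorphism U -> D, because both domains are circular. It
   maps 0 to q - t q + O(t^2), so for small t > 0 the exponential factor grows to first order unless
   q = 0, and the maximum principle for J h on the disc spanned by q keeps the Jacobian factor from
   compensating. Hence f(0) = 0 at level 1 and, by direct sums, at every level; Cartan's uniqueness theorem
   on bounded circular domains makes f and its inverse linear. *)
theory Submission
  imports Defs "HOL-Complex_Analysis.Complex_Analysis"
begin

text \<open>The domains are open, connected and stable under rotation, but a segment from 0 to one
  of their points may leave them. Homogeneous expansions and the maximum principle can therefore not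
  be taken on discs spanned by a point. Averages over roots of unity replace them: rotations stay in
  the domain, the averages converge near 0, and connectedness spreads the convergence.

  The comparison map: rotating by \<open>e^{it}\<close> moves \<open>q\<close> by
  \<open>i t q\<close> and keeps its length. The map \<open>f o i h\<close> fixes \<open>q\<close>;
  its derivative there is \<open>Df o i o Dh\<close>, which is multiplication by \<open>i\<close> as
  \<open>Df\<close> is complex linear, and turns \<open>i t q\<close> into \<open>- t q\<close>. The
  first variation of the Jacobian has only a weak sign; the exponential factor adds a term in
  \<open>|q|^2\<close> of strict sign.

  Limits of biholomorphisms may degenerate to maps into the boundary. A nonzero limiting Jacobian
  excludes this at the point 0 of the first level, direct sums at 0 on the other levels,
  equicontinuity and connectedness everywhere else.\<close>

section \<open>Limits of holomorphic functions of one variable along a filter\<close>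

text \<open>Tychonoff's theorem for the product of the discs of radius \<open>M a\<close>. A filter
  \<open>G\<close> replaces a subsequence: the index type \<open>'a\<close> will range over all
  points of all levels, an uncountable set on which no diagonal subsequence is available.\<close>

lemma pointwise_cluster:
  fixes f :: "'k \<Rightarrow> 'a \<Rightarrow> complex"
  assumes F: "F \<noteq> bot" and M: "\<And>k a. cmod (f k a) \<le> M a"
  obtains G g where "G \<le> F" "G \<noteq> bot" "\<And>a. ((\<lambda>k. f k a) \<longlongrightarrow> g a) G"
proof -
  define K where "K = PiE UNIV (\<lambda>a. cball (0::complex) (M a))"
  have "compactin (product_topology (\<lambda>_. euclidean) UNIV) K"
    unfolding K_def by (subst compactin_PiE) auto
  then have K: "compact K"
    by (simp add: euclidean_product_topology)
  have "eventually (\<lambda>y. y \<in> K) (filtermap f F)"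
    using M by (simp add: eventually_filtermap K_def PiE_UNIV_domain Pi_iff)
  moreover have "filtermap f F \<noteq> bot"
    using F by (simp add: filtermap_bot_iff)
  ultimately obtain g where g: "inf (nhds g) (filtermap f F) \<noteq> bot"
    using K unfolding compact_filter by blast
  \<comment> \<open>\<open>G\<close> refines \<open>F\<close> by the requirement that
    \<open>f k\<close> be close to the cluster point \<open>g\<close> in the product topology.
    Convergence is built in; what needs proof is that \<open>G\<close> is nontrivial.\<close>
  define G where "G = inf (filtercomap f (nhds g)) F"
  have "G \<noteq> bot"
  proof
    assume "G = bot"
    then have "eventually (\<lambda>_. False) G" by simp
    then obtain P Q where P: "eventually P (filtercomap f (nhds g))" and Q: "eventually Q F"
      and PQ: "\<And>k. P k \<Longrightarrow> Q k \<Longrightarrow> False"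
      unfolding G_def eventually_inf by blast
    from P obtain P' where P': "eventually P' (nhds g)" "\<And>k. P' (f k) \<Longrightarrow> P k"
      by (auto simp: eventually_filtercomap)
    have "eventually (\<lambda>y. \<not> P' y) (filtermap f F)"
      using Q by (auto simp: eventually_filtermap elim!: eventually_mono dest: P'(2) PQ)
    with P'(1) have "eventually (\<lambda>_. False) (inf (nhds g) (filtermap f F))"
      unfolding eventually_inf by blast
    with g show False by (simp add: trivial_limit_def)
  qed
  moreover have "G \<le> F" by (simp add: G_def)
  moreover have lim: "filterlim f (nhds g) G"
    unfolding G_def by (rule filterlim_mono[OF filterlim_filtercomap order_refl inf_le1])
  have "((\<lambda>k. f k a) \<longlongrightarrow> g a) G" for a
    using lim by (rule continuous_on_tendsto_compose[where s = UNIV, OF continuous_on_product_coordinates]) auto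
  ultimately show thesis using that by blast
qed

text \<open>Schwarz's lemma for \<open>(g (R u) - g 0) / (3 M)\<close>. The numerator is at most
  \<open>2 M\<close>; dividing by \<open>3 M\<close> makes the bound \<open>1\<close> strict, as
  that lemma demands.\<close>

lemma Schwarz_Lipschitz:
  assumes g: "g holomorphic_on ball 0 R" and M: "\<And>z. z \<in> ball 0 R \<Longrightarrow> cmod (g z) \<le> M"
    and z: "cmod z < R"
  shows "cmod (g z - g 0) \<le> 3 * M / R * cmod z"
proof -
  have R: "R > 0" using z by (metis norm_ge_zero order.strict_trans1)
  have M0: "M \<ge> 0" using M[of 0] R by (auto intro: order_trans[OF norm_ge_zero])
  show ?thesis
  proof (cases "M = 0")
    case True
    then show ?thesis using M[of z] M[of 0] R z by auto
  next
    case False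
    then have Mp: "M > 0" using M0 by simp
    define w where "w = (\<lambda>u. (g (of_real R * u) - g 0) / of_real (3 * M))"
    have img: "of_real R * u \<in> ball 0 R" if "u \<in> ball 0 1" for u :: complex
      using that R by (simp add: norm_mult)
    have "w holomorphic_on ball 0 1"
      unfolding w_def
    proof (intro holomorphic_intros)
      have "(g \<circ> (\<lambda>u. of_real R * u)) holomorphic_on ball 0 1"
        by (rule holomorphic_on_compose_gen[OF _ g]) (auto intro!: holomorphic_intros img simp del: mem_ball)
      then show "(\<lambda>u. g (of_real R * u)) holomorphic_on ball 0 1" by (simp add: o_def)
    qed (use Mp in auto)
    moreover have "w 0 = 0" by (simp add: w_def)
    moreover have "cmod (w u) < 1" if "cmod u < 1" for u
    proof -
      have "cmod (g (of_real R * u)) \<le> M" using img[of u] that M by simp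
      moreover have "cmod (g 0) \<le> M" using M R by simp
      ultimately have "cmod (g (of_real R * u) - g 0) \<le> M + M"
        by (meson norm_triangle_le_diff add_mono)
      then show ?thesis using Mp by (simp add: w_def norm_divide norm_mult)
    qed
    moreover have "cmod (z / of_real R) < 1" using z R by (simp add: norm_divide)
    ultimately have "cmod (w (z / of_real R)) \<le> cmod (z / of_real R)"
      using Schwarz_Lemma(1) by blast
    then show ?thesis using Mp R
      by (simp add: w_def norm_divide norm_mult field_simps)
  qed
qed

text \<open>The \<open>e/3\<close> argument on a finite \<open>\<delta>\<close>-net. It works along
  any filter, because convergence is used at finitely many points simultaneously.\<close>

lemma equi_Lipschitz_uniform_limit:
  fixes f :: "'k \<Rightarrow> 'a::metric_space \<Rightarrow> complex"
  assumes C: "compact C"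
    and L: "\<And>x y. x \<in> C \<Longrightarrow> y \<in> C \<Longrightarrow> cmod (g x - g y) \<le> L * dist x y"
    and lip: "eventually (\<lambda>k. \<forall>x\<in>C. \<forall>y\<in>C. cmod (f k x - f k y) \<le> L * dist x y) F"
    and lim: "\<And>x. x \<in> C \<Longrightarrow> ((\<lambda>k. f k x) \<longlongrightarrow> g x) F"
  shows "uniform_limit C f g F"
proof (rule uniform_limitI)
  fix e :: real assume e: "e > 0"
  define \<delta> where "\<delta> = e / (3 * (\<bar>L\<bar> + 1))"
  have \<delta>: "\<delta> > 0" using e by (simp add: \<delta>_def add_nonneg_pos)
  have L\<delta>: "L * t \<le> e / 3" if "0 \<le> t" "t < \<delta>" for t
  proof -
    have "L * t \<le> (\<bar>L\<bar> + 1) * t" using that by (intro mult_right_mono) auto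
    also have "\<dots> \<le> (\<bar>L\<bar> + 1) * \<delta>" using that by (intro mult_left_mono) auto
    also have "\<dots> = e / 3" by (simp add: \<delta>_def field_simps)
    finally show ?thesis .
  qed
  obtain N where N: "finite N" "N \<subseteq> C" "C \<subseteq> (\<Union>x\<in>N. ball x \<delta>)"
    using compactE_image[OF C, of C "\<lambda>x. ball x \<delta>"] \<delta> by (metis centre_in_ball open_ball UN_I subsetI)
  have "eventually (\<lambda>k. \<forall>x\<in>N. dist (f k x) (g x) < e / 3) F"
    by (intro eventually_ball_finite N ballI tendstoD lim) (use N e in auto)
  with lip show "eventually (\<lambda>k. \<forall>x\<in>C. dist (f k x) (g x) < e) F"
  proof eventually_elim
    case (elim k)
    show ?case
    proof
      fix x assume x: "x \<in> C"
      then obtain y where y: "y \<in> N" "dist y x < \<delta>" using N(3) by auto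
      have "cmod (f k x - f k y) \<le> e / 3" "cmod (g x - g y) \<le> e / 3"
        using elim(1) L[OF x, of y] y N(2) x L\<delta>[of "dist x y"]
        by (force simp: dist_commute)+
      moreover have "cmod (f k y - g y) < e / 3" using elim(2) y by (auto simp: dist_norm)
      ultimately have "cmod (f k x - g x) < e"
        by norm
      then show "dist (f k x) (g x) < e" by (simp add: dist_norm)
    qed
  qed
qed

text \<open>The common bound \<open>M\<close> makes the functions uniformly Lipschitz on a smaller
  disc, so pointwise convergence is uniform there and, by Weierstrass, passes to the
  derivatives.\<close>

lemma holomorphic_pointwise_limit:
  fixes f :: "'k \<Rightarrow> complex \<Rightarrow> complex"
  assumes F: "F \<noteq> bot" and R: "R > 0"
    and hol: "eventually (\<lambda>k. f k holomorphic_on ball a R \<and> (\<forall>z\<in>ball a R. cmod (f k z) \<le> M)) F"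
    and lim: "\<And>z. z \<in> ball a R \<Longrightarrow> ((\<lambda>k. f k z) \<longlongrightarrow> g z) F"
  shows "\<exists>r>0. g holomorphic_on ball a r" "((\<lambda>k. deriv (f k) a) \<longlongrightarrow> deriv g a) F"
proof -
  \<comment> \<open>For \<open>y\<close> within \<open>r\<close> of \<open>a\<close> the disc of
    radius \<open>2 r\<close> about \<open>y\<close> still lies in \<open>ball a R\<close>, and two
    such points are at most \<open>2 r\<close> apart.\<close>
  define r where "r = R / 4"
  have r: "r > 0" using R by (simp add: r_def)
  define L where "L = 3 * M / (2 * r)"
  have *: "cmod (h x - h y) \<le> L * dist x y"
    if h: "h holomorphic_on ball a R" "\<forall>z\<in>ball a R. cmod (h z) \<le> M" and xy: "x \<in> cball a r" "y \<in> cball a r"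
    for h x y
  proof (cases "x = y")
    case False
    have sub: "ball y (2*r) \<subseteq> ball a R"
    proof
      fix z assume "z \<in> ball y (2*r)"
      then show "z \<in> ball a R" using xy r dist_triangle[of a z y] by (auto simp: r_def)
    qed
    have "((\<lambda>z. h (y + z)) holomorphic_on ball 0 (2*r))"
    proof -
      have "(h \<circ> (\<lambda>z. y + z)) holomorphic_on ball 0 (2*r)"
        by (rule holomorphic_on_compose_gen[OF _ h(1)])
          (use sub in \<open>auto intro!: holomorphic_intros simp: dist_norm subset_iff\<close>)
      then show ?thesis by (simp add: o_def)
    qed
    moreover have "cmod (h (y + z)) \<le> M" if "z \<in> ball 0 (2*r)" for z
      using that sub h(2) by (auto simp: dist_norm subset_iff)
    moreover have "dist x y \<le> dist a x + dist a y" using dist_triangle3 by blast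
    then have "cmod (x - y) < 2 * r \<or> cmod (x - y) = 2*r" using xy by (auto simp: dist_norm)
    moreover have ?thesis if "cmod (x - y) < 2*r"
      using Schwarz_Lipschitz[of "\<lambda>z. h (y + z)" "2*r" M "x - y"] calculation(1,2) that
      by (simp add: L_def dist_norm)
    \<comment> \<open>At distance exactly \<open>2 r\<close> the Schwarz estimate does not apply,
      but \<open>L * 2 r\<close> is \<open>3 M\<close> and dominates the trivial bound
      \<open>2 M\<close>.\<close>
    moreover have ?thesis if eq: "cmod (x - y) = 2*r"
    proof -
      have "cmod (h x) \<le> M" "cmod (h y) \<le> M"
        using xy r h(2) by (auto simp: r_def)
      then have "cmod (h x - h y) \<le> M + M" by (meson norm_triangle_le_diff add_mono)
      moreover have "M \<ge> 0" using \<open>cmod (h x) \<le> M\<close> norm_ge_zero order_trans by blast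
      ultimately have "cmod (h x - h y) \<le> 3*M" by simp
      then show ?thesis using eq r by (simp add: L_def dist_norm)
    qed
    ultimately show ?thesis by blast
  qed simp
  have sub: "cball a r \<subseteq> ball a R" using R by (auto simp: r_def)
  have lip: "eventually (\<lambda>k. \<forall>x\<in>cball a r. \<forall>y\<in>cball a r. cmod (f k x - f k y) \<le> L * dist x y) F"
    using hol by eventually_elim (use * in blast)
  have glip: "cmod (g x - g y) \<le> L * dist x y" if "x \<in> cball a r" "y \<in> cball a r" for x y
  proof (rule tendsto_upperbound[OF _ _ F])
    show "((\<lambda>k. cmod (f k x - f k y)) \<longlongrightarrow> cmod (g x - g y)) F"
      using that sub by (intro tendsto_intros lim) auto
    show "\<forall>\<^sub>F k in F. cmod (f k x - f k y) \<le> L * dist x y"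
      using lip by eventually_elim (use that in blast)
  qed
  have ul: "uniform_limit (cball a r) f g F"
  proof (rule equi_Lipschitz_uniform_limit[OF _ _ lip])
    show "((\<lambda>k. f k x) \<longlongrightarrow> g x) F" if "x \<in> cball a r" for x using lim sub that by blast
    show "cmod (g x - g y) \<le> L * dist x y"
      if "x \<in> cball a r" "y \<in> cball a r" for x y
      using glip that .
  qed auto
  have ev: "\<forall>\<^sub>F n in F. continuous_on (cball a r) (f n) \<and>
     (\<forall>w \<in> ball a r. (f n has_field_derivative deriv (f n) w) (at w))"
    using hol
  proof eventually_elim
    case (elim k)
    then have h: "f k holomorphic_on ball a R" by blast
    have "continuous_on (cball a r) (f k)"
      using holomorphic_on_imp_continuous_on[OF h] continuous_on_subset sub by blast
    moreover have "ball a r \<subseteq> ball a R" using R by (auto simp: r_def)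
    ultimately show ?case using h by (auto intro: holomorphic_derivI)
  qed
  obtain g' where g': "\<And>w. w \<in> ball a r \<Longrightarrow> (g has_field_derivative g' w) (at w) \<and> ((\<lambda>n. deriv (f n) w) \<longlongrightarrow> g' w) F"
    using has_complex_derivative_uniform_limit[OF ev ul] F r by auto
  then have "g holomorphic_on ball a r"
    by (intro holomorphic_onI) (use field_differentiable_at_within field_differentiable_def in blast)
  with r show "\<exists>r>0. g holomorphic_on ball a r" by blast
  show "((\<lambda>k. deriv (f k) a) \<longlongrightarrow> deriv g a) F"
    using g'[of a] r by (auto dest!: DERIV_imp_deriv)
qed

section \<open>Holomorphic functions of several variables\<close>

definition polydisc :: "'i set \<Rightarrow> ('i \<Rightarrow> complex) \<Rightarrow> real \<Rightarrow> ('i \<Rightarrow> complex) set" where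
  "polydisc I x r = {y. \<forall>p\<in>I. cmod (y p - x p) < r}"

text \<open>Openness in the finite-dimensional space of the \<open>I\<close>-coordinates. Such a set
  is automatically stable under changes of the coordinates outside \<open>I\<close>.\<close>

definition pd_open :: "'i set \<Rightarrow> ('i \<Rightarrow> complex) set \<Rightarrow> bool" where
  "pd_open I S \<longleftrightarrow> (\<forall>x\<in>S. \<exists>r>0. polydisc I x r \<subseteq> S)"

definition pd_connected :: "'i set \<Rightarrow> ('i \<Rightarrow> complex) set \<Rightarrow> bool" where
  "pd_connected I S \<longleftrightarrow>
     (\<forall>A B. pd_open I A \<longrightarrow> pd_open I B \<longrightarrow> A \<union> B = S \<longrightarrow> A \<inter> B = {} \<longrightarrow> A = {} \<or> B = {})"

text \<open>A vector is a function on an index set \<open>I\<close>, whose values outside \<open>I\<close> are ignored, so that all matrix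
  levels live in one type. Holomorphy means local boundedness together with holomorphy along all
  holomorphic curves.\<close>

definition chol :: "'i set \<Rightarrow> ('i \<Rightarrow> complex) set \<Rightarrow> (('i \<Rightarrow> complex) \<Rightarrow> complex) \<Rightarrow> bool" where
  "chol I S \<phi> \<longleftrightarrow>
     (\<forall>x\<in>S. \<exists>r>0. \<exists>M. polydisc I x r \<subseteq> S \<and> (\<forall>y\<in>polydisc I x r. cmod (\<phi> y) \<le> M)) \<and>
     (\<forall>\<Omega> c. open \<Omega> \<longrightarrow> (\<forall>p\<in>I. (\<lambda>z. c z p) holomorphic_on \<Omega>) \<longrightarrow> (\<forall>z\<in>\<Omega>. c z \<in> S) \<longrightarrow>
        (\<lambda>z. \<phi> (c z)) holomorphic_on \<Omega>)"

definition dd :: "(('i \<Rightarrow> complex) \<Rightarrow> complex) \<Rightarrow> ('i \<Rightarrow> complex) \<Rightarrow> ('i \<Rightarrow> complex) \<Rightarrow> complex" where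
  "dd \<phi> x v = deriv (\<lambda>z. \<phi> (\<lambda>p. x p + z * v p)) 0"

lemma mem_polydisc: "y \<in> polydisc I x r \<longleftrightarrow> (\<forall>p\<in>I. cmod (y p - x p) < r)"
  by (simp add: polydisc_def)

lemma polydisc_mono: "r \<le> s \<Longrightarrow> polydisc I x r \<subseteq> polydisc I x s"
  by (force simp: polydisc_def)

lemma centre_polydisc [simp]: "r > 0 \<Longrightarrow> x \<in> polydisc I x r"
  by (simp add: polydisc_def)

lemma polydisc_half:
  assumes "y \<in> polydisc I x (r/2)" "r' \<le> r / 2"
  shows "polydisc I y r' \<subseteq> polydisc I x r"
proof
  fix z assume "z \<in> polydisc I y r'"
  then have "cmod (z p - x p) < r" if "p \<in> I" for p
    using assms that norm_triangle_ineq[of "z p - y p" "y p - x p"] by (force simp: mem_polydisc)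
  then show "z \<in> polydisc I x r" by (simp add: mem_polydisc)
qed

lemma bounded_coords:
  fixes f :: "'i \<Rightarrow> complex"
  assumes "finite I" obtains V where "V > 0" "\<And>p. p \<in> I \<Longrightarrow> cmod (f p) \<le> V"
proof -
  have "cmod (f p) \<le> 1 + (\<Sum>p\<in>I. cmod (f p))" if "p \<in> I" for p
    using member_le_sum[OF that, of "\<lambda>p. cmod (f p)"] assms by auto
  then show thesis using that[of "1 + (\<Sum>p\<in>I. cmod (f p))"] by (auto simp: sum_nonneg add_pos_nonneg)
qed

lemma pd_open_polydisc:
  assumes "finite I" shows "pd_open I (polydisc I x r)"
  unfolding pd_open_def
proof
  fix y assume y: "y \<in> polydisc I x r"
  define d where "d = Min (insert 1 ((\<lambda>p. r - cmod (y p - x p)) ` I))"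
  have "d > 0" using assms y by (auto simp: d_def mem_polydisc)
  moreover have "polydisc I y d \<subseteq> polydisc I x r"
  proof
    fix z assume z: "z \<in> polydisc I y d"
    have "cmod (z p - x p) < r" if "p \<in> I" for p
    proof -
      have "d \<le> r - cmod (y p - x p)" using that assms unfolding d_def by (intro Min_le) auto
      then show ?thesis using z that norm_triangle_ineq[of "z p - y p" "y p - x p"] by (force simp: mem_polydisc)
    qed
    then show "z \<in> polydisc I x r" by (simp add: mem_polydisc)
  qed
  ultimately show "\<exists>r'>0. polydisc I y r' \<subseteq> polydisc I x r" by blast
qed

lemma loc_boundI:
  assumes "r > 0" "polydisc I x r \<subseteq> S" "\<And>y. y \<in> polydisc I x r \<Longrightarrow> cmod (\<phi> y) \<le> M"
  shows "\<exists>r>0. \<exists>M. polydisc I x r \<subseteq> S \<and> (\<forall>y\<in>polydisc I x r. cmod (\<phi> y) \<le> M)"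
  using assms by blast

lemma chol_open: "chol I S \<phi> \<Longrightarrow> pd_open I S"
  unfolding chol_def pd_open_def by meson

lemma chol_bounded:
  assumes "chol I S \<phi>" "x \<in> S"
  obtains r M where "r > 0" "M > 0" "polydisc I x r \<subseteq> S" "\<And>y. y \<in> polydisc I x r \<Longrightarrow> cmod (\<phi> y) \<le> M"
proof -
  from assms obtain r M where rM: "r > 0" "polydisc I x r \<subseteq> S" "\<And>y. y \<in> polydisc I x r \<Longrightarrow> cmod (\<phi> y) \<le> M"
    unfolding chol_def by meson
  have "cmod (\<phi> y) \<le> \<bar>M\<bar> + 1" if "y \<in> polydisc I x r" for y using rM(3)[OF that] by linarith
  then show thesis using that[of r "\<bar>M\<bar> + 1"] rM by (auto simp: add_nonneg_pos)
qed

lemma chol_curve: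
  assumes "chol I S \<phi>" "open \<Omega>" "\<And>p. p \<in> I \<Longrightarrow> (\<lambda>z. c z p) holomorphic_on \<Omega>" "\<And>z. z \<in> \<Omega> \<Longrightarrow> c z \<in> S"
  shows "(\<lambda>z. \<phi> (c z)) holomorphic_on \<Omega>"
  using assms unfolding chol_def by blast

lemma chol_line:
  assumes "chol I S \<phi>" "open \<Omega>" "\<And>z. z \<in> \<Omega> \<Longrightarrow> (\<lambda>p. x p + z * v p) \<in> S"
  shows "(\<lambda>z. \<phi> (\<lambda>p. x p + z * v p)) holomorphic_on \<Omega>"
  by (rule chol_curve[OF assms(1,2)]) (use assms(3) in \<open>auto intro!: holomorphic_intros\<close>)

lemma cholI:
  assumes "\<And>x. x \<in> S \<Longrightarrow> \<exists>r>0. \<exists>M. polydisc I x r \<subseteq> S \<and> (\<forall>y\<in>polydisc I x r. cmod (\<phi> y) \<le> M)"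
    and "\<And>\<Omega> c. open \<Omega> \<Longrightarrow> (\<And>p. p \<in> I \<Longrightarrow> (\<lambda>z. c z p) holomorphic_on \<Omega>) \<Longrightarrow> (\<And>z. z \<in> \<Omega> \<Longrightarrow> c z \<in> S) \<Longrightarrow>
        (\<lambda>z. \<phi> (c z)) holomorphic_on \<Omega>"
  shows "chol I S \<phi>"
  unfolding chol_def
proof (intro conjI ballI allI impI)
  fix x assume "x \<in> S"
  then show "\<exists>r>0. \<exists>M. polydisc I x r \<subseteq> S \<and> (\<forall>y\<in>polydisc I x r. cmod (\<phi> y) \<le> M)" by (rule assms(1))
next
  fix \<Omega> :: "complex set" and c :: "complex \<Rightarrow> 'a \<Rightarrow> complex"
  assume c: "open \<Omega>" "\<forall>p\<in>I. (\<lambda>z. c z p) holomorphic_on \<Omega>" "\<forall>z\<in>\<Omega>. c z \<in> S"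
  show "(\<lambda>z. \<phi> (c z)) holomorphic_on \<Omega>"
    by (rule assms(2)[OF c(1)]) (use c(2,3) in blast)+
qed

lemma cholI_bounded:
  assumes "pd_open I S" "\<And>x. x \<in> S \<Longrightarrow> cmod (\<phi> x) \<le> M"
    and "\<And>\<Omega> c. open \<Omega> \<Longrightarrow> (\<And>p. p \<in> I \<Longrightarrow> (\<lambda>z. c z p) holomorphic_on \<Omega>) \<Longrightarrow> (\<And>z. z \<in> \<Omega> \<Longrightarrow> c z \<in> S) \<Longrightarrow>
        (\<lambda>z. \<phi> (c z)) holomorphic_on \<Omega>"
  shows "chol I S \<phi>"
proof (rule cholI)
  fix x assume "x \<in> S"
  then obtain r where "r > 0" "polydisc I x r \<subseteq> S" using assms(1) unfolding pd_open_def by blast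
  then show "\<exists>r>0. \<exists>M. polydisc I x r \<subseteq> S \<and> (\<forall>y\<in>polydisc I x r. cmod (\<phi> y) \<le> M)"
    using assms(2) by (intro loc_boundI[of r]) auto
qed (rule assms(3))

lemma chol_subset:
  assumes "chol I S \<phi>" "T \<subseteq> S" "pd_open I T" shows "chol I T \<phi>"
proof (rule cholI)
  fix x assume x: "x \<in> T"
  then obtain r where r: "r > 0" "polydisc I x r \<subseteq> T" using assms(3) unfolding pd_open_def by blast
  obtain r' M where r': "r' > 0" "\<And>y. y \<in> polydisc I x r' \<Longrightarrow> cmod (\<phi> y) \<le> M"
    using x assms(2) by (metis chol_bounded[OF assms(1)] subsetD)
  show "\<exists>r>0. \<exists>M. polydisc I x r \<subseteq> T \<and> (\<forall>y\<in>polydisc I x r. cmod (\<phi> y) \<le> M)"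
  proof (rule loc_boundI[of "min r r'"])
    show "polydisc I x (min r r') \<subseteq> T" using r(2) polydisc_mono[of "min r r'" r I x] by simp
    show "cmod (\<phi> y) \<le> M" if "y \<in> polydisc I x (min r r')" for y
      using that polydisc_mono[of "min r r'" r' I x] by (intro r'(2)) auto
  qed (use r r' in simp)
next
  fix \<Omega> :: "complex set" and c :: "complex \<Rightarrow> 'a \<Rightarrow> complex"
  assume "open \<Omega>" "\<And>p. p \<in> I \<Longrightarrow> (\<lambda>z. c z p) holomorphic_on \<Omega>" "\<And>z. z \<in> \<Omega> \<Longrightarrow> c z \<in> T"
  then show "(\<lambda>z. \<phi> (c z)) holomorphic_on \<Omega>"
    using assms(2) by (intro chol_curve[OF assms(1)]) auto
qed

lemma chol_const: "pd_open I S \<Longrightarrow> chol I S (\<lambda>x. a)"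
  by (rule cholI_bounded[of _ _ _ "cmod a"]) auto

lemma chol_coord:
  assumes "pd_open I S" "p \<in> I" shows "chol I S (\<lambda>x. x p)"
proof (rule cholI)
  fix x assume "x \<in> S"
  then obtain r where r: "r > 0" "polydisc I x r \<subseteq> S" using assms unfolding pd_open_def by blast
  have "cmod (y p) \<le> cmod (x p) + r" if "y \<in> polydisc I x r" for y
  proof -
    have "cmod (y p - x p) < r" using that assms by (simp add: mem_polydisc)
    then show ?thesis using norm_triangle_sub[of "y p" "x p"] by linarith
  qed
  then show "\<exists>r>0. \<exists>M. polydisc I x r \<subseteq> S \<and> (\<forall>y\<in>polydisc I x r. cmod (y p) \<le> M)"
    using r by (intro loc_boundI[of r]) auto
qed (use assms(2) in auto)

lemma chol_binop:
  assumes f: "chol I S f" and g: "chol I S g"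
    and hol: "\<And>f g \<Omega>. f holomorphic_on \<Omega> \<Longrightarrow> g holomorphic_on \<Omega> \<Longrightarrow> (\<lambda>z. h (f z) (g z)) holomorphic_on \<Omega>"
    and bd: "\<And>a b A B. cmod a \<le> A \<Longrightarrow> cmod b \<le> B \<Longrightarrow> cmod (h a b) \<le> H A B"
  shows "chol I S (\<lambda>x. h (f x) (g x))"
proof (rule cholI)
  fix x assume x: "x \<in> S"
  obtain r M where r: "r > 0" "polydisc I x r \<subseteq> S" "\<And>y. y \<in> polydisc I x r \<Longrightarrow> cmod (f y) \<le> M"
    using chol_bounded[OF f x] by metis
  obtain r' M' where r': "r' > 0" "\<And>y. y \<in> polydisc I x r' \<Longrightarrow> cmod (g y) \<le> M'"
    using chol_bounded[OF g x] by metis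
  show "\<exists>r>0. \<exists>M. polydisc I x r \<subseteq> S \<and> (\<forall>y\<in>polydisc I x r. cmod (h (f y) (g y)) \<le> M)"
  proof (rule loc_boundI[of "min r r'"])
    show "polydisc I x (min r r') \<subseteq> S" using r(2) polydisc_mono[of "min r r'" r I x] by simp
    fix y assume "y \<in> polydisc I x (min r r')"
    then have "y \<in> polydisc I x r" "y \<in> polydisc I x r'"
      using polydisc_mono[of "min r r'" r I x] polydisc_mono[of "min r r'" r' I x] by auto
    then show "cmod (h (f y) (g y)) \<le> H M M'" using r r' bd by blast
  qed (use r r' in simp)
next
  fix \<Omega> :: "complex set" and c :: "complex \<Rightarrow> 'a \<Rightarrow> complex"
  assume a: "open \<Omega>" "\<And>p. p \<in> I \<Longrightarrow> (\<lambda>z. c z p) holomorphic_on \<Omega>" "\<And>z. z \<in> \<Omega> \<Longrightarrow> c z \<in> S"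
  show "(\<lambda>z. h (f (c z)) (g (c z))) holomorphic_on \<Omega>"
    by (intro hol chol_curve[OF f] chol_curve[OF g] a)
qed

lemma chol_add: "chol I S f \<Longrightarrow> chol I S g \<Longrightarrow> chol I S (\<lambda>x. f x + g x)"
  by (rule chol_binop[where h = "(+)" and H = "(+)"]) (auto intro: holomorphic_intros norm_triangle_mono)

lemma chol_diff: "chol I S f \<Longrightarrow> chol I S g \<Longrightarrow> chol I S (\<lambda>x. f x - g x)"
  by (rule chol_binop[where h = "(-)" and H = "(+)"]) (auto intro: holomorphic_intros norm_triangle_le_diff add_mono)

lemma chol_mult: "chol I S f \<Longrightarrow> chol I S g \<Longrightarrow> chol I S (\<lambda>x. f x * g x)"
proof (rule chol_binop[where h = "(*)" and H = "(*)"])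
  fix a b :: complex and A B assume "cmod a \<le> A" "cmod b \<le> B"
  then show "cmod (a * b) \<le> A * B"
    by (simp add: norm_mult) (metis mult_mono norm_ge_zero order_trans)
qed (auto intro: holomorphic_intros)

lemma chol_sum:
  assumes "pd_open I S" "\<And>j. j \<in> A \<Longrightarrow> chol I S (f j)"
  shows "chol I S (\<lambda>x. \<Sum>j\<in>A. f j x)"
  using assms(2)
proof (induction A rule: infinite_finite_induct)
  case (insert a A)
  then show ?case by (auto intro!: chol_add)
qed (auto intro: chol_const assms(1))

lemma chol_prod:
  assumes "pd_open I S" "\<And>j. j \<in> A \<Longrightarrow> chol I S (f j)"
  shows "chol I S (\<lambda>x. \<Prod>j\<in>A. f j x)"
  using assms(2)
proof (induction A rule: infinite_finite_induct)
  case (insert a A)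
  then show ?case by (auto intro!: chol_mult)
qed (auto intro: chol_const assms(1))

text \<open>Distances are measured by arbitrary bounds \<open>\<delta>\<close> on all coordinate differences, so that no
  norm on the vectors is needed.\<close>

lemma chol_Lipschitz0:
  assumes hol: "chol I S \<phi>" and sub: "polydisc I x r \<subseteq> S"
    and M: "\<And>y. y \<in> polydisc I x r \<Longrightarrow> cmod (\<phi> y) \<le> M"
    and d: "0 < \<delta>" "\<delta> < r" "\<And>p. p \<in> I \<Longrightarrow> cmod (y p - x p) \<le> \<delta>"
  shows "cmod (\<phi> y - \<phi> x) \<le> 3 * M / r * \<delta>"
proof -
  define g where "g = (\<lambda>z. \<phi> (\<lambda>p. x p + z * (y p - x p)))"
  have mem: "(\<lambda>p. x p + z * (y p - x p)) \<in> polydisc I x r" if "z \<in> ball 0 (r / \<delta>)" for z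
    unfolding mem_polydisc
  proof
    fix p assume p: "p \<in> I"
    have "cmod (z * (y p - x p)) \<le> cmod z * \<delta>"
      using d(3)[OF p] by (simp add: norm_mult mult_left_mono)
    also have "\<dots> < r" using that d by (simp add: pos_less_divide_eq)
    finally show "cmod (x p + z * (y p - x p) - x p) < r" by simp
  qed
  have "g holomorphic_on ball 0 (r / \<delta>)"
    unfolding g_def using mem sub by (intro chol_line[OF hol]) auto
  moreover have "cmod (g z) \<le> M" if "z \<in> ball 0 (r / \<delta>)" for z
    unfolding g_def by (intro M mem that)
  ultimately have "cmod (g 1 - g 0) \<le> 3 * M / (r / \<delta>) * cmod 1"
    by (rule Schwarz_Lipschitz) (use d in auto)
  then show ?thesis by (simp add: g_def)
qed

text \<open>\<open>chol_Lipschitz0\<close> recentred at \<open>y\<close> with radius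
  \<open>r/2\<close>, which doubles \<open>3\<close> to \<open>6\<close>. That estimate wants a
  positive distance below the radius, so the claim is shown for every
  \<open>\<delta>' > \<delta>\<close>, with the trivial bound \<open>2 M\<close> when
  \<open>\<delta>'\<close> is large; letting \<open>\<delta>'\<close> decrease to
  \<open>\<delta>\<close> also covers \<open>\<delta> = 0\<close>.\<close>

lemma chol_Lipschitz:
  assumes hol: "chol I S \<phi>" and sub: "polydisc I x r \<subseteq> S"
    and M: "\<And>y. y \<in> polydisc I x r \<Longrightarrow> cmod (\<phi> y) \<le> M" and r: "r > 0"
    and y: "y \<in> polydisc I x (r/2)" "y' \<in> polydisc I x (r/2)"
    and d: "0 \<le> \<delta>" "\<And>p. p \<in> I \<Longrightarrow> cmod (y' p - y p) \<le> \<delta>"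
  shows "cmod (\<phi> y' - \<phi> y) \<le> 6 * M / r * \<delta>"
proof -
  have M0: "M \<ge> 0" using M[of x] r by (auto intro: order_trans[OF norm_ge_zero])
  have *: "cmod (\<phi> y' - \<phi> y) \<le> 6 * M / r * \<delta>'" if "\<delta>' > \<delta>" for \<delta>'
  proof (cases "\<delta>' < r/2")
    case True
    have sub': "polydisc I y (r/2) \<subseteq> polydisc I x r" by (rule polydisc_half[OF y(1)]) simp
    have "cmod (\<phi> y' - \<phi> y) \<le> 3 * M / (r/2) * \<delta>'"
      by (rule chol_Lipschitz0[OF hol])
        (use sub sub' M True d that in \<open>force+\<close>)
    then show ?thesis by simp
  next
    case False
    have "cmod (\<phi> y') \<le> M" "cmod (\<phi> y) \<le> M"
      using M y polydisc_mono[of "r/2" r I x] r by auto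
    then have "cmod (\<phi> y' - \<phi> y) \<le> M + M" by (meson norm_triangle_le_diff add_mono)
    also have "\<dots> \<le> 6 * M / r * (r/2)" using M0 r by simp
    also have "\<dots> \<le> 6 * M / r * \<delta>'" using False M0 r by (intro mult_left_mono) auto
    finally show ?thesis .
  qed
  show ?thesis
  proof (rule field_le_epsilon)
    fix e :: real assume e: "e > 0"
    define \<delta>' where "\<delta>' = \<delta> + e / (6 * M / r + 1)"
    have pos: "6 * M / r + 1 > 0" using M0 r by (simp add: add_nonneg_pos)
    have "cmod (\<phi> y' - \<phi> y) \<le> 6 * M / r * \<delta>'"
      by (rule *) (use e pos in \<open>simp add: \<delta>'_def\<close>)
    also have "6 * M / r * \<delta>' = 6 * M / r * \<delta> + (6 * M / r) * (e / (6 * M / r + 1))"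
      by (simp add: \<delta>'_def distrib_left)
    also have "(6 * M / r) * (e / (6 * M / r + 1)) \<le> (6 * M / r + 1) * (e / (6 * M / r + 1))"
      using e pos by (intro mult_right_mono) auto
    also have "\<dots> = e" using pos by simp
    finally show "cmod (\<phi> y' - \<phi> y) \<le> 6 * M / r * \<delta> + e" by simp
  qed
qed

text \<open>The Lipschitz estimate at distance \<open>0\<close>. In effect this is Liouville's
  theorem: a line that changes only coordinates outside \<open>I\<close> never leaves a polydisc,
  and \<open>\<phi>\<close> is bounded there.\<close>

lemma chol_cong_coords:
  assumes hol: "chol I S \<phi>" and "x \<in> S" "\<And>p. p \<in> I \<Longrightarrow> y p = x p"
  shows "\<phi> y = \<phi> x"
proof -
  obtain r M where r: "r > 0" "polydisc I x r \<subseteq> S" "\<And>y. y \<in> polydisc I x r \<Longrightarrow> cmod (\<phi> y) \<le> M"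
    using chol_bounded[OF hol assms(2)] by metis
  have "cmod (\<phi> y - \<phi> x) \<le> 6 * M / r * 0"
    by (rule chol_Lipschitz[OF hol r(2,3,1)]) (use assms r in \<open>auto simp: mem_polydisc\<close>)
  then show ?thesis by simp
qed

lemma curve_in_polydisc:
  assumes "finite I" "open \<Omega>" "z0 \<in> \<Omega>" "r > 0" "\<And>p. p \<in> I \<Longrightarrow> (\<lambda>z. c z p) holomorphic_on \<Omega>"
  shows "\<exists>\<rho>>0. ball z0 \<rho> \<subseteq> \<Omega> \<and> (\<forall>z\<in>ball z0 \<rho>. c z \<in> polydisc I (c z0) r)"
proof -
  have "eventually (\<lambda>z. \<forall>p\<in>I. dist (c z p) (c z0 p) < r) (nhds z0)"
  proof (intro eventually_ball_finite assms ballI)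
    fix p assume p: "p \<in> I"
    have "isCont (\<lambda>z. c z p) z0"
      using assms p by (meson continuous_on_eq_continuous_at holomorphic_on_imp_continuous_on)
    then have "((\<lambda>z. c z p) \<longlongrightarrow> c z0 p) (nhds z0)"
      using tendsto_at_iff_tendsto_nhds[of "\<lambda>z. c z p" z0] by (simp add: isCont_def)
    then show "\<forall>\<^sub>F z in nhds z0. dist (c z p) (c z0 p) < r"
      by (rule tendstoD) (rule assms(4))
  qed
  moreover have "eventually (\<lambda>z. z \<in> \<Omega>) (nhds z0)"
    using assms by (simp add: eventually_nhds_in_open)
  ultimately have "eventually (\<lambda>z. z \<in> \<Omega> \<and> c z \<in> polydisc I (c z0) r) (nhds z0)"
    by eventually_elim (simp add: mem_polydisc dist_norm)
  then show ?thesis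
    unfolding eventually_nhds_metric by (force simp: dist_commute)
qed

lemma line_in_polydisc:
  assumes "finite I" "r > 0"
  obtains \<rho> where "\<rho> > 0" "\<And>z. z \<in> ball 0 \<rho> \<Longrightarrow> (\<lambda>p. x p + z * v p) \<in> polydisc I x r"
proof -
  have "\<exists>\<rho>>0. ball (0::complex) \<rho> \<subseteq> UNIV \<and> (\<forall>z\<in>ball 0 \<rho>. (\<lambda>p. x p + z * v p) \<in> polydisc I (\<lambda>p. x p + 0 * v p) r)"
    by (rule curve_in_polydisc[where c = "\<lambda>z p. x p + z * v p"])
      (use assms in \<open>auto intro!: holomorphic_intros\<close>)
  then show thesis using that by auto
qed

section \<open>Locally bounded families and Vitali's theorem\<close>

text \<open>Normality in the sense of Montel, along a filter. Holomorphy and bound are demanded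
  eventually and on the polydisc, so that difference quotients, which make sense on a given polydisc
  for small increments, form such a family.\<close>

definition loc_bounded_family ::
  "'i set \<Rightarrow> ('i \<Rightarrow> complex) set \<Rightarrow> 'k filter \<Rightarrow> ('k \<Rightarrow> ('i \<Rightarrow> complex) \<Rightarrow> complex) \<Rightarrow> bool" where
  "loc_bounded_family I S F \<phi> \<longleftrightarrow> (\<forall>x\<in>S. \<exists>r>0. \<exists>M. polydisc I x r \<subseteq> S \<and>
     eventually (\<lambda>k. chol I (polydisc I x r) (\<phi> k) \<and> (\<forall>y\<in>polydisc I x r. cmod (\<phi> k y) \<le> M)) F)"

lemma loc_bounded_family_mono: "loc_bounded_family I S F \<phi> \<Longrightarrow> G \<le> F \<Longrightarrow> loc_bounded_family I S G \<phi>"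
  unfolding loc_bounded_family_def by (meson filter_leD)

lemma loc_bounded_familyI:
  assumes "finite I" "pd_open I S" "\<And>k. chol I S (\<phi> k)" "\<And>k x. x \<in> S \<Longrightarrow> cmod (\<phi> k x) \<le> M"
  shows "loc_bounded_family I S F \<phi>"
  unfolding loc_bounded_family_def
proof
  fix x assume "x \<in> S"
  then obtain r where r: "r > 0" "polydisc I x r \<subseteq> S" using assms(2) unfolding pd_open_def by blast
  then have "chol I (polydisc I x r) (\<phi> k)" for k
    using assms(1,3) pd_open_polydisc chol_subset by blast
  then have "eventually (\<lambda>k. chol I (polydisc I x r) (\<phi> k) \<and> (\<forall>y\<in>polydisc I x r. cmod (\<phi> k y) \<le> M)) F"
    using r(2) assms(4) by (intro always_eventually) blast
  with r show "\<exists>r>0. \<exists>M. polydisc I x r \<subseteq> S \<and>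
     eventually (\<lambda>k. chol I (polydisc I x r) (\<phi> k) \<and> (\<forall>y\<in>polydisc I x r. cmod (\<phi> k y) \<le> M)) F"
    by blast
qed

text \<open>Holomorphy and derivatives are tested along curves and lines, and near each parameter
  these stay in a polydisc with a common bound. So the one-variable limit theorem suffices.\<close>

lemma loc_bounded_family_limit:
  assumes I: "finite I" and F: "F \<noteq> bot" and lb: "loc_bounded_family I S F \<phi>"
    and lim: "\<And>x. x \<in> S \<Longrightarrow> ((\<lambda>k. \<phi> k x) \<longlongrightarrow> g x) F"
  shows "chol I S g" "x \<in> S \<Longrightarrow> ((\<lambda>k. dd (\<phi> k) x v) \<longlongrightarrow> dd g x v) F"
proof -
  show "chol I S g"
  proof (rule cholI)
    fix x assume "x \<in> S"
    then obtain r M where r: "r > 0" "polydisc I x r \<subseteq> S"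
      "eventually (\<lambda>k. chol I (polydisc I x r) (\<phi> k) \<and> (\<forall>y\<in>polydisc I x r. cmod (\<phi> k y) \<le> M)) F"
      using lb unfolding loc_bounded_family_def by meson
    have "cmod (g y) \<le> M" if "y \<in> polydisc I x r" for y
    proof (rule tendsto_upperbound[OF _ _ F])
      show "((\<lambda>k. cmod (\<phi> k y)) \<longlongrightarrow> cmod (g y)) F"
        using that r by (intro tendsto_intros lim) auto
      show "\<forall>\<^sub>F k in F. cmod (\<phi> k y) \<le> M"
        using r(3) by eventually_elim (use that in blast)
    qed
    then show "\<exists>r>0. \<exists>M. polydisc I x r \<subseteq> S \<and> (\<forall>y\<in>polydisc I x r. cmod (g y) \<le> M)"
      using r by blast
  next
    fix \<Omega> c assume c: "open \<Omega>" "\<And>p. p \<in> I \<Longrightarrow> (\<lambda>z. c z p) holomorphic_on \<Omega>" "\<And>z. z \<in> \<Omega> \<Longrightarrow> c z \<in> S"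
    show "(\<lambda>z. g (c z)) holomorphic_on \<Omega>"
      unfolding holomorphic_on_open[OF c(1)]
    proof
      fix z0 assume z0: "z0 \<in> \<Omega>"
      then obtain r M where r: "r > 0" "polydisc I (c z0) r \<subseteq> S"
        "eventually (\<lambda>k. chol I (polydisc I (c z0) r) (\<phi> k) \<and> (\<forall>y\<in>polydisc I (c z0) r. cmod (\<phi> k y) \<le> M)) F"
        using lb c unfolding loc_bounded_family_def by meson
      obtain \<rho> where \<rho>: "\<rho> > 0" "ball z0 \<rho> \<subseteq> \<Omega>" "\<And>z. z \<in> ball z0 \<rho> \<Longrightarrow> c z \<in> polydisc I (c z0) r"
        using curve_in_polydisc[of I \<Omega> z0 r c] I c(1,2) z0 r(1) by blast
      have ev: "eventually (\<lambda>k. (\<lambda>z. \<phi> k (c z)) holomorphic_on ball z0 \<rho> \<and> (\<forall>z\<in>ball z0 \<rho>. cmod (\<phi> k (c z)) \<le> M)) F"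
        using r(3)
      proof eventually_elim
        case (elim k)
        then show ?case
          by (intro conjI chol_curve[of I "polydisc I (c z0) r" "\<phi> k"])
            (use \<rho> c(2) in \<open>auto intro: holomorphic_on_subset\<close>)
      qed
      have "\<exists>r>0. (\<lambda>z. g (c z)) holomorphic_on ball z0 r"
        by (rule holomorphic_pointwise_limit(1)[OF F \<rho>(1) ev]) (use \<rho> c in \<open>auto intro!: lim\<close>)
      then show "\<exists>f'. ((\<lambda>z. g (c z)) has_field_derivative f') (at z0)"
        by (meson centre_in_ball holomorphic_derivI open_ball)
    qed
  qed
  assume "x \<in> S"
  then obtain r M where r: "r > 0" "polydisc I x r \<subseteq> S"
    "eventually (\<lambda>k. chol I (polydisc I x r) (\<phi> k) \<and> (\<forall>y\<in>polydisc I x r. cmod (\<phi> k y) \<le> M)) F"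
    using lb unfolding loc_bounded_family_def by meson
  obtain \<rho> where \<rho>: "\<rho> > 0" "\<And>z. z \<in> ball 0 \<rho> \<Longrightarrow> (\<lambda>p. x p + z * v p) \<in> polydisc I x r"
    using line_in_polydisc[OF I r(1), of x v] by blast
  have ev: "eventually (\<lambda>k. (\<lambda>z. \<phi> k (\<lambda>p. x p + z * v p)) holomorphic_on ball 0 \<rho>
       \<and> (\<forall>z\<in>ball 0 \<rho>. cmod (\<phi> k (\<lambda>p. x p + z * v p)) \<le> M)) F"
    using r(3)
  proof eventually_elim
    case (elim k)
    then show ?case
      by (intro conjI chol_line[of I "polydisc I x r" "\<phi> k"]) (use \<rho> in auto)
  qed
  show "((\<lambda>k. dd (\<phi> k) x v) \<longlongrightarrow> dd g x v) F"
    unfolding dd_def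
    by (rule holomorphic_pointwise_limit(2)[OF F \<rho>(1) ev]) (use \<rho> r in \<open>auto intro!: lim\<close>)
qed

text \<open>The parameter \<open>t\<close> is complex: the part of a complex line inside a polydisc
  is thereby connected, as the identity theorem in one variable requires.\<close>

lemma polydisc_convex:
  assumes "y \<in> polydisc I x r" "z \<in> polydisc I x r"
  shows "convex {t::complex. (\<lambda>p. y p + t * (z p - y p)) \<in> polydisc I x r}"
proof (rule convexI)
  fix a b :: complex and u v :: real
  assume a: "a \<in> {t. (\<lambda>p. y p + t * (z p - y p)) \<in> polydisc I x r}"
    and b: "b \<in> {t. (\<lambda>p. y p + t * (z p - y p)) \<in> polydisc I x r}" and uv: "0 \<le> u" "0 \<le> v" "u + v = 1"
  have "cmod (y p + (u *\<^sub>R a + v *\<^sub>R b) * (z p - y p) - x p) < r" if p: "p \<in> I" for p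
  proof -
    define A B where "A = y p + a * (z p - y p)" and "B = y p + b * (z p - y p)"
    have "A \<in> ball (x p) r" "B \<in> ball (x p) r"
      using a b p by (auto simp: mem_polydisc A_def B_def dist_norm norm_minus_commute)
    then have "u *\<^sub>R A + v *\<^sub>R B \<in> ball (x p) r"
      using convex_ball[of "x p" r] uv unfolding convex_def by blast
    moreover have "u *\<^sub>R A + v *\<^sub>R B = (u + v) *\<^sub>R y p + (u *\<^sub>R a + v *\<^sub>R b) * (z p - y p)"
      unfolding A_def B_def by (simp add: algebra_simps)
    ultimately show ?thesis using uv by (simp add: dist_norm norm_minus_commute)
  qed
  then show "u *\<^sub>R a + v *\<^sub>R b \<in> {t. (\<lambda>p. y p + t * (z p - y p)) \<in> polydisc I x r}"
    by (simp add: mem_polydisc)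
qed

lemma chol_identity:
  assumes I: "finite I" and hol: "chol I S \<phi>" and con: "pd_connected I S"
    and x0: "x0 \<in> S" "s > 0" and zero: "\<And>y. y \<in> polydisc I x0 s \<Longrightarrow> y \<in> S \<Longrightarrow> \<phi> y = 0"
    and x: "x \<in> S"
  shows "\<phi> x = 0"
proof -
  define A where "A = {x\<in>S. \<exists>r>0. polydisc I x r \<subseteq> S \<and> (\<forall>y\<in>polydisc I x r. \<phi> y = 0)}"
  have A: "pd_open I A"
    unfolding pd_open_def
  proof
    fix x assume "x \<in> A"
    then obtain r where r: "r > 0" "polydisc I x r \<subseteq> S" "\<forall>y\<in>polydisc I x r. \<phi> y = 0"
      by (auto simp: A_def)
    have "polydisc I x r \<subseteq> A"
    proof
      fix y assume y: "y \<in> polydisc I x r"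
      obtain r' where "r' > 0" "polydisc I y r' \<subseteq> polydisc I x r"
        using pd_open_polydisc[OF I] y unfolding pd_open_def by blast
      then show "y \<in> A" using r y unfolding A_def by blast
    qed
    then show "\<exists>r>0. polydisc I x r \<subseteq> A" using r by blast
  qed
  have B: "pd_open I (S - A)"
    unfolding pd_open_def
  proof
    fix x assume x: "x \<in> S - A"
    then obtain r where r: "r > 0" "polydisc I x r \<subseteq> S"
      using chol_open[OF hol] unfolding pd_open_def by blast
    \<comment> \<open>Were some point \<open>y\<close> of the polydisc in \<open>A\<close>, every
      point \<open>z\<close> of it would lie on a complex line through \<open>y\<close>. As
      \<open>\<phi>\<close> vanishes on that line near \<open>y\<close>, it vanishes at
      \<open>z\<close>, and then the centre \<open>x\<close> would be in \<open>A\<close>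
      too.\<close>
    have "y \<notin> A" if y: "y \<in> polydisc I x r" for y
    proof
      assume "y \<in> A"
      then obtain s where s: "s > 0" "\<And>z. z \<in> polydisc I y s \<Longrightarrow> \<phi> z = 0" by (auto simp: A_def)
      have "\<phi> z = 0" if z: "z \<in> polydisc I x r" for z
      proof -
        define T where "T = {t. (\<lambda>p. y p + t * (z p - y p)) \<in> polydisc I x r}"
        have opT: "open T"
        proof -
          have "T = (\<Inter>p\<in>I. (\<lambda>t. y p + t * (z p - y p)) -` ball (x p) r)"
            by (auto simp: T_def mem_polydisc dist_norm norm_minus_commute)
          then show ?thesis using I by (auto intro!: open_INT open_vimage continuous_intros)
        qed
        have "connected T" unfolding T_def using polydisc_convex[OF y z] by (rule convex_connected)
        have T01: "0 \<in> T" "1 \<in> T" using y z by (auto simp: T_def)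
        define g where "g = (\<lambda>t. \<phi> (\<lambda>p. y p + t * (z p - y p)))"
        have hg: "g holomorphic_on T"
          unfolding g_def using r by (intro chol_line[OF hol opT]) (auto simp: T_def)
        have "\<exists>\<rho>>0. ball 0 \<rho> \<subseteq> T \<and> (\<forall>t\<in>ball 0 \<rho>. (\<lambda>p. y p + t * (z p - y p)) \<in> polydisc I (\<lambda>p. y p + 0 * (z p - y p)) s)"
          by (rule curve_in_polydisc[OF I opT T01(1) s(1)]) (auto intro!: holomorphic_intros)
        then obtain \<rho> where \<rho>: "\<rho> > 0" "ball 0 \<rho> \<subseteq> T" "\<And>t. t \<in> ball 0 \<rho> \<Longrightarrow> g t = 0"
          using s(2) by (auto simp: g_def)
        have "g 1 = 0"
          by (rule analytic_continuation_open[of "ball 0 \<rho>" T g "\<lambda>_. 0"])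
            (use \<rho> hg opT \<open>connected T\<close> T01 in auto)
        then show ?thesis by (simp add: g_def)
      qed
      then have "x \<in> A" using x r unfolding A_def by blast
      then show False using x by simp
    qed
    then show "\<exists>r>0. polydisc I x r \<subseteq> S - A" using r by (intro exI[of _ r]) auto
  qed
  obtain r0 where r0: "r0 > 0" "polydisc I x0 r0 \<subseteq> S"
    using chol_open[OF hol] x0 unfolding pd_open_def by blast
  have "x0 \<in> A" unfolding A_def
    using x0 r0 zero polydisc_mono[of "min s r0" s I x0] polydisc_mono[of "min s r0" r0 I x0]
    by (auto intro!: exI[of _ "min s r0"])
  moreover have "A \<union> (S - A) = S" "A \<inter> (S - A) = {}" by (auto simp: A_def)
  ultimately have "S - A = {}"
    using con[unfolded pd_connected_def, rule_format, OF A B] by blast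
  then have "x \<in> A" using x by blast
  then show ?thesis by (auto simp: A_def)
qed

text \<open>Vitali's theorem by compactness. A failure at \<open>x\<close> persists on a finer
  filter; a pointwise cluster limit there is holomorphic and vanishes near \<open>x0\<close>, hence
  at \<open>x\<close> by the identity theorem.\<close>

lemma loc_bounded_family_null:
  assumes I: "finite I" and lb: "loc_bounded_family I S F \<phi>" and con: "pd_connected I S"
    and x0: "x0 \<in> S" "s > 0"
    and null: "\<And>y. y \<in> polydisc I x0 s \<Longrightarrow> y \<in> S \<Longrightarrow> ((\<lambda>k. \<phi> k y) \<longlongrightarrow> 0) F"
    and x: "x \<in> S"
  shows "((\<lambda>k. \<phi> k x) \<longlongrightarrow> 0) F"
proof (rule ccontr)
  assume "\<not> ?thesis"
  then obtain e where e: "e > 0" "\<not> eventually (\<lambda>k. cmod (\<phi> k x) < e) F"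
    unfolding tendsto_iff by auto
  define F' where "F' = inf F (principal {k. \<not> cmod (\<phi> k x) < e})"
  have F': "F' \<noteq> bot"
    using e(2) by (auto simp: F'_def trivial_limit_def eventually_inf_principal)
  have "\<exists>M. \<forall>y\<in>S. eventually (\<lambda>k. cmod (\<phi> k y) \<le> M y) F"
  proof (rule bchoice, rule ballI)
    fix y assume "y \<in> S"
    then obtain r M where r: "r > 0" 
      "eventually (\<lambda>k. chol I (polydisc I y r) (\<phi> k) \<and> (\<forall>y\<in>polydisc I y r. cmod (\<phi> k y) \<le> M)) F"
      using lb unfolding loc_bounded_family_def by meson
    from r(2) have "eventually (\<lambda>k. cmod (\<phi> k y) \<le> M) F"
      by eventually_elim (use r(1) in auto)
    then show "\<exists>M. eventually (\<lambda>k. cmod (\<phi> k y) \<le> M) F" by blast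
  qed
  then obtain M where M: "\<And>y. y \<in> S \<Longrightarrow> eventually (\<lambda>k. cmod (\<phi> k y) \<le> M y) F" by blast
  \<comment> \<open>The bounds hold eventually, whereas the compactness lemma wants them for every
    \<open>k\<close>; the default \<open>0\<close> repairs the remaining indices without affecting
    limits.\<close>
  define f where "f = (\<lambda>k y. if cmod (\<phi> k y) \<le> M y then \<phi> k y else 0)"
  obtain G g where G: "G \<le> F'" "G \<noteq> bot" "\<And>y. ((\<lambda>k. f k y) \<longlongrightarrow> g y) G"
  proof (rule pointwise_cluster[OF F', of f "\<lambda>y. \<bar>M y\<bar>"])
    show "cmod (f k a) \<le> \<bar>M a\<bar>" for k a using abs_ge_self[of "M a"] by (auto simp: f_def intro: order_trans)
  qed blast
  have GF: "G \<le> F" using G(1) by (simp add: F'_def)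
  have lim: "((\<lambda>k. \<phi> k y) \<longlongrightarrow> g y) G" if "y \<in> S" for y
  proof (rule Lim_transform_eventually[OF G(3)])
    show "\<forall>\<^sub>F k in G. f k y = \<phi> k y"
      using filter_leD[OF GF M[OF that]] by eventually_elim (simp add: f_def)
  qed
  have "chol I S g"
    by (rule loc_bounded_family_limit(1)[OF I G(2) loc_bounded_family_mono[OF lb GF] lim])
  moreover have "g y = 0" if "y \<in> polydisc I x0 s" "y \<in> S" for y
    using tendsto_unique[OF G(2) lim[OF that(2)] tendsto_mono[OF GF null[OF that]]] .
  ultimately have "g x = 0"
    using chol_identity[OF I _ con x0 _ x] by blast
  then have "eventually (\<lambda>k. cmod (\<phi> k x) < e) G"
    using lim[OF x] e(1) by (auto dest!: tendstoD)
  moreover have "eventually (\<lambda>k. \<not> cmod (\<phi> k x) < e) G"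
    using filter_leD[OF G(1)] by (auto simp: F'_def eventually_inf_principal)
  ultimately have "eventually (\<lambda>k. False) G" by eventually_elim simp
  then show False using G(2) by (simp add: trivial_limit_def)
qed

section \<open>Directional derivatives and the chain rule\<close>

text \<open>\<open>Schwarz_Lipschitz\<close> used twice, for \<open>g\<close> and then for its
  difference quotient at \<open>0\<close>; each use contributes a factor
  \<open>3 / R\<close>.\<close>

lemma Schwarz_second_order:
  assumes g: "g holomorphic_on ball 0 R" and M: "\<And>z. z \<in> ball 0 R \<Longrightarrow> cmod (g z) \<le> M"
    and R: "R > 1"
  shows "cmod (g 1 - g 0 - deriv g 0) \<le> 9 * M / R\<^sup>2"
proof -
  define h where "h = (\<lambda>z. if z = 0 then deriv g 0 else (g z - g 0) / (z - 0))"
  have h: "h holomorphic_on ball 0 R"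
    unfolding h_def by (rule pole_lemma_open[OF g]) auto
  have M0: "M \<ge> 0" using M[of 0] R by (auto intro: order_trans[OF norm_ge_zero])
  have b: "cmod (h z) \<le> 3 * M / R" if "z \<in> ball 0 R" "z \<noteq> 0" for z
    using Schwarz_Lipschitz[OF g M, of z] that by (simp add: h_def norm_divide field_simps)
  have "isCont h 0"
    using holomorphic_on_imp_continuous_on[OF h] R by (simp add: continuous_on_eq_continuous_at)
  then have "h \<midarrow>0\<rightarrow> h 0" by (rule isContD)
  then have "cmod (h 0) \<le> 3 * M / R"
  proof (rule Lim_norm_ubound[rotated])
    show "\<forall>\<^sub>F x in at 0. cmod (h x) \<le> 3 * M / R"
      unfolding eventually_at using R b by (intro exI[of _ R]) (auto simp: dist_norm)
  qed simp
  then have "cmod (h z) \<le> 3 * M / R" if "z \<in> ball 0 R" for z using b[OF that] by (cases "z = 0") auto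
  then have "cmod (h 1 - h 0) \<le> 3 * (3 * M / R) / R * cmod 1"
    by (rule Schwarz_Lipschitz[OF h]) (use R in auto)
  then show ?thesis by (simp add: h_def power2_eq_square)
qed

text \<open>The slice through \<open>x\<close> in direction \<open>v\<close> lives on a disc of
  radius \<open>r / \<delta>\<close>, so the second-order Schwarz bound becomes quadratic in
  \<open>\<delta>\<close>.\<close>

lemma dd_estimate:
  assumes hol: "chol I S \<phi>" and sub: "polydisc I x r \<subseteq> S"
    and M: "\<And>y. y \<in> polydisc I x r \<Longrightarrow> cmod (\<phi> y) \<le> M"
    and d: "0 < \<delta>" "\<delta> < r" "\<And>p. p \<in> I \<Longrightarrow> cmod (v p) \<le> \<delta>"
  shows "cmod (\<phi> (\<lambda>p. x p + v p) - \<phi> x - dd \<phi> x v) \<le> 9 * M / r\<^sup>2 * \<delta>\<^sup>2"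
proof -
  define g where "g = (\<lambda>z. \<phi> (\<lambda>p. x p + z * v p))"
  have mem: "(\<lambda>p. x p + z * v p) \<in> polydisc I x r" if "z \<in> ball 0 (r / \<delta>)" for z
    unfolding mem_polydisc
  proof
    fix p assume p: "p \<in> I"
    have "cmod (z * v p) \<le> cmod z * \<delta>"
      using d(3)[OF p] by (simp add: norm_mult mult_left_mono)
    also have "\<dots> < r" using that d by (simp add: pos_less_divide_eq)
    finally show "cmod (x p + z * v p - x p) < r" by simp
  qed
  have "g holomorphic_on ball 0 (r / \<delta>)"
    unfolding g_def using mem sub by (intro chol_line[OF hol]) auto
  moreover have "cmod (g z) \<le> M" if "z \<in> ball 0 (r / \<delta>)" for z
    unfolding g_def by (intro M mem that)
  ultimately have "cmod (g 1 - g 0 - deriv g 0) \<le> 9 * M / (r / \<delta>)\<^sup>2"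
    by (rule Schwarz_second_order) (use d in auto)
  then show ?thesis by (simp add: g_def dd_def power_divide field_simps)
qed

lemma has_field_derivative_dd:
  assumes "finite I" "chol I S \<phi>" "x \<in> S"
  shows "((\<lambda>z. \<phi> (\<lambda>p. x p + z * v p)) has_field_derivative dd \<phi> x v) (at 0)"
proof -
  obtain r where r: "r > 0" "polydisc I x r \<subseteq> S" using chol_bounded[OF assms(2,3)] by metis
  obtain \<rho> where \<rho>: "\<rho> > 0" "\<And>z. z \<in> ball 0 \<rho> \<Longrightarrow> (\<lambda>p. x p + z * v p) \<in> polydisc I x r"
    using line_in_polydisc[OF assms(1) r(1), of x v] by blast
  have "(\<lambda>z. \<phi> (\<lambda>p. x p + z * v p)) holomorphic_on ball 0 \<rho>"
    by (rule chol_line[OF assms(2)]) (use \<rho> r in auto)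
  then show ?thesis
    unfolding dd_def using \<rho>(1) by (meson centre_in_ball holomorphic_derivI open_ball)
qed

lemma dd_scale:
  assumes "finite I" "chol I S \<phi>" "x \<in> S"
  shows "dd \<phi> x (\<lambda>p. a * v p) = a * dd \<phi> x v"
proof -
  have "((\<lambda>z. \<phi> (\<lambda>p. x p + (a * z) * v p)) has_field_derivative dd \<phi> x v * a) (at 0)"
    by (rule DERIV_chain2[of "\<lambda>z. \<phi> (\<lambda>p. x p + z * v p)" _ "\<lambda>z. a * z"])
      (use has_field_derivative_dd[OF assms] in \<open>auto intro!: derivative_eq_intros\<close>)
  then have "deriv (\<lambda>z. \<phi> (\<lambda>p. x p + (a * z) * v p)) 0 = dd \<phi> x v * a"
    by (rule DERIV_imp_deriv)
  moreover have "(\<lambda>z. \<phi> (\<lambda>p. x p + (a * z) * v p)) = (\<lambda>z. \<phi> (\<lambda>p. x p + z * (a * v p)))"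
    by (simp add: mult_ac)
  ultimately show ?thesis by (simp add: dd_def)
qed

lemma dd_cong:
  assumes "finite I" "chol I S \<phi>" "x \<in> S" "\<And>p. p \<in> I \<Longrightarrow> w p = v p"
  shows "dd \<phi> x w = dd \<phi> x v"
proof -
  obtain r where r: "r > 0" "polydisc I x r \<subseteq> S" using chol_bounded[OF assms(2,3)] by metis
  obtain \<rho> where \<rho>: "\<rho> > 0" "\<And>z. z \<in> ball 0 \<rho> \<Longrightarrow> (\<lambda>p. x p + z * v p) \<in> polydisc I x r"
    using line_in_polydisc[OF assms(1) r(1), of x v] by blast
  have "eventually (\<lambda>z. z \<in> ball 0 \<rho>) (nhds (0::complex))"
    using \<rho>(1) by (intro eventually_nhds_in_open) auto
  then have "eventually (\<lambda>z. \<phi> (\<lambda>p. x p + z * w p) = \<phi> (\<lambda>p. x p + z * v p)) (nhds 0)"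
  proof eventually_elim
    case (elim z)
    then show ?case by (intro chol_cong_coords[OF assms(2)]) (use \<rho> r assms(4) in auto)
  qed
  then show ?thesis unfolding dd_def by (rule deriv_cong_ev) simp
qed

text \<open>Additivity is not built into a derivative along lines; it follows once the mixed second
  difference \<open>Q z\<close> is \<open>O(|z|^2)\<close>. As a function of the step in direction
  \<open>w\<close> that difference is holomorphic and, by the Lipschitz estimate, of size
  \<open>|z|\<close>; Schwarz's lemma yields the second factor \<open>|z|\<close>.\<close>

lemma dd_add:
  assumes I: "finite I" and hol: "chol I S \<phi>" and x: "x \<in> S"
  shows "dd \<phi> x (\<lambda>p. v p + w p) = dd \<phi> x v + dd \<phi> x w"
proof -
  obtain r M where r: "r > 0" "M > 0" "polydisc I x r \<subseteq> S" "\<And>y. y \<in> polydisc I x r \<Longrightarrow> cmod (\<phi> y) \<le> M"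
    using chol_bounded[OF hol x] by metis
  obtain V where V: "V > 0" "\<And>p. p \<in> I \<Longrightarrow> cmod (v p) \<le> V" using bounded_coords[OF I, of v] by blast
  obtain W where W: "W > 0" "\<And>p. p \<in> I \<Longrightarrow> cmod (w p) \<le> W" using bounded_coords[OF I, of w] by blast
  \<comment> \<open>With this radius the two steps together move \<open>x\<close> by at most
    \<open>r/4\<close>, inside the half polydisc where the Lipschitz estimate holds.\<close>
  define \<rho> where "\<rho> = r / (4 * (V + W))"
  have \<rho>: "\<rho> > 0" using r V W by (simp add: \<rho>_def)
  have mem: "(\<lambda>p. x p + z * v p + s * w p) \<in> polydisc I x (r/2)" if "cmod z < \<rho>" "cmod s < \<rho>" for z s
    unfolding mem_polydisc
  proof
    fix p assume p: "p \<in> I"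
    have "cmod (z * v p + s * w p) \<le> cmod z * cmod (v p) + cmod s * cmod (w p)"
      by (rule norm_triangle_le) (simp add: norm_mult)
    also have "\<dots> \<le> \<rho> * V + \<rho> * W"
      using that V W p \<rho> by (intro add_mono mult_mono) auto
    also have "\<dots> = r / 4" using V W by (simp add: \<rho>_def divide_simps) (simp add: algebra_simps)
    finally have "cmod (z * v p + s * w p) \<le> r / 4" .
    then show "cmod (x p + z * v p + s * w p - x p) < r / 2" using r(1) by (simp add: add.assoc)
  qed
  define K where "K = 3 * (6 * M / r * V) / \<rho>"
  define Q where "Q = (\<lambda>z. \<phi> (\<lambda>p. x p + z * (v p + w p)) - \<phi> (\<lambda>p. x p + z * v p) - \<phi> (\<lambda>p. x p + z * w p) + \<phi> x)"
  have QK: "cmod (Q z) \<le> K * (cmod z)\<^sup>2" if z: "cmod z < \<rho>" for z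
  proof -
    define g where "g = (\<lambda>s. \<phi> (\<lambda>p. x p + z * v p + s * w p) - \<phi> (\<lambda>p. x p + s * w p))"
    have sub2: "polydisc I x (r/2) \<subseteq> S" using r polydisc_mono[of "r/2" r I x] by auto
    have mem0: "(\<lambda>p. x p + s * w p) \<in> polydisc I x (r/2)" if "cmod s < \<rho>" for s
      using mem[of 0 s] that \<rho> by simp
    have "g holomorphic_on ball 0 \<rho>"
      unfolding g_def
    proof (intro holomorphic_on_diff)
      show "(\<lambda>s. \<phi> (\<lambda>p. x p + z * v p + s * w p)) holomorphic_on ball 0 \<rho>"
        by (rule chol_line[OF hol, of _ "\<lambda>p. x p + z * v p"]) (use mem z sub2 in auto)
      show "(\<lambda>s. \<phi> (\<lambda>p. x p + s * w p)) holomorphic_on ball 0 \<rho>"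
        by (rule chol_line[OF hol]) (use mem0 sub2 in auto)
    qed
    moreover have "cmod (g s) \<le> 6 * M / r * (V * cmod z)" if "s \<in> ball 0 \<rho>" for s
      unfolding g_def
      by (rule chol_Lipschitz[OF hol r(3) r(4) r(1)])
        (use that z V mem mem0 in \<open>auto simp: norm_mult mult.commute[of V] intro!: mult_left_mono\<close>)
    ultimately have "cmod (g z - g 0) \<le> 3 * (6 * M / r * (V * cmod z)) / \<rho> * cmod z"
      by (rule Schwarz_Lipschitz) (use z in auto)
    moreover have "g z - g 0 = Q z"
      by (simp add: g_def Q_def algebra_simps)
    ultimately show ?thesis by (simp add: K_def power2_eq_square mult_ac)
  qed
  have "(Q has_field_derivative (dd \<phi> x (\<lambda>p. v p + w p) - dd \<phi> x v - dd \<phi> x w)) (at 0)"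
    unfolding Q_def by (auto intro!: derivative_eq_intros has_field_derivative_dd[OF I hol x])
  moreover have "(Q has_field_derivative 0) (at 0)"
  proof -
    have "((\<lambda>z. (Q z - Q 0) / (z - 0)) \<longlongrightarrow> 0) (at 0)"
    proof (rule Lim_null_comparison)
      show "\<forall>\<^sub>F z in at 0. cmod ((Q z - Q 0) / (z - 0)) \<le> K * cmod z"
        unfolding eventually_at using \<rho>
      proof (intro exI[of _ \<rho>] conjI ballI impI)
        fix z :: complex assume "z \<noteq> 0 \<and> dist z 0 < \<rho>"
        then show "cmod ((Q z - Q 0) / (z - 0)) \<le> K * cmod z"
          using QK[of z] by (simp add: Q_def norm_divide field_simps power2_eq_square)
      qed
      show "((\<lambda>z. K * cmod z) \<longlongrightarrow> 0) (at 0)"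
        by (auto intro!: tendsto_eq_intros)
    qed
    then show ?thesis by (simp add: has_field_derivative_iff)
  qed
  ultimately have "dd \<phi> x (\<lambda>p. v p + w p) - dd \<phi> x v - dd \<phi> x w = 0"
    by (rule DERIV_unique)
  then show ?thesis by (simp add: algebra_simps)
qed

abbreviation std_vec :: "'i \<Rightarrow> 'i \<Rightarrow> complex" where
  "std_vec p \<equiv> (\<lambda>q. if q = p then 1 else 0)"

lemma dd_sum:
  assumes I: "finite I" and hol: "chol I S \<phi>" and x: "x \<in> S"
  shows "dd \<phi> x v = (\<Sum>p\<in>I. v p * dd \<phi> x (std_vec p))"
proof -
  have z: "dd \<phi> x (\<lambda>p. 0) = 0" using dd_scale[OF assms, of 0 "\<lambda>p. 0"] by simp
  have "dd \<phi> x (\<lambda>q. if q \<in> J then v q else 0) = (\<Sum>p\<in>J. v p * dd \<phi> x (std_vec p))" if "finite J" for J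
    using that
  proof induction
    case (insert a J)
    have "(\<lambda>q. if q \<in> insert a J then v q else 0) = (\<lambda>q. v a * std_vec a q + (if q \<in> J then v q else 0))"
      using insert by auto
    then show ?case using insert
      by (simp add: dd_add[OF assms] dd_scale[OF assms])
  qed (simp add: z)
  from this[OF I] show ?thesis
    using dd_cong[OF assms, of "\<lambda>q. if q \<in> I then v q else 0" v] by simp
qed

text \<open>The increment of \<open>\<phi>\<close> along the curve is \<open>dd\<close> of
  \<open>c z - x\<close> up to a quadratic error. Near \<open>z0\<close> the difference quotients of
  \<open>c\<close> are bounded by \<open>K\<close>, so after division by \<open>z - z0\<close> the
  error is \<open>O(|z - z0|)\<close>; expanding \<open>dd\<close> in standard vectors reduces the
  limit to finitely many coordinates.\<close>

lemma chol_chain_rule: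
  assumes I: "finite I" and hol: "chol I S \<phi>" and \<Omega>: "open \<Omega>" "z0 \<in> \<Omega>"
    and c: "\<And>p. p \<in> I \<Longrightarrow> (\<lambda>z. c z p) holomorphic_on \<Omega>" "c z0 \<in> S"
  shows "((\<lambda>z. \<phi> (c z)) has_field_derivative dd \<phi> (c z0) (\<lambda>p. deriv (\<lambda>z. c z p) z0)) (at z0)"
proof -
  define x where "x = c z0"
  obtain r M where r: "r > 0" "M > 0" "polydisc I x r \<subseteq> S" "\<And>y. y \<in> polydisc I x r \<Longrightarrow> cmod (\<phi> y) \<le> M"
    using chol_bounded[OF hol c(2)] unfolding x_def by metis
  have D: "((\<lambda>z. (c z p - x p) / (z - z0)) \<longlongrightarrow> deriv (\<lambda>z. c z p) z0) (at z0)" if "p \<in> I" for p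
    using holomorphic_derivI[OF c(1)[OF that] \<Omega>] by (simp add: has_field_derivative_iff x_def)
  obtain V where V: "V > 0" "\<And>p. p \<in> I \<Longrightarrow> cmod (deriv (\<lambda>z. c z p) z0) \<le> V"
    using bounded_coords[OF I, of "\<lambda>p. deriv (\<lambda>z. c z p) z0"] by blast
  define K where "K = V + 1"
  have "eventually (\<lambda>z. \<forall>p\<in>I. cmod ((c z p - x p) / (z - z0)) < K) (at z0)"
  proof (intro eventually_ball_finite I ballI)
    fix p assume p: "p \<in> I"
    show "eventually (\<lambda>z. cmod ((c z p - x p) / (z - z0)) < K) (at z0)"
      by (rule order_tendstoD(2)[OF tendsto_norm[OF D[OF p]]]) (use V(2)[OF p] in \<open>simp add: K_def\<close>)
  qed
  moreover have "eventually (\<lambda>z. z \<noteq> z0) (at z0)" by (simp add: eventually_at_filter)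
  moreover have "eventually (\<lambda>z. cmod (z - z0) < r / K) (at z0)"
    using V r by (auto simp: eventually_at K_def dist_norm intro!: exI[of _ "r / (V + 1)"])
  ultimately have ev: "eventually (\<lambda>z. cmod ((\<phi> (c z) - \<phi> x) / (z - z0) - (\<Sum>p\<in>I. (c z p - x p) / (z - z0) * dd \<phi> x (std_vec p)))
       \<le> 9 * M / r\<^sup>2 * K\<^sup>2 * cmod (z - z0)) (at z0)"
  proof eventually_elim
    case (elim z)
    have K: "K > 0" using V by (simp add: K_def)
    have "cmod (\<phi> (\<lambda>p. x p + (c z p - x p)) - \<phi> x - dd \<phi> x (\<lambda>p. c z p - x p)) \<le> 9 * M / r\<^sup>2 * (K * cmod (z - z0))\<^sup>2"
    proof (rule dd_estimate[OF hol r(3,4)])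
      show "cmod (c z p - x p) \<le> K * cmod (z - z0)" if "p \<in> I" for p
        using elim(1,2) that by (auto simp: norm_divide pos_divide_less_eq less_imp_le)
    qed (use elim K in \<open>auto simp: pos_less_divide_eq mult.commute\<close>)
    then have "cmod (\<phi> (c z) - \<phi> x - (\<Sum>p\<in>I. (c z p - x p) * dd \<phi> x (std_vec p))) / cmod (z - z0) \<le> 9 * M / r\<^sup>2 * (K * cmod (z - z0))\<^sup>2 / cmod (z - z0)"
      using dd_sum[OF I hol c(2), folded x_def, of "\<lambda>p. c z p - x p"] by (intro divide_right_mono) auto
    moreover have "9 * M / r\<^sup>2 * (K * cmod (z - z0))\<^sup>2 / cmod (z - z0) = 9 * M / r\<^sup>2 * K\<^sup>2 * cmod (z - z0)"
      using elim(2) by (simp add: power2_eq_square)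
    moreover have "(\<phi> (c z) - \<phi> x) / (z - z0) - (\<Sum>p\<in>I. (c z p - x p) / (z - z0) * dd \<phi> x (std_vec p))
        = (\<phi> (c z) - \<phi> x - (\<Sum>p\<in>I. (c z p - x p) * dd \<phi> x (std_vec p))) / (z - z0)"
      by (simp add: diff_divide_distrib[of "\<phi> (c z) - \<phi> x"] sum_divide_distrib)
    ultimately show ?case by (simp add: norm_divide)
  qed
  have lim1: "((\<lambda>z. (\<phi> (c z) - \<phi> x) / (z - z0) - (\<Sum>p\<in>I. (c z p - x p) / (z - z0) * dd \<phi> x (std_vec p))) \<longlongrightarrow> 0) (at z0)"
  proof (rule Lim_null_comparison[OF ev])
    show "((\<lambda>z. 9 * M / r\<^sup>2 * K\<^sup>2 * cmod (z - z0)) \<longlongrightarrow> 0) (at z0)"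
      by (intro tendsto_mult_right_zero tendsto_norm_zero LIM_zero tendsto_ident_at)
  qed
  have lim2: "((\<lambda>z. \<Sum>p\<in>I. (c z p - x p) / (z - z0) * dd \<phi> x (std_vec p)) \<longlongrightarrow> (\<Sum>p\<in>I. deriv (\<lambda>z. c z p) z0 * dd \<phi> x (std_vec p))) (at z0)"
    by (intro tendsto_intros D)
  have "((\<lambda>z. (\<phi> (c z) - \<phi> x) / (z - z0)) \<longlongrightarrow> (\<Sum>p\<in>I. deriv (\<lambda>z. c z p) z0 * dd \<phi> x (std_vec p))) (at z0)"
    using tendsto_add[OF lim1 lim2] by (simp only: diff_add_cancel add_0)
  then show ?thesis
    unfolding has_field_derivative_iff x_def by (subst dd_sum[OF I hol c(2)])
qed

lemma chol_continuous:
  assumes J: "finite J" and f: "\<And>p. p \<in> J \<Longrightarrow> chol I S (\<lambda>x. f x p)"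
    and S: "pd_open I S" and x: "x \<in> S" and r: "r > 0"
  shows "\<exists>s>0. polydisc I x s \<subseteq> S \<and> (\<forall>y\<in>polydisc I x s. f y \<in> polydisc J (f x) r)"
proof -
  have "\<exists>s>0. polydisc I x s \<subseteq> S \<and> (\<forall>y\<in>polydisc I x s. cmod (f y p - f x p) < r)" if p: "p \<in> J" for p
  proof -
    obtain s N where s: "s > 0" "N > 0" "polydisc I x s \<subseteq> S" "\<And>y. y \<in> polydisc I x s \<Longrightarrow> cmod (f y p) \<le> N"
      using chol_bounded[OF f[OF p] x] by metis
    define \<delta> where "\<delta> = min (s/2) (r * s / (6 * N) / 2)"
    have \<delta>: "\<delta> > 0" "\<delta> < s" "3 * N / s * \<delta> < r"
    proof -
      show "\<delta> > 0" using s r by (simp add: \<delta>_def)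
      show "\<delta> < s" using s by (auto simp: \<delta>_def)
      have "3 * N / s * \<delta> \<le> 3 * N / s * (r * s / (6 * N) / 2)"
        using s by (intro mult_left_mono) (auto simp: \<delta>_def)
      also have "\<dots> < r" using s r by simp
      finally show "3 * N / s * \<delta> < r" .
    qed
    have "cmod (f y p - f x p) < r" if y: "y \<in> polydisc I x \<delta>" for y
    proof -
      have "cmod (f y p - f x p) \<le> 3 * N / s * \<delta>"
        by (rule chol_Lipschitz0[OF f[OF p] s(3,4) \<delta>(1,2)]) (use y in \<open>auto simp: mem_polydisc less_imp_le\<close>)
      then show ?thesis using \<delta>(3) by simp
    qed
    moreover have "polydisc I x \<delta> \<subseteq> S" using polydisc_mono[of \<delta> s I x] \<delta> s by auto
    ultimately show ?thesis using \<delta>(1) by blast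
  qed
  then obtain s where s: "\<And>p. p \<in> J \<Longrightarrow> s p > 0 \<and> (\<forall>y\<in>polydisc I x (s p). cmod (f y p - f x p) < r)"
    by metis
  obtain s0 where s0: "s0 > 0" "polydisc I x s0 \<subseteq> S" using S x unfolding pd_open_def by blast
  define d where "d = Min (insert s0 (s ` J))"
  have d: "d > 0" "d \<le> s0" "\<And>p. p \<in> J \<Longrightarrow> d \<le> s p" using J s s0 by (auto simp: d_def)
  have "f y \<in> polydisc J (f x) r" if "y \<in> polydisc I x d" for y
    unfolding mem_polydisc using s d(3) polydisc_mono that by blast
  moreover have "polydisc I x d \<subseteq> S" using s0 d polydisc_mono[of d s0 I x] by auto
  ultimately show ?thesis using d(1) by blast
qed

text \<open>Holomorphy along curves composes at once, since \<open>f\<close> maps holomorphic curves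
  to holomorphic curves. Local boundedness is inherited through the continuity of
  \<open>f\<close>.\<close>

lemma chol_compose:
  assumes I: "finite I" and J: "finite J"
    and \<phi>: "chol J T \<phi>" and f: "\<And>p. p \<in> J \<Longrightarrow> chol I S (\<lambda>x. f x p)"
    and S: "pd_open I S" and ST: "\<And>x. x \<in> S \<Longrightarrow> f x \<in> T"
  shows "chol I S (\<lambda>x. \<phi> (f x))"
proof (rule cholI)
  fix x assume x: "x \<in> S"
  obtain r M where r: "r > 0" "\<And>y. y \<in> polydisc J (f x) r \<Longrightarrow> cmod (\<phi> y) \<le> M"
    using chol_bounded[OF \<phi> ST[OF x]] by metis
  obtain s where s: "s > 0" "polydisc I x s \<subseteq> S" "\<And>y. y \<in> polydisc I x s \<Longrightarrow> f y \<in> polydisc J (f x) r"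
    using chol_continuous[of J I S f x r] J f S x r(1) by blast
  then show "\<exists>r>0. \<exists>M. polydisc I x r \<subseteq> S \<and> (\<forall>y\<in>polydisc I x r. cmod (\<phi> (f y)) \<le> M)"
    using r by (intro loc_boundI[of s]) auto
next
  fix \<Omega> :: "complex set" and c :: "complex \<Rightarrow> 'a \<Rightarrow> complex"
  assume c: "open \<Omega>" "\<And>p. p \<in> I \<Longrightarrow> (\<lambda>z. c z p) holomorphic_on \<Omega>" "\<And>z. z \<in> \<Omega> \<Longrightarrow> c z \<in> S"
  show "(\<lambda>z. \<phi> (f (c z))) holomorphic_on \<Omega>"
    by (rule chol_curve[OF \<phi> c(1)]) (use chol_curve[OF f c(1)] c ST in auto)
qed

lemma dd_compose:
  assumes I: "finite I" and J: "finite J"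
    and \<phi>: "chol J T \<phi>" and f: "\<And>p. p \<in> J \<Longrightarrow> chol I S (\<lambda>x. f x p)"
    and x: "x \<in> S" and ST: "f x \<in> T"
  shows "dd (\<lambda>x. \<phi> (f x)) x v = dd \<phi> (f x) (\<lambda>p. dd (\<lambda>x. f x p) x v)"
proof (cases "J = {}")
  \<comment> \<open>Without coordinate functions there is no source for a polydisc around
    \<open>x\<close> inside \<open>S\<close>, but \<open>\<phi>\<close> is then constant.\<close>
  case True
  have c: "\<phi> y = \<phi> (f x)" for y
    by (rule chol_cong_coords[OF \<phi> ST]) (simp add: True)
  then have "\<phi> = (\<lambda>y. \<phi> (f x))" by auto
  then show ?thesis unfolding dd_def by (metis deriv_const)
next
  case False
  then obtain r where r: "r > 0" "polydisc I x r \<subseteq> S" using f x chol_bounded by (metis all_not_in_conv)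
  obtain \<rho> where \<rho>: "\<rho> > 0" "\<And>z. z \<in> ball 0 \<rho> \<Longrightarrow> (\<lambda>p. x p + z * v p) \<in> polydisc I x r"
    using line_in_polydisc[OF I r(1), of x v] by blast
  have "((\<lambda>z. \<phi> (f (\<lambda>p. x p + z * v p))) has_field_derivative
     dd \<phi> (f (\<lambda>p. x p + 0 * v p)) (\<lambda>q. deriv (\<lambda>z. f (\<lambda>p. x p + z * v p) q) 0)) (at 0)"
  proof (rule chol_chain_rule[OF J \<phi>, of "ball 0 \<rho>"])
    fix q assume "q \<in> J"
    then show "(\<lambda>z. f (\<lambda>p. x p + z * v p) q) holomorphic_on ball 0 \<rho>"
      by (intro chol_line[OF f]) (use \<rho> r in auto)
  qed (use \<rho> ST in auto)
  then show ?thesis by (auto simp: dd_def dest: DERIV_imp_deriv)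
qed

text \<open>The derivative is the limit of difference quotients as \<open>s\<close> tends to
  \<open>0\<close>. By the Lipschitz estimate these are bounded by \<open>6 * M / r * V\<close> on
  the quarter polydisc, so they form a locally bounded family.\<close>

lemma chol_dd:
  assumes I: "finite I" and hol: "chol I S \<phi>"
  shows "chol I S (\<lambda>x. dd \<phi> x v)"
proof (rule loc_bounded_family_limit(1)[where F = "at (0::complex)" and \<phi> = "\<lambda>s x. (\<phi> (\<lambda>p. x p + s * v p) - \<phi> x) / s"])
  show "loc_bounded_family I S (at 0) (\<lambda>s x. (\<phi> (\<lambda>p. x p + s * v p) - \<phi> x) / s)"
    unfolding loc_bounded_family_def
  proof
    fix x assume x: "x \<in> S"
    obtain r M where r: "r > 0" "M > 0" "polydisc I x r \<subseteq> S" "\<And>y. y \<in> polydisc I x r \<Longrightarrow> cmod (\<phi> y) \<le> M"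
      using chol_bounded[OF hol x] by metis
    obtain V where V: "V > 0" "\<And>p. p \<in> I \<Longrightarrow> cmod (v p) \<le> V" using bounded_coords[OF I, of v] by blast
    have subS: "polydisc I x (r/4) \<subseteq> polydisc I x (r/2)" "polydisc I x (r/2) \<subseteq> S"
      using r polydisc_mono[of "r/2" r I x] polydisc_mono[of "r/4" "r/2" I x] by auto
    have pos: "r / 4 > 0" and sub4: "polydisc I x (r/4) \<subseteq> S" using r subS by auto
    have "eventually (\<lambda>s. chol I (polydisc I x (r/4)) (\<lambda>x. (\<phi> (\<lambda>p. x p + s * v p) - \<phi> x) / s) \<and>
        (\<forall>y\<in>polydisc I x (r/4). cmod ((\<phi> (\<lambda>p. y p + s * v p) - \<phi> y) / s) \<le> 6 * M / r * V)) (at 0)"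
      unfolding eventually_at
    proof (intro exI[of _ "r / (4 * V)"] conjI ballI impI)
      show "0 < r / (4 * V)" using r V by simp
      fix s :: complex assume s: "s \<noteq> 0 \<and> dist s 0 < r / (4 * V)"
      have sv: "cmod (s * v p) < r / 4" if "p \<in> I" for p
      proof -
        have "cmod (s * v p) \<le> cmod s * V" using V(2)[OF that] by (simp add: norm_mult mult_left_mono)
        also have "\<dots> < r / 4" using s V by (simp add: field_simps)
        finally show ?thesis .
      qed
      have sh: "(\<lambda>p. y p + s * v p) \<in> polydisc I x (r/2)" if "y \<in> polydisc I x (r/4)" for y
        unfolding mem_polydisc
      proof
        fix p assume p: "p \<in> I"
        then have "cmod (y p - x p) < r / 4" using that by (simp add: mem_polydisc)
        then show "cmod (y p + s * v p - x p) < r / 2"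
          using sv[OF p] norm_triangle_ineq[of "y p - x p" "s * v p"] by (simp add: algebra_simps)
      qed
      have "chol I (polydisc I x (r/4)) (\<lambda>y. \<phi> (\<lambda>p. y p + s * v p))"
        by (rule chol_compose[OF I I hol])
          (use sh subS I in \<open>auto intro!: chol_add chol_coord chol_const pd_open_polydisc\<close>)
      moreover have "chol I (polydisc I x (r/4)) \<phi>"
        by (rule chol_subset[OF hol]) (use subS I pd_open_polydisc in auto)
      ultimately have "chol I (polydisc I x (r/4)) (\<lambda>y. (\<phi> (\<lambda>p. y p + s * v p) - \<phi> y) * (1 / s))"
        by (intro chol_mult chol_diff chol_const pd_open_polydisc I)
      then show "chol I (polydisc I x (r/4)) (\<lambda>y. (\<phi> (\<lambda>p. y p + s * v p) - \<phi> y) / s)" by simp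
      fix y assume y: "y \<in> polydisc I x (r/4)"
      have "cmod (\<phi> (\<lambda>p. y p + s * v p) - \<phi> y) \<le> 6 * M / r * (cmod s * V)"
        by (rule chol_Lipschitz[OF hol r(3,4,1)])
          (use y sh subS V in \<open>auto simp: norm_mult mult_left_mono\<close>)
      then show "cmod ((\<phi> (\<lambda>p. y p + s * v p) - \<phi> y) / s) \<le> 6 * M / r * V"
        using s by (simp add: norm_divide field_simps)
    qed
    then show "\<exists>r>0. \<exists>M. polydisc I x r \<subseteq> S \<and>
        eventually (\<lambda>s. chol I (polydisc I x r) (\<lambda>x. (\<phi> (\<lambda>p. x p + s * v p) - \<phi> x) / s) \<and>
        (\<forall>y\<in>polydisc I x r. cmod ((\<phi> (\<lambda>p. y p + s * v p) - \<phi> y) / s) \<le> M)) (at 0)"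
      using pos sub4 by blast
  qed
  show "((\<lambda>s. (\<phi> (\<lambda>p. x p + s * v p) - \<phi> x) / s) \<longlongrightarrow> dd \<phi> x v) (at 0)" if "x \<in> S" for x
    using has_field_derivative_dd[OF I hol that, of v] by (simp add: has_field_derivative_iff)
qed (use I in auto)

section \<open>Homogeneous expansions on circular domains\<close>

definition unity_root :: "nat \<Rightarrow> nat \<Rightarrow> complex" where
  "unity_root m j = exp (2 * of_real pi * \<i> * of_nat j / of_nat m)"

lemma norm_unity_root [simp]: "cmod (unity_root m j) = 1"
proof -
  have "2 * of_real pi * \<i> * of_nat j / of_nat m = \<i> * of_real (2 * pi * j / m)" by simp
  then show ?thesis unfolding unity_root_def by (simp only: norm_exp_i_times)
qed

lemma unity_root_power: "unity_root m j ^ k = unity_root m k ^ j"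
proof -
  have "unity_root m j ^ k = exp (of_nat k * (2 * of_real pi * \<i> * of_nat j / of_nat m))"
    for j k by (simp only: unity_root_def exp_of_nat_mult)
  moreover have "of_nat k * (2 * of_real pi * \<i> * of_nat j / of_nat m) = of_nat j * (2 * of_real pi * \<i> * of_nat k / of_nat m)"
    by simp
  ultimately show ?thesis by metis
qed

text \<open>A discretised Fourier integral of \<open>g\<close> against \<open>u^a * cnj u^b\<close>
  over the unit circle. A finite sum of rotations stays visibly holomorphic in parameters. Keeping
  \<open>a\<close> and \<open>b\<close> apart allows a negative difference and lets products of
  geometric sums appear later.\<close>

definition root_average :: "nat \<Rightarrow> nat \<Rightarrow> nat \<Rightarrow> (complex \<Rightarrow> complex) \<Rightarrow> complex" where
  "root_average m a b g =
     (\<Sum>j<m. g (unity_root m j) * unity_root m j ^ a * cnj (unity_root m j) ^ b) / of_nat m"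

lemma root_average_norm:
  assumes "\<And>u. cmod u = 1 \<Longrightarrow> cmod (g u) \<le> B" "B \<ge> 0"
  shows "cmod (root_average m a b g) \<le> B"
proof -
  have "cmod (\<Sum>j<m. g (unity_root m j) * unity_root m j ^ a * cnj (unity_root m j) ^ b) \<le> (\<Sum>j<m. B)"
    by (rule sum_norm_le) (simp add: norm_mult norm_power assms)
  then show ?thesis using assms(2)
    by (cases "m = 0") (auto simp: root_average_def norm_divide field_simps)
qed

lemma root_average_power_equal: "m > 0 \<Longrightarrow> i + a = b \<Longrightarrow> root_average m a b (\<lambda>z. z ^ i) = 1"
proof -
  assume m: "m > 0" and i: "i + a = b"
  have "unity_root m j ^ i * unity_root m j ^ a * cnj (unity_root m j) ^ b = 1" for j
  proof -
    have "unity_root m j ^ i * unity_root m j ^ a * cnj (unity_root m j) ^ b = (unity_root m j * cnj (unity_root m j)) ^ b"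
      using i by (simp add: power_add[symmetric] power_mult_distrib)
    also have "unity_root m j * cnj (unity_root m j) = 1"
      by (simp add: complex_norm_square[symmetric])
    finally show ?thesis by simp
  qed
  then show ?thesis using m by (simp add: root_average_def)
qed

text \<open>A full geometric sum over an \<open>m\<close>-th root of unity \<open>w\<close> other
  than \<open>1\<close>. The bound on \<open>m\<close> excludes aliasing: \<open>i + a\<close> and
  \<open>b\<close> cannot agree modulo \<open>m\<close> without being equal.\<close>

lemma root_average_power_unequal:
  assumes "i + a \<noteq> b" "i + a + b < m"
  shows "root_average m a b (\<lambda>z. z ^ i) = 0"
proof -
  have m: "m > 0" using assms by simp
  define w where "w = unity_root m (i + a) * cnj (unity_root m b)"
  have t: "unity_root m j ^ i * unity_root m j ^ a * cnj (unity_root m j) ^ b = w ^ j" for j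
  proof -
    have "unity_root m j ^ i * unity_root m j ^ a = unity_root m (i + a) ^ j"
      by (simp only: power_add[symmetric] unity_root_power[of m j "i + a"])
    moreover have "cnj (unity_root m j) ^ b = cnj (unity_root m b) ^ j"
      by (metis complex_cnj_power unity_root_power)
    ultimately show ?thesis by (simp add: w_def power_mult_distrib)
  qed
  have "w \<noteq> 1"
  proof
    assume "w = 1"
    have "unity_root m b = w * unity_root m b" using \<open>w = 1\<close> by simp
    also have "\<dots> = unity_root m (i + a) * (unity_root m b * cnj (unity_root m b))" by (simp add: w_def mult_ac)
    also have "\<dots> = unity_root m (i + a)" by (simp add: complex_norm_square[symmetric])
    finally have "b mod m = (i + a) mod m"
      using complex_root_unity_eq[of m b "i + a"] m by (simp add: unity_root_def)
    then show False using assms by simp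
  qed
  moreover have "w ^ m = 1"
    using m complex_root_unity[of m "i + a"] complex_root_unity[of m b]
    by (simp add: w_def power_mult_distrib unity_root_def complex_cnj_power[symmetric] del: complex_cnj_power)
  ultimately have "(\<Sum>j<m. w ^ j) = 0"
    by (simp add: sum_gp_strict)
  then show ?thesis by (simp add: root_average_def t)
qed

definition taylor_coeff :: "(complex \<Rightarrow> complex) \<Rightarrow> nat \<Rightarrow> complex" where
  "taylor_coeff g l = (deriv ^^ l) g 0 / fact l"

lemma taylor_coeff_sums:
  assumes "g holomorphic_on ball 0 R" "cmod z < R"
  shows "(\<lambda>l. taylor_coeff g l * z ^ l) sums g z"
  using holomorphic_power_series[OF assms(1), of z] assms(2) by (simp add: taylor_coeff_def)

lemma taylor_coeff_summable:
  assumes "g holomorphic_on ball 0 R" "R > 1"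
  shows "summable (\<lambda>l. cmod (taylor_coeff g l))"
proof -
  have "summable (\<lambda>l. taylor_coeff g l * of_real ((R + 1) / 2) ^ l)"
    by (rule sums_summable[OF taylor_coeff_sums[OF assms(1)]]) (use assms(2) in simp)
  then have "summable (\<lambda>l. cmod (taylor_coeff g l * 1 ^ l))"
    by (rule powser_insidea) (use assms(2) in simp)
  then show ?thesis by simp
qed

text \<open>Tannery's theorem with the moduli of the Taylor coefficients as majorants; a radius
  above \<open>1\<close> makes them summable. Each monomial contributes its exact Fourier
  coefficient as soon as \<open>m\<close> exceeds \<open>i + a + b\<close>.\<close>

lemma root_average_limit:
  assumes g: "g holomorphic_on ball 0 R" and R: "R > 1"
  shows "(\<lambda>m. root_average m a b g) \<longlonglongrightarrow> (if a \<le> b then taylor_coeff g (b - a) else 0)"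
proof -
  have sm: "summable (\<lambda>l. cmod (taylor_coeff g l))" by (rule taylor_coeff_summable[OF assms])
  define f where "f = (\<lambda>i m. taylor_coeff g i * root_average m a b (\<lambda>z. z ^ i))"
  define c where "c = (\<lambda>i. if i + a = b then taylor_coeff g i else 0)"
  have "((\<lambda>m. suminf (\<lambda>i. f i m)) \<longlongrightarrow> suminf c) sequentially"
  proof (rule tannerys_theorem[where M = "\<lambda>l. cmod (taylor_coeff g l)", THEN conjunct2, THEN conjunct2])
    fix i
    have "eventually (\<lambda>m. f i m = c i) sequentially"
      using eventually_gt_at_top[of "i + a + b"]
    proof eventually_elim
      case (elim m)
      then show ?case
        using root_average_power_equal[of m i a b] root_average_power_unequal[of i a b m]
        by (auto simp: f_def c_def)
    qed
    then show "(\<lambda>m. f i m) \<longlonglongrightarrow> c i" by (rule tendsto_eventually)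
  next
    have "cmod (f i m) \<le> cmod (taylor_coeff g i)" for i m
      using root_average_norm[of "\<lambda>z. z ^ i" 1 m a b]
      by (simp add: f_def norm_mult norm_power mult_left_le)
    then show "eventually (\<lambda>(k,n). cmod (f k n) \<le> cmod (taylor_coeff g k)) (at_top \<times>\<^sub>F sequentially)"
      by (intro always_eventually) auto
  qed (use sm in auto)
  moreover have "suminf (\<lambda>i. f i m) = root_average m a b g" for m
  proof -
    have "(\<lambda>i. (\<Sum>j<m. taylor_coeff g i * unity_root m j ^ i * (unity_root m j ^ a * cnj (unity_root m j) ^ b)) / of_nat m) sums
       ((\<Sum>j<m. g (unity_root m j) * (unity_root m j ^ a * cnj (unity_root m j) ^ b)) / of_nat m)"
      by (intro sums_divide sums_sum sums_mult2 taylor_coeff_sums[OF g]) (use R in simp)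
    then have "(\<lambda>i. f i m) sums root_average m a b g"
      by (simp add: f_def root_average_def sum_distrib_left mult.assoc)
    then show ?thesis by (simp add: sums_iff)
  qed
  moreover have "suminf c = (if a \<le> b then taylor_coeff g (b - a) else 0)"
  proof (cases "a \<le> b")
    case True
    then have "i + a = b \<longleftrightarrow> i = b - a" for i by auto
    then have "c = (\<lambda>i. if i = b - a then taylor_coeff g i else 0)" by (simp add: c_def)
    then show ?thesis using True sums_single[of "b - a" "taylor_coeff g"] by (simp add: sums_iff)
  next
    case False
    then have "c = (\<lambda>i. 0)" by (auto simp: c_def)
    then show ?thesis using False by simp
  qed
  ultimately show ?thesis by simp
qed

lemma cesaro_null:
  fixes s :: "nat \<Rightarrow> complex"
  assumes "s \<longlonglongrightarrow> 0" shows "(\<lambda>n. (\<Sum>b<n. s b) / of_nat n) \<longlonglongrightarrow> 0"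
proof (rule tendstoI)
  fix e :: real assume e: "e > 0"
  obtain N where N: "\<And>b. b \<ge> N \<Longrightarrow> cmod (s b) < e / 2"
    using LIMSEQ_D[OF assms, of "e/2"] e by auto
  define K where "K = (\<Sum>b<N. cmod (s b))"
  have "eventually (\<lambda>n. real n > 2 * K / e) sequentially"
    using filterlim_real_sequentially by (simp add: filterlim_at_top_dense)
  then show "eventually (\<lambda>n. dist ((\<Sum>b<n. s b) / of_nat n) 0 < e) sequentially"
    using eventually_gt_at_top[of N]
  proof eventually_elim
    case (elim n)
    have "cmod (\<Sum>b<n. s b) \<le> (\<Sum>b<n. cmod (s b))" by (rule norm_sum)
    also have "(\<Sum>b<n. cmod (s b)) = K + (\<Sum>b=N..<n. cmod (s b))"
      unfolding K_def lessThan_atLeast0 using elim by (subst sum.atLeastLessThan_concat) auto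
    also have "(\<Sum>b=N..<n. cmod (s b)) \<le> (\<Sum>b=N..<n. e/2)"
      by (rule sum_mono) (use N in \<open>auto intro: less_imp_le\<close>)
    also have "\<dots> \<le> real n * (e/2)" using e by simp
    also have "K + real n * (e/2) < real n * e" using elim e by (simp add: field_simps)
    finally show ?case using elim by (simp add: norm_divide field_simps)
  qed
qed

definition circled :: "('i \<Rightarrow> complex) set \<Rightarrow> bool" where
  "circled S \<longleftrightarrow> (\<forall>x\<in>S. \<forall>u. cmod u = 1 \<longrightarrow> (\<lambda>p. u * x p) \<in> S)"

text \<open>The homogeneous component of degree \<open>l\<close> in the expansion at
  \<open>0\<close>, read off the slice through \<open>x\<close>. Small \<open>z\<close> decide it,
  so for \<open>\<psi>\<close> holomorphic near \<open>0\<close> it makes sense at every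
  \<open>x\<close>, wherever the slice goes later.\<close>

definition hom_part :: "(('i \<Rightarrow> complex) \<Rightarrow> complex) \<Rightarrow> nat \<Rightarrow> ('i \<Rightarrow> complex) \<Rightarrow> complex" where
  "hom_part \<psi> l x = taylor_coeff (\<lambda>z. \<psi> (\<lambda>p. z * x p)) l"

lemma hom_part_1: "hom_part \<psi> 1 x = dd \<psi> (\<lambda>p. 0) x"
  by (simp add: hom_part_def taylor_coeff_def dd_def)

locale circled_domain =
  fixes I :: "'i set" and S :: "('i \<Rightarrow> complex) set"
  assumes fin: "finite I" and opn: "pd_open I S" and con: "pd_connected I S"
    and circ: "circled S" and zero: "(\<lambda>p. 0) \<in> S"
    and bdd: "\<exists>R. S \<subseteq> polydisc I (\<lambda>p. 0) R"
begin

lemma rotate: "x \<in> S \<Longrightarrow> cmod u = 1 \<Longrightarrow> (\<lambda>p. u * x p) \<in> S"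
  using circ by (auto simp: circled_def)

text \<open>Compactness of the circle: polydiscs around finitely many rotated copies of
  \<open>x\<close> suffice, which yields one bound for all rotations of all points near
  \<open>x\<close>.\<close>

lemma rotation_bounded:
  assumes \<psi>: "chol I S \<psi>" and x: "x \<in> S"
  shows "\<exists>r>0. \<exists>M. polydisc I x r \<subseteq> S \<and> (\<forall>y\<in>polydisc I x r. \<forall>u. cmod u = 1 \<longrightarrow> cmod (\<psi> (\<lambda>p. u * y p)) \<le> M)"
proof -
  obtain V where V: "V > 0" "\<And>p. p \<in> I \<Longrightarrow> cmod (x p) \<le> V" using bounded_coords[OF fin, of x] by blast
  have "\<exists>r M. r > 0 \<and> (\<forall>y\<in>polydisc I (\<lambda>p. u * x p) r. cmod (\<psi> y) \<le> M)" if "u \<in> sphere 0 1" for u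
  proof -
    have "(\<lambda>p. u * x p) \<in> S" using that by (intro rotate x) simp
    then show ?thesis by (metis chol_bounded[OF \<psi>])
  qed
  then obtain r M where rM: "\<And>u. u \<in> sphere 0 1 \<Longrightarrow> r u > 0"
      "\<And>u y. u \<in> sphere 0 1 \<Longrightarrow> y \<in> polydisc I (\<lambda>p. u * x p) (r u) \<Longrightarrow> cmod (\<psi> y) \<le> M u"
    by metis
  \<comment> \<open>Half of the radius \<open>r u\<close> pays for replacing a rotation by one from
    the finite net, the other half for moving the point.\<close>
  have "sphere (0::complex) 1 \<subseteq> (\<Union>u\<in>sphere 0 1. ball u (r u / (2 * V)))"
    using rM(1) V by force
  then obtain N where N: "N \<subseteq> sphere (0::complex) 1" "finite N" "sphere 0 1 \<subseteq> (\<Union>u\<in>N. ball u (r u / (2 * V)))"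
    using compactE_image[OF compact_sphere, of "sphere 0 1" "\<lambda>u. ball u (r u / (2 * V))" "0::complex" 1] by auto
  obtain r0 where r0: "r0 > 0" "polydisc I x r0 \<subseteq> S" using opn x unfolding pd_open_def by blast
  define d where "d = Min (insert r0 ((\<lambda>u. r u / 2) ` N))"
  have d1: "d > 0" "d \<le> r0"
    using N(2) rM(1)[OF subsetD[OF N(1)]] r0 by (auto simp: d_def)
  have d2: "d \<le> r u / 2" if "u \<in> N" for u
    unfolding d_def using N(2) that by (intro Min_le) auto
  note d = d1 d2
  have "cmod (\<psi> (\<lambda>p. u * y p)) \<le> (\<Sum>u\<in>N. \<bar>M u\<bar>)" if y: "y \<in> polydisc I x d" and u: "cmod u = 1" for y u
  proof -
    have "u \<in> sphere 0 1" using u by simp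
    then obtain w where w: "w \<in> N" "u \<in> ball w (r w / (2 * V))" using N(3) by blast
    have "(\<lambda>p. u * y p) \<in> polydisc I (\<lambda>p. w * x p) (r w)"
      unfolding mem_polydisc
    proof
      fix p assume p: "p \<in> I"
      have "u * y p - w * x p = u * (y p - x p) + (u - w) * x p" by (simp add: algebra_simps)
      then have "cmod (u * y p - w * x p) \<le> cmod (u * (y p - x p)) + cmod ((u - w) * x p)"
        using norm_triangle_ineq by metis
      also have "cmod (u * (y p - x p)) < r w / 2"
        using y p d(3)[OF w(1)] u by (auto simp: mem_polydisc norm_mult)
      also have "cmod ((u - w) * x p) \<le> cmod (u - w) * V" using V(2)[OF p] by (simp add: norm_mult mult_left_mono)
      also have "\<dots> \<le> r w / 2" using w(2) V(1) by (simp add: dist_norm norm_minus_commute field_simps)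
      finally show "cmod (u * y p - w * x p) < r w" by simp
    qed
    then have "cmod (\<psi> (\<lambda>p. u * y p)) \<le> M w" using rM(2) N w by blast
    also have "M w \<le> \<bar>M w\<bar>" by simp
    also have "\<dots> \<le> (\<Sum>u\<in>N. \<bar>M u\<bar>)" using N w by (intro member_le_sum) auto
    finally show ?thesis .
  qed
  moreover have "polydisc I x d \<subseteq> S" using r0 d polydisc_mono[of d r0 I x] by auto
  ultimately show ?thesis using d(1) by blast
qed

lemma slice_holomorphic:
  assumes \<psi>: "chol I S \<psi>" and r: "polydisc I (\<lambda>p. 0) r \<subseteq> S" and y: "y \<in> polydisc I (\<lambda>p. 0) (r/2)"
  shows "\<exists>R>1. (\<lambda>z. \<psi> (\<lambda>p. z * y p)) holomorphic_on ball 0 R"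
proof -
  have "(\<lambda>z. \<psi> (\<lambda>p. 0 + z * y p)) holomorphic_on ball 0 2"
  proof (rule chol_line[OF \<psi>])
    fix z :: complex assume z: "z \<in> ball 0 2"
    have "cmod (z * y p) < r" if "p \<in> I" for p
    proof -
      have "cmod (y p) < r / 2" using y that by (simp add: mem_polydisc)
      moreover have "cmod z * cmod (y p) \<le> 2 * cmod (y p)" using z by (intro mult_right_mono) auto
      ultimately show ?thesis by (simp add: norm_mult)
    qed
    then show "(\<lambda>p. 0 + z * y p) \<in> S" using r by (auto simp: mem_polydisc subset_iff)
  qed simp
  then show ?thesis by (intro exI[of _ 2]) simp
qed

lemma zero_polydisc: obtains r where "r > 0" "polydisc I (\<lambda>p. 0) r \<subseteq> S"
  using opn zero unfolding pd_open_def by blast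

text \<open>Here \<open>a x\<close> may lie outside \<open>S\<close>: both sides are derivatives at
  \<open>0\<close> of slices, related by the substitution of \<open>a z\<close> for \<open>z\<close>
  on a small enough disc.\<close>

lemma hom_part_scale:
  assumes \<psi>: "chol I S \<psi>"
  shows "hom_part \<psi> l (\<lambda>p. a * x p) = a ^ l * hom_part \<psi> l x"
proof -
  obtain r where r: "r > 0" "polydisc I (\<lambda>p. 0) r \<subseteq> S" by (rule zero_polydisc)
  obtain \<rho> where \<rho>: "\<rho> > 0" "\<And>z. z \<in> ball 0 \<rho> \<Longrightarrow> (\<lambda>p. 0 + z * x p) \<in> polydisc I (\<lambda>p. 0) r"
    using line_in_polydisc[OF fin r(1), of "\<lambda>p. 0" x] by blast
  define g where "g = (\<lambda>z. \<psi> (\<lambda>p. 0 + z * x p))"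
  have g: "g holomorphic_on ball 0 \<rho>"
    unfolding g_def by (rule chol_line[OF \<psi>]) (use \<rho> r in auto)
  define s where "s = \<rho> / (cmod a + 1)"
  have s: "s > 0" using \<rho> by (simp add: s_def add_nonneg_pos)
  have "a * w \<in> ball 0 \<rho>" if "w \<in> ball 0 s" for w
  proof -
    have "cmod (a * w) \<le> (cmod a + 1) * cmod w" by (simp add: norm_mult mult_right_mono)
    also have "\<dots> < \<rho>" using that by (simp add: s_def pos_less_divide_eq add_nonneg_pos mult.commute)
    finally show ?thesis by simp
  qed
  then have "(deriv ^^ l) (\<lambda>w. g (a * w)) 0 = a ^ l * (deriv ^^ l) g (a * 0)"
    using s by (intro higher_deriv_compose_linear[OF g, of "ball 0 s"]) auto
  moreover have "(\<lambda>w. g (a * w)) = (\<lambda>z. \<psi> (\<lambda>p. z * (a * x p)))" by (simp add: g_def mult_ac)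
  ultimately show ?thesis by (simp add: hom_part_def taylor_coeff_def g_def)
qed

lemma chol_root_average:
  assumes \<psi>: "chol I S \<psi>"
  shows "chol I S (\<lambda>x. root_average m a b (\<lambda>u. \<psi> (\<lambda>p. u * x p)))"
proof -
  have *: "chol I S (\<lambda>x. \<psi> (\<lambda>p. unity_root m j * x p))" for j
    by (rule chol_compose[OF fin fin \<psi> _ opn])
      (auto intro!: chol_mult chol_coord chol_const opn rotate)
  have "chol I S (\<lambda>x. (\<Sum>j<m. \<psi> (\<lambda>p. unity_root m j * x p) * unity_root m j ^ a * cnj (unity_root m j) ^ b) * (1 / of_nat m))"
    by (intro chol_mult chol_sum chol_const opn *)
  then show ?thesis by (simp add: root_average_def)
qed

lemma root_average_family_bounded:
  assumes \<psi>: "chol I S \<psi>" and x: "x \<in> S"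
  shows "\<exists>r>0. \<exists>M. polydisc I x r \<subseteq> S \<and> (\<forall>y\<in>polydisc I x r. \<forall>m a b.
           cmod (root_average m a b (\<lambda>u. \<psi> (\<lambda>p. u * y p))) \<le> M)"
proof -
  obtain r M where r: "r > 0" "polydisc I x r \<subseteq> S"
    "\<And>y u. y \<in> polydisc I x r \<Longrightarrow> cmod u = 1 \<Longrightarrow> cmod (\<psi> (\<lambda>p. u * y p)) \<le> M"
    using rotation_bounded[OF assms] by metis
  have "M \<ge> 0" using r(3)[of x 1] r(1) by (auto intro: order_trans[OF norm_ge_zero])
  then show ?thesis using r by (meson root_average_norm)
qed

text \<open>Near \<open>0\<close> the component is a limit of root averages. Homogeneity does the
  rest: the bounded set \<open>S\<close> is shrunk by \<open>a\<close> into that neighbourhood, and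
  the value is multiplied by \<open>(1/a)^l\<close>.\<close>

lemma hom_part_chol:
  assumes \<psi>: "chol I S \<psi>"
  shows "chol I S (hom_part \<psi> l)"
proof -
  obtain r where r: "r > 0" "polydisc I (\<lambda>p. 0) r \<subseteq> S" by (rule zero_polydisc)
  obtain s M where s: "s > 0" "polydisc I (\<lambda>p. 0) s \<subseteq> S"
    "\<And>y m a b. y \<in> polydisc I (\<lambda>p. 0) s \<Longrightarrow> cmod (root_average m a b (\<lambda>u. \<psi> (\<lambda>p. u * y p))) \<le> M"
    using root_average_family_bounded[OF \<psi> zero] by metis
  define t where "t = min s (r/2)"
  define B where "B = polydisc I (\<lambda>p. 0) t"
  have t: "t > 0" using r s by (simp add: t_def)
  have B: "pd_open I B" unfolding B_def by (rule pd_open_polydisc[OF fin])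
  have BS: "B \<subseteq> S" "B \<subseteq> polydisc I (\<lambda>p. 0) s" "B \<subseteq> polydisc I (\<lambda>p. 0) (r/2)"
    using s(2) polydisc_mono[of t s I "\<lambda>p. 0"] polydisc_mono[of t "r/2" I "\<lambda>p. 0"] by (auto simp: t_def B_def)
  have cB: "chol I B (hom_part \<psi> l)"
  proof (rule loc_bounded_family_limit(1)[OF fin])
    show "loc_bounded_family I B sequentially (\<lambda>m x. root_average m 0 l (\<lambda>u. \<psi> (\<lambda>p. u * x p)))"
      by (rule loc_bounded_familyI[OF fin B, where M = M])
        (use chol_subset[OF chol_root_average[OF \<psi>] BS(1) B] s BS in auto)
    fix x assume "x \<in> B"
    then obtain R where "R > 1" "(\<lambda>z. \<psi> (\<lambda>p. z * x p)) holomorphic_on ball 0 R"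
      using slice_holomorphic[OF \<psi> r(2)] BS(3) by blast
    then show "(\<lambda>m. root_average m 0 l (\<lambda>u. \<psi> (\<lambda>p. u * x p))) \<longlonglongrightarrow> hom_part \<psi> l x"
      using root_average_limit[of _ R 0 l] by (auto simp: hom_part_def)
  qed simp
  obtain R where R: "S \<subseteq> polydisc I (\<lambda>p. 0) R" using bdd by blast
  define a where "a = t / (\<bar>R\<bar> + 1)"
  have a: "a > 0" using t by (simp add: a_def add_nonneg_pos)
  have "chol I S (\<lambda>x. hom_part \<psi> l (\<lambda>p. of_real a * x p))"
  proof (rule chol_compose[OF fin fin cB _ opn])
    fix x assume "x \<in> S"
    then have "cmod (x p) < \<bar>R\<bar> + 1" if "p \<in> I" for p using R that by (fastforce simp: mem_polydisc)
    moreover have "a * (\<bar>R\<bar> + 1) = t" by (simp add: a_def)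
    ultimately have "a * cmod (x p) < t" if "p \<in> I" for p
      using mult_strict_left_mono[OF _ a] that by metis
    then show "(\<lambda>p. of_real a * x p) \<in> B"
      using a by (simp add: B_def mem_polydisc norm_mult)
  qed (auto intro!: chol_mult chol_coord chol_const opn)
  then have "chol I S (\<lambda>x. of_real (1/a) ^ l * hom_part \<psi> l (\<lambda>p. of_real a * x p))"
    by (intro chol_mult chol_const opn)
  moreover have "of_real (1/a) ^ l * hom_part \<psi> l (\<lambda>p. of_real a * x p) = hom_part \<psi> l x" for x
    using a by (simp add: hom_part_scale[OF \<psi>] field_simps)
  ultimately show ?thesis by simp
qed

text \<open>Near \<open>0\<close> the slices are power series on a disc of radius above
  \<open>1\<close>. Elsewhere the disc through \<open>x\<close> may leave \<open>S\<close>; the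
  averages remain locally bounded because rotations do not leave it, and Vitali's theorem carries
  the limit over.\<close>

lemma root_average_tendsto:
  assumes \<psi>: "chol I S \<psi>" and x: "x \<in> S"
  shows "(\<lambda>m. root_average m a b (\<lambda>u. \<psi> (\<lambda>p. u * x p))) \<longlonglongrightarrow> (if a \<le> b then hom_part \<psi> (b - a) x else 0)"
proof -
  obtain r where r: "r > 0" "polydisc I (\<lambda>p. 0) r \<subseteq> S" by (rule zero_polydisc)
  define T where "T = (\<lambda>x. if a \<le> b then hom_part \<psi> (b - a) x else 0)"
  have T: "chol I S T" unfolding T_def by (cases "a \<le> b") (auto intro: hom_part_chol \<psi> chol_const opn)
  have "(\<lambda>m. root_average m a b (\<lambda>u. \<psi> (\<lambda>p. u * x p)) - T x) \<longlonglongrightarrow> 0"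
  proof (rule loc_bounded_family_null[OF fin _ con zero _ _ x])
    show "r / 2 > 0" using r by simp
    fix y assume y: "y \<in> polydisc I (\<lambda>p. 0) (r/2)"
    obtain R where "R > 1" "(\<lambda>z. \<psi> (\<lambda>p. z * y p)) holomorphic_on ball 0 R"
      using slice_holomorphic[OF \<psi> r(2) y] by blast
    then have "(\<lambda>m. root_average m a b (\<lambda>u. \<psi> (\<lambda>p. u * y p))) \<longlonglongrightarrow> T y"
      using root_average_limit[of "\<lambda>z. \<psi> (\<lambda>p. z * y p)" R a b] by (simp only: hom_part_def T_def)
    then show "(\<lambda>m. root_average m a b (\<lambda>u. \<psi> (\<lambda>p. u * y p)) - T y) \<longlonglongrightarrow> 0"
      by (simp add: LIM_zero)
  next
    show "loc_bounded_family I S sequentially (\<lambda>m x. root_average m a b (\<lambda>u. \<psi> (\<lambda>p. u * x p)) - T x)"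
      unfolding loc_bounded_family_def
    proof
      fix x assume x: "x \<in> S"
      obtain r1 M1 where 1: "r1 > 0" "polydisc I x r1 \<subseteq> S"
        "\<And>y m a b. y \<in> polydisc I x r1 \<Longrightarrow> cmod (root_average m a b (\<lambda>u. \<psi> (\<lambda>p. u * y p))) \<le> M1"
        using root_average_family_bounded[OF \<psi> x] by metis
      obtain r2 M2 where 2: "r2 > 0" "\<And>y. y \<in> polydisc I x r2 \<Longrightarrow> cmod (T y) \<le> M2"
        using chol_bounded[OF T x] by metis
      define d where "d = min r1 r2"
      have d: "d > 0" "polydisc I x d \<subseteq> S" "polydisc I x d \<subseteq> polydisc I x r1" "polydisc I x d \<subseteq> polydisc I x r2"
        using 1 2 polydisc_mono[of d r1 I x] polydisc_mono[of d r2 I x] by (auto simp: d_def)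
      have "eventually (\<lambda>m. chol I (polydisc I x d) (\<lambda>x. root_average m a b (\<lambda>u. \<psi> (\<lambda>p. u * x p)) - T x) \<and>
         (\<forall>y\<in>polydisc I x d. cmod (root_average m a b (\<lambda>u. \<psi> (\<lambda>p. u * y p)) - T y) \<le> M1 + M2)) sequentially"
      proof (intro always_eventually allI conjI ballI)
        show "chol I (polydisc I x d) (\<lambda>x. root_average m a b (\<lambda>u. \<psi> (\<lambda>p. u * x p)) - T x)" for m
          by (rule chol_subset[OF chol_diff[OF chol_root_average[OF \<psi>] T] d(2) pd_open_polydisc[OF fin]])
        fix m y assume "y \<in> polydisc I x d"
        then show "cmod (root_average m a b (\<lambda>u. \<psi> (\<lambda>p. u * y p)) - T y) \<le> M1 + M2"
          using 1(3) 2(2) d by (intro norm_triangle_le_diff add_mono) auto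
      qed
      with d show "\<exists>r>0. \<exists>M. polydisc I x r \<subseteq> S \<and>
         eventually (\<lambda>m. chol I (polydisc I x r) (\<lambda>x. root_average m a b (\<lambda>u. \<psi> (\<lambda>p. u * x p)) - T x) \<and>
         (\<forall>y\<in>polydisc I x r. cmod (root_average m a b (\<lambda>u. \<psi> (\<lambda>p. u * y p)) - T y) \<le> M)) sequentially"
        by blast
    qed
  qed
  then show ?thesis unfolding T_def by (simp add: LIM_zero_iff)
qed

text \<open>Cauchy's estimate from the circle through \<open>x\<close> alone; the disc inside that
  circle may leave \<open>S\<close>.\<close>

lemma hom_part_bound:
  assumes \<psi>: "chol I S \<psi>" and x: "x \<in> S" and B: "\<And>u. cmod u = 1 \<Longrightarrow> cmod (\<psi> (\<lambda>p. u * x p)) \<le> B"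
  shows "cmod (hom_part \<psi> l x) \<le> B"
proof (rule tendsto_upperbound)
  show "(\<lambda>m. cmod (root_average m 0 l (\<lambda>u. \<psi> (\<lambda>p. u * x p)))) \<longlonglongrightarrow> cmod (hom_part \<psi> l x)"
    using root_average_tendsto[OF \<psi> x, of 0 l] by (auto intro: tendsto_norm)
  have "B \<ge> 0" using B[of 1] by (auto intro: order_trans[OF norm_ge_zero])
  then show "\<forall>\<^sub>F m in sequentially. cmod (root_average m 0 l (\<lambda>u. \<psi> (\<lambda>p. u * x p))) \<le> B"
    using B by (intro always_eventually allI root_average_norm) auto
qed simp

text \<open>Cesaro means of the partial sums of the homogeneous expansion: the inner sum over
  \<open>a \<le> b\<close> collects the degrees up to \<open>b\<close>. The double sum is kept so
  that root averages substituted for the components assemble into a square.\<close>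

definition fejer :: "(('i \<Rightarrow> complex) \<Rightarrow> complex) \<Rightarrow> nat \<Rightarrow> ('i \<Rightarrow> complex) \<Rightarrow> complex" where
  "fejer \<psi> L x = (\<Sum>b<L. \<Sum>a<L. if a \<le> b then hom_part \<psi> (b - a) x else 0) / of_nat L"

text \<open>The Fejer kernel is nonnegative with mean \<open>1\<close>.\<close>

lemma fejer_bound:
  assumes \<psi>: "chol I S \<psi>" and x: "x \<in> S" and B: "\<And>u. cmod u = 1 \<Longrightarrow> cmod (\<psi> (\<lambda>p. u * x p)) \<le> B"
  shows "cmod (fejer \<psi> L x) \<le> B"
proof (cases "L = 0")
  case True
  have "B \<ge> 0" using B[of 1] by (auto intro: order_trans[OF norm_ge_zero])
  then show ?thesis by (simp add: fejer_def True)
next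
  case False
  have B0: "B \<ge> 0" using B[of 1] by (auto intro: order_trans[OF norm_ge_zero])
  \<comment> \<open>The Fejer mean before the limit in \<open>m\<close>. Summed over
    \<open>a\<close> and \<open>b\<close> first, it weights the value at each root by
    \<open>k m j\<close>, the square of a modulus.\<close>
  define A where "A = (\<lambda>g m. (\<Sum>b<L. \<Sum>a<L. root_average m a b g) / of_nat L)"
  define k where "k = (\<lambda>m j. (cmod (\<Sum>a<L. unity_root m j ^ a))\<^sup>2)"
  have A: "A g m = (\<Sum>j<m. g (unity_root m j) * of_real (k m j)) / of_nat (m * L)" for g m
  proof -
    have "(\<Sum>b<L. \<Sum>a<L. root_average m a b g) =
        (\<Sum>b<L. \<Sum>a<L. \<Sum>j<m. g (unity_root m j) * unity_root m j ^ a * cnj (unity_root m j) ^ b) / of_nat m"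
      by (simp add: root_average_def sum_divide_distrib)
    also have "(\<Sum>b<L. \<Sum>a<L. \<Sum>j<m. g (unity_root m j) * unity_root m j ^ a * cnj (unity_root m j) ^ b) = (\<Sum>b<L. \<Sum>j<m. \<Sum>a<L. g (unity_root m j) * unity_root m j ^ a * cnj (unity_root m j) ^ b)"
      by (intro sum.cong refl sum.swap)
    also have "\<dots> = (\<Sum>j<m. \<Sum>b<L. \<Sum>a<L. g (unity_root m j) * unity_root m j ^ a * cnj (unity_root m j) ^ b)"
      by (rule sum.swap)
    also have "\<dots> = (\<Sum>j<m. g (unity_root m j) * ((\<Sum>a<L. unity_root m j ^ a) * cnj (\<Sum>a<L. unity_root m j ^ a)))"
    proof (rule sum.cong[OF refl])
      fix j
      let ?w = "unity_root m j"
      have "(\<Sum>b<L. \<Sum>a<L. g ?w * ?w ^ a * cnj ?w ^ b) = g ?w * (\<Sum>b<L. \<Sum>a<L. ?w ^ a * cnj ?w ^ b)"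
        by (simp add: sum_distrib_left mult.assoc)
      also have "(\<Sum>b<L. \<Sum>a<L. ?w ^ a * cnj ?w ^ b) = (\<Sum>a<L. ?w ^ a) * (\<Sum>b<L. cnj ?w ^ b)"
        unfolding sum_product by (rule sum.swap)
      finally show "(\<Sum>b<L. \<Sum>a<L. g ?w * ?w ^ a * cnj ?w ^ b) = g ?w * ((\<Sum>a<L. ?w ^ a) * cnj (\<Sum>a<L. ?w ^ a))"
        by simp
    qed
    also have "\<dots> = (\<Sum>j<m. g (unity_root m j) * of_real (k m j))"
      unfolding k_def complex_norm_square ..
    finally show ?thesis unfolding A_def by (simp only: divide_divide_eq_left of_nat_mult)
  qed
  have le: "cmod (A (\<lambda>u. \<psi> (\<lambda>p. u * x p)) m) \<le> B * cmod (A (\<lambda>u. 1) m)" for m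
  proof -
    have k0: "k m j \<ge> 0" for j by (simp add: k_def)
    have "cmod (\<Sum>j<m. \<psi> (\<lambda>p. unity_root m j * x p) * of_real (k m j)) \<le> (\<Sum>j<m. B * k m j)"
      by (rule sum_norm_le) (auto simp: norm_mult k0 intro!: mult_right_mono B)
    also have "\<dots> = B * cmod (\<Sum>j<m. 1 * of_real (k m j))"
    proof -
      have "(\<Sum>j<m. k m j) \<ge> 0" by (simp add: k_def sum_nonneg)
      then show ?thesis by (simp add: sum_distrib_left[symmetric] of_real_sum[symmetric] del: of_real_sum)
    qed
    finally show ?thesis
      unfolding A by (simp add: norm_divide norm_mult divide_right_mono)
  qed
  have lim1: "(\<lambda>m. A (\<lambda>u. 1) m) \<longlonglongrightarrow> 1"
  proof -
    have "(\<lambda>m. A (\<lambda>u. 1) m) \<longlonglongrightarrow> (\<Sum>b<L. \<Sum>a<L. if a \<le> b then taylor_coeff (\<lambda>u. 1) (b - a) else 0) / of_nat L"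
      unfolding A_def by (intro tendsto_intros root_average_limit[of _ 2]) (use False in auto)
    also have "(\<Sum>b<L. \<Sum>a<L. if a \<le> b then taylor_coeff (\<lambda>u. 1) (b - a) else (0::complex)) = (\<Sum>b<L. \<Sum>a<L. if a = b then 1 else 0)"
      by (intro sum.cong refl) (auto simp: taylor_coeff_def)
    finally show ?thesis using False by simp
  qed
  have lim2: "(\<lambda>m. A (\<lambda>u. \<psi> (\<lambda>p. u * x p)) m) \<longlonglongrightarrow> fejer \<psi> L x"
    unfolding A_def fejer_def by (intro tendsto_intros root_average_tendsto[OF \<psi> x]) (use False in auto)
  have "cmod (fejer \<psi> L x) \<le> B * cmod 1"
    by (rule tendsto_le[OF _ tendsto_mult[OF tendsto_const tendsto_norm[OF lim1]] tendsto_norm[OF lim2]])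
      (use le in auto)
  then show ?thesis by simp
qed

lemma fejer_chol:
  assumes \<psi>: "chol I S \<psi>" shows "chol I S (fejer \<psi> L)"
proof -
  have "chol I S (\<lambda>x. if a \<le> b then hom_part \<psi> (b - a) x else 0)" for a b
    by (cases "a \<le> b") (auto intro: hom_part_chol \<psi> chol_const opn)
  then have "chol I S (\<lambda>x. (\<Sum>b<L. \<Sum>a<L. if a \<le> b then hom_part \<psi> (b - a) x else 0) * (1 / of_nat L))"
    by (intro chol_mult chol_sum chol_const opn)
  then show ?thesis by (simp add: fejer_def[abs_def])
qed

text \<open>Near \<open>0\<close> these are Cesaro means of a convergent series. The bound by the
  maximum over circles, which partial sums in general violate, supplies the local boundedness for
  Vitali's theorem.\<close>

lemma fejer_tendsto:
  assumes \<psi>: "chol I S \<psi>" and x: "x \<in> S"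
  shows "(\<lambda>L. fejer \<psi> L x) \<longlonglongrightarrow> \<psi> x"
proof -
  obtain r where r: "r > 0" "polydisc I (\<lambda>p. 0) r \<subseteq> S" by (rule zero_polydisc)
  have "(\<lambda>L. fejer \<psi> L x - \<psi> x) \<longlonglongrightarrow> 0"
  proof (rule loc_bounded_family_null[OF fin _ con zero _ _ x])
    show "r / 2 > 0" using r by simp
    fix y assume y: "y \<in> polydisc I (\<lambda>p. 0) (r/2)"
    obtain R where R: "R > 1" "(\<lambda>z. \<psi> (\<lambda>p. z * y p)) holomorphic_on ball 0 R"
      using slice_holomorphic[OF \<psi> r(2) y] by blast
    define s where "s = (\<lambda>b. (\<Sum>l<Suc b. hom_part \<psi> l y) - \<psi> y)"
    have "(\<lambda>l. hom_part \<psi> l y) sums \<psi> y"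
      using taylor_coeff_sums[OF R(2), of 1] R(1) by (simp add: hom_part_def)
    then have "(\<lambda>b. \<Sum>l<Suc b. hom_part \<psi> l y) \<longlonglongrightarrow> \<psi> y"
      unfolding sums_def by (rule LIMSEQ_Suc)
    then have "s \<longlonglongrightarrow> 0" by (simp only: s_def LIM_zero_iff)
    then have ces: "(\<lambda>L. (\<Sum>b<L. s b) / of_nat L) \<longlonglongrightarrow> 0" by (rule cesaro_null)
    have inner: "(\<Sum>a<L. if a \<le> b then hom_part \<psi> (b - a) y else 0) = (\<Sum>l<Suc b. hom_part \<psi> l y)" if "b < L" for b L
    proof -
      have "(\<Sum>a<L. if a \<le> b then hom_part \<psi> (b - a) y else 0) = (\<Sum>a\<le>b. hom_part \<psi> (b - a) y)"
        using that by (intro sum.mono_neutral_cong_right) auto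
      also have "\<dots> = (\<Sum>l\<le>b. hom_part \<psi> l y)"
        by (rule sum.nat_diff_reindex[where n = "Suc b", unfolded lessThan_Suc_atMost, simplified])
      finally show ?thesis by (simp add: lessThan_Suc_atMost)
    qed
    have "eventually (\<lambda>L. (\<Sum>b<L. s b) / of_nat L = fejer \<psi> L y - \<psi> y) sequentially"
      using eventually_gt_at_top[of 0]
    proof eventually_elim
      case (elim L)
      have "(\<Sum>b<L. s b) = (\<Sum>b<L. \<Sum>a<L. if a \<le> b then hom_part \<psi> (b - a) y else 0) - of_nat L * \<psi> y"
        using inner by (simp add: s_def sum_subtractf)
      then show ?case using elim by (simp add: fejer_def diff_divide_distrib)
    qed
    with ces show "(\<lambda>L. fejer \<psi> L y - \<psi> y) \<longlonglongrightarrow> 0" by (rule Lim_transform_eventually)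
  next
    show "loc_bounded_family I S sequentially (\<lambda>L x. fejer \<psi> L x - \<psi> x)"
      unfolding loc_bounded_family_def
    proof
      fix x assume x: "x \<in> S"
      obtain d M where d: "d > 0" "polydisc I x d \<subseteq> S"
        "\<And>y u. y \<in> polydisc I x d \<Longrightarrow> cmod u = 1 \<Longrightarrow> cmod (\<psi> (\<lambda>p. u * y p)) \<le> M"
        using rotation_bounded[OF \<psi> x] by metis
      have "eventually (\<lambda>L. chol I (polydisc I x d) (\<lambda>x. fejer \<psi> L x - \<psi> x) \<and>
         (\<forall>y\<in>polydisc I x d. cmod (fejer \<psi> L y - \<psi> y) \<le> M + M)) sequentially"
      proof (intro always_eventually allI conjI ballI)
        show "chol I (polydisc I x d) (\<lambda>x. fejer \<psi> L x - \<psi> x)" for L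
          by (rule chol_subset[OF chol_diff[OF fejer_chol[OF \<psi>] \<psi>] d(2) pd_open_polydisc[OF fin]])
        fix L y assume y: "y \<in> polydisc I x d"
        have "cmod (fejer \<psi> L y) \<le> M" using d y by (intro fejer_bound[OF \<psi>]) auto
        moreover have "cmod (\<psi> y) \<le> M" using d(3)[OF y, of 1] by simp
        ultimately show "cmod (fejer \<psi> L y - \<psi> y) \<le> M + M"
          by (intro norm_triangle_le_diff add_mono)
      qed
      with d show "\<exists>r>0. \<exists>M. polydisc I x r \<subseteq> S \<and>
         eventually (\<lambda>L. chol I (polydisc I x r) (\<lambda>x. fejer \<psi> L x - \<psi> x) \<and>
         (\<forall>y\<in>polydisc I x r. cmod (fejer \<psi> L y - \<psi> y) \<le> M)) sequentially"
        by blast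
    qed
  qed
  then show ?thesis by (simp add: LIM_zero_iff)
qed

text \<open>The disc spanned by \<open>x\<close> may leave \<open>S\<close>, so the maximum
  principle is not applied to \<open>\<psi>\<close> itself. Along the line through \<open>x\<close>
  the Fejer means are polynomials, bounded by \<open>B\<close> on the circle, so they are bounded by
  \<open>B\<close> on the disc; \<open>\<psi>\<close> at \<open>t x\<close> is their limit.\<close>

lemma circle_maximum_principle:
  assumes \<psi>: "chol I S \<psi>" and x: "x \<in> S" and B: "\<And>u. cmod u = 1 \<Longrightarrow> cmod (\<psi> (\<lambda>p. u * x p)) \<le> B"
    and t: "cmod t \<le> 1" and tx: "(\<lambda>p. t * x p) \<in> S"
  shows "cmod (\<psi> (\<lambda>p. t * x p)) \<le> B"
proof (rule tendsto_upperbound)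
  show "(\<lambda>L. cmod (fejer \<psi> L (\<lambda>p. t * x p))) \<longlonglongrightarrow> cmod (\<psi> (\<lambda>p. t * x p))"
    by (rule tendsto_norm) (rule fejer_tendsto[OF \<psi> tx])
  have "cmod (fejer \<psi> L (\<lambda>p. t * x p)) \<le> B" for L
  proof -
    define g where "g = (\<lambda>z. fejer \<psi> L (\<lambda>p. z * x p))"
    have "g z = (\<Sum>b<L. \<Sum>a<L. if a \<le> b then z ^ (b - a) * hom_part \<psi> (b - a) x else 0) / of_nat L" for z
      unfolding g_def fejer_def hom_part_scale[OF \<psi>] ..
    then have g: "g = (\<lambda>z. (\<Sum>b<L. \<Sum>a<L. if a \<le> b then z ^ (b - a) * hom_part \<psi> (b - a) x else 0) / of_nat L)" ..
    have "(\<lambda>z. if a \<le> b then z ^ (b - a) * hom_part \<psi> (b - a) x else 0) holomorphic_on UNIV" for a b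
      by (cases "a \<le> b") (auto intro!: holomorphic_intros)
    then have "(\<lambda>z. (\<Sum>b<L. \<Sum>a<L. if a \<le> b then z ^ (b - a) * hom_part \<psi> (b - a) x else 0) * (1 / of_nat L)) holomorphic_on UNIV"
      by (intro holomorphic_intros)
    then have hol: "g holomorphic_on UNIV" by (simp add: g)
    have "cmod (g t) \<le> B"
    proof (rule maximum_modulus_frontier[of g "cball 0 1"])
      show "g holomorphic_on interior (cball 0 1)" using hol by (rule holomorphic_on_subset) simp
      show "continuous_on (closure (cball 0 1)) g"
        using holomorphic_on_imp_continuous_on[OF hol] by (rule continuous_on_subset) simp
      fix z :: complex assume "z \<in> frontier (cball 0 1)"
      then have z: "cmod z = 1" by (simp add: frontier_cball)
      show "cmod (g z) \<le> B"
        unfolding g_def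
      proof (rule fejer_bound[OF \<psi> rotate[OF x z]])
        fix u :: complex assume "cmod u = 1"
        then show "cmod (\<psi> (\<lambda>p. u * (z * x p))) \<le> B"
          using B[of "u * z"] z by (simp add: norm_mult mult.assoc)
      qed
    qed (use t in auto)
    then show ?thesis by (simp add: g_def)
  qed
  then show "\<forall>\<^sub>F L in sequentially. cmod (fejer \<psi> L (\<lambda>p. t * x p)) \<le> B" by simp
qed simp

text \<open>The root averages with \<open>a = 0\<close> and \<open>b = 1\<close> equal
  \<open>\<psi> x\<close> for every \<open>m > 0\<close> and converge to the component of degree
  \<open>1\<close>.\<close>

lemma homogeneous_imp_linear:
  assumes \<psi>: "chol I S \<psi>" and x: "x \<in> S"
    and hom: "\<And>u x. cmod u = 1 \<Longrightarrow> x \<in> S \<Longrightarrow> \<psi> (\<lambda>p. u * x p) = u * \<psi> x"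
  shows "\<psi> x = dd \<psi> (\<lambda>p. 0) x"
proof -
  have "root_average m 0 1 (\<lambda>u. \<psi> (\<lambda>p. u * x p)) = \<psi> x" if "m > 0" for m
  proof -
    have "\<psi> (\<lambda>p. unity_root m j * x p) = \<psi> x * unity_root m j" for j
      using hom[OF norm_unity_root x] by (simp add: mult.commute)
    then have "root_average m 0 1 (\<lambda>u. \<psi> (\<lambda>p. u * x p)) = \<psi> x * root_average m 0 1 (\<lambda>u. u ^ 1)"
      by (simp add: root_average_def sum_distrib_left mult.assoc)
    then show ?thesis using root_average_power_equal[OF that, of 1 0 1] by simp
  qed
  then have "eventually (\<lambda>m. root_average m 0 1 (\<lambda>u. \<psi> (\<lambda>p. u * x p)) = \<psi> x) sequentially"
    using eventually_gt_at_top[of 0] by (rule eventually_mono[rotated])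
  then have "(\<lambda>m. root_average m 0 1 (\<lambda>u. \<psi> (\<lambda>p. u * x p))) \<longlonglongrightarrow> \<psi> x"
    by (rule tendsto_eventually)
  moreover have "(\<lambda>m. root_average m 0 1 (\<lambda>u. \<psi> (\<lambda>p. u * x p))) \<longlonglongrightarrow> hom_part \<psi> 1 x"
    using root_average_tendsto[OF \<psi> x, of 0 1] by simp
  ultimately show ?thesis unfolding hom_part_1[symmetric] by (rule LIMSEQ_unique)
qed

end

lemma pd_open_cong:
  assumes "pd_open I S" "x \<in> S" "\<And>p. p \<in> I \<Longrightarrow> y p = x p" shows "y \<in> S"
proof -
  obtain r where "r > 0" "polydisc I x r \<subseteq> S" using assms unfolding pd_open_def by blast
  then show ?thesis using assms(3) by (auto simp: mem_polydisc subset_iff)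
qed

text \<open>A uniform bound makes the family equicontinuous at \<open>y\<close>, so a moving
  argument \<open>w k\<close> may be replaced by its limit.\<close>

lemma equicontinuous_null:
  assumes I: "finite I" and T: "pd_open I T" and \<phi>: "\<And>k. chol I T (\<phi> k)"
    and M: "\<And>k y. y \<in> T \<Longrightarrow> cmod (\<phi> k y) \<le> M" and y: "y \<in> T"
    and w: "\<And>p. p \<in> I \<Longrightarrow> ((\<lambda>k. w k p) \<longlongrightarrow> y p) G"
  shows "((\<lambda>k. \<phi> k (w k) - \<phi> k y) \<longlongrightarrow> 0) G"
proof (rule tendstoI)
  fix e :: real assume e: "e > 0"
  obtain r where r: "r > 0" "polydisc I y r \<subseteq> T" using T y unfolding pd_open_def by blast
  have M0: "M \<ge> 0" using M[OF y] norm_ge_zero order_trans by blast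
  define K where "K = 6 * M / r"
  have K: "K \<ge> 0" using M0 r by (simp add: K_def)
  define \<delta> where "\<delta> = min (r/2) (e / (K + 1))"
  have \<delta>: "\<delta> > 0" "\<delta> \<le> r/2" "K * \<delta> < e"
  proof -
    show "\<delta> > 0" using r e K by (simp add: \<delta>_def)
    show "\<delta> \<le> r/2" unfolding \<delta>_def by (rule min.cobounded1)
    have "K * \<delta> \<le> K * (e / (K + 1))" using K by (intro mult_left_mono) (auto simp: \<delta>_def)
    also have "\<dots> < e" using K e by (simp add: field_simps)
    finally show "K * \<delta> < e" .
  qed
  have "eventually (\<lambda>k. \<forall>p\<in>I. dist (w k p) (y p) < \<delta>) G"
    by (intro eventually_ball_finite I ballI tendstoD[OF w] \<delta>)
  then show "eventually (\<lambda>k. dist (\<phi> k (w k) - \<phi> k y) 0 < e) G"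
  proof eventually_elim
    case (elim k)
    have "cmod (\<phi> k (w k) - \<phi> k y) \<le> 6 * M / r * \<delta>"
    proof (rule chol_Lipschitz[OF \<phi> r(2) _ r(1)])
      show "w k \<in> polydisc I y (r/2)" using elim \<delta>(2) by (force simp: mem_polydisc dist_norm)
    qed (use M r elim \<delta> in \<open>auto simp: dist_norm less_imp_le\<close>)
    then show ?case using \<delta>(3) by (simp add: K_def)
  qed
qed

section \<open>Cartan's uniqueness theorem\<close>

text \<open>One half of a biholomorphism: \<open>f\<close> is holomorphic into \<open>T\<close> and
  \<open>h\<close> is a left inverse. Both directions together give a biholomorphism. Equality is
  demanded on \<open>I\<close>, since the other coordinates carry no meaning.\<close>

definition mutual :: "'i set \<Rightarrow> ('i \<Rightarrow> complex) set \<Rightarrow> ('i \<Rightarrow> complex) set \<Rightarrow>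
    (('i \<Rightarrow> complex) \<Rightarrow> 'i \<Rightarrow> complex) \<Rightarrow> (('i \<Rightarrow> complex) \<Rightarrow> 'i \<Rightarrow> complex) \<Rightarrow> bool" where
  "mutual I S T f h \<longleftrightarrow>
     (\<forall>x\<in>S. f x \<in> T \<and> (\<forall>p\<in>I. h (f x) p = x p)) \<and> (\<forall>p\<in>I. chol I S (\<lambda>x. f x p))"

lemma mutualD:
  assumes "mutual I S T f h"
  shows "x \<in> S \<Longrightarrow> f x \<in> T" "x \<in> S \<Longrightarrow> p \<in> I \<Longrightarrow> h (f x) p = x p" "p \<in> I \<Longrightarrow> chol I S (\<lambda>x. f x p)"
  using assms by (auto simp: mutual_def)

lemma mutual_dd:
  assumes I: "finite I" and S: "pd_open I S" and fh: "mutual I S T f h" and x: "x \<in> S" and q: "q \<in> I"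
  shows "dd (\<lambda>x. h (f x) q) x w = w q"
proof -
  obtain r where r: "r > 0" "polydisc I x r \<subseteq> S" using S x unfolding pd_open_def by blast
  obtain \<rho> where \<rho>: "\<rho> > 0" "\<And>z. z \<in> ball 0 \<rho> \<Longrightarrow> (\<lambda>p. x p + z * w p) \<in> polydisc I x r"
    using line_in_polydisc[OF I r(1), of x w] by blast
  have "eventually (\<lambda>z. z \<in> ball 0 \<rho>) (nhds (0::complex))"
    using \<rho>(1) by (intro eventually_nhds_in_open) auto
  then have "eventually (\<lambda>z. h (f (\<lambda>p. x p + z * w p)) q = x q + z * w q) (nhds 0)"
  proof eventually_elim
    case (elim z)
    then have "(\<lambda>p. x p + z * w p) \<in> S" using \<rho> r by blast
    from mutualD(2)[OF fh this q] show ?case by simp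
  qed
  then have "dd (\<lambda>x. h (f x) q) x w = deriv (\<lambda>z. x q + z * w q) 0"
    unfolding dd_def by (rule deriv_cong_ev) simp
  also have "\<dots> = w q" by (rule DERIV_imp_deriv) (auto intro!: derivative_eq_intros)
  finally show ?thesis .
qed

text \<open>Cartan's theorem on limits of biholomorphisms: the single interior value
  \<open>F x0\<close> forces all values of \<open>F\<close> into \<open>T\<close>. Near
  \<open>x0\<close>, equicontinuity of the \<open>h k\<close> at \<open>F x\<close> shows that
  \<open>h k (F x)\<close> tends to \<open>x\<close>. Hence the self-maps \<open>h l o f k\<close>
  of \<open>S\<close> tend to the identity near \<open>x0\<close> as \<open>k\<close> and
  \<open>l\<close> grow independently, and by Vitali's theorem on all of \<open>S\<close>.\<close>

lemma mutual_limit: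
  assumes I: "finite I" and S: "pd_open I S" and con: "pd_connected I S" and T: "pd_open I T"
    and boundS: "\<And>x. x \<in> S \<Longrightarrow> \<forall>p\<in>I. cmod (x p) \<le> M" and boundT: "\<And>x. x \<in> T \<Longrightarrow> \<forall>p\<in>I. cmod (x p) \<le> M"
    and fh: "\<And>k. mutual I S T (f k) (h k)" and hf: "\<And>k. mutual I T S (h k) (f k)"
    and G: "G \<noteq> bot"
    and F: "\<And>x p. x \<in> S \<Longrightarrow> p \<in> I \<Longrightarrow> ((\<lambda>k. f k x p) \<longlongrightarrow> F x p) G"
    and H: "\<And>x p. x \<in> T \<Longrightarrow> p \<in> I \<Longrightarrow> ((\<lambda>k. h k x p) \<longlongrightarrow> H x p) G"
    and x0: "x0 \<in> S" "F x0 \<in> T" and x: "x \<in> S"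
  shows "F x \<in> T" "p \<in> I \<Longrightarrow> H (F x) p = x p"
proof -
  note f = mutualD[OF fh] and h = mutualD[OF hf]
  have bS: "cmod (x p) \<le> M" if "x \<in> S" "p \<in> I" for x p using boundS that by blast
  have bT: "cmod (x p) \<le> M" if "x \<in> T" "p \<in> I" for x p using boundT that by blast
  have bf: "cmod (f k x p) \<le> M" if "x \<in> S" "p \<in> I" for k x p using f(1) bT that by blast
  have bh: "cmod (h k x p) \<le> M" if "x \<in> T" "p \<in> I" for k x p using h(1) bS that by blast
  have inv: "((\<lambda>k. h k (F x) p) \<longlongrightarrow> x p) G" if "x \<in> S" "F x \<in> T" "p \<in> I" for x p
  proof -
    have "((\<lambda>k. h k (f k x) p - h k (F x) p) \<longlongrightarrow> 0) G"
      by (rule equicontinuous_null[OF I T]) (use h(3) bh F that in auto)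
    then have "((\<lambda>k. x p - h k (F x) p) \<longlongrightarrow> 0) G" using f(2) that by simp
    then have "((\<lambda>k. x p - (x p - h k (F x) p)) \<longlongrightarrow> x p - 0) G" by (intro tendsto_diff tendsto_const)
    then show ?thesis by simp
  qed
  have Fhol: "chol I S (\<lambda>x. F x p)" if p: "p \<in> I" for p
    by (rule loc_bounded_family_limit(1)[OF I G loc_bounded_familyI[OF I S, where M = M and \<phi> = "\<lambda>k x. f k x p"]])
      (use f bf F p in auto)
  obtain r where r: "r > 0" "polydisc I (F x0) r \<subseteq> T" using T x0 unfolding pd_open_def by blast
  obtain s where s: "s > 0" "polydisc I x0 s \<subseteq> S" "\<And>x. x \<in> polydisc I x0 s \<Longrightarrow> F x \<in> polydisc I (F x0) r"
    using chol_continuous[of I I S F x0 r] I Fhol S x0 r(1) by blast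
  have fstG: "filterlim fst G (G \<times>\<^sub>F G)" and sndG: "filterlim snd G (G \<times>\<^sub>F G)"
    by (rule filterlim_fst filterlim_snd)+
  \<comment> \<open>For \<open>k = l\<close> this would say nothing. Independent indices allow
    \<open>l\<close> to be frozen below while \<open>k\<close> alone passes to the limit.\<close>
  have null: "((\<lambda>kl. h (snd kl) (f (fst kl) x) p - x p) \<longlongrightarrow> 0) (G \<times>\<^sub>F G)" if p: "p \<in> I" and x: "x \<in> S" for x p
  proof (rule loc_bounded_family_null[OF I _ con x0(1) s(1) _ x])
    show "loc_bounded_family I S (G \<times>\<^sub>F G) (\<lambda>kl x. h (snd kl) (f (fst kl) x) p - x p)"
    proof (rule loc_bounded_familyI[OF I S, where M = "M + M"])
      show "chol I S (\<lambda>x. h (snd kl) (f (fst kl) x) p - x p)" for kl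
        by (intro chol_diff chol_coord S p chol_compose[OF I I h(3)[OF p]] f)
      show "cmod (h (snd kl) (f (fst kl) x) p - x p) \<le> M + M" if "x \<in> S" for kl x
        using bh[OF f(1)[OF that] p] bS[OF that p] by (intro norm_triangle_le_diff add_mono)
    qed
    fix y assume y: "y \<in> polydisc I x0 s" "y \<in> S"
    then have Fy: "F y \<in> T" using s r by blast
    have "((\<lambda>kl. h (snd kl) (f (fst kl) y) p - h (snd kl) (F y) p) \<longlongrightarrow> 0) (G \<times>\<^sub>F G)"
    proof (rule equicontinuous_null[OF I T, where w = "\<lambda>kl. f (fst kl) y" and \<phi> = "\<lambda>kl y. h (snd kl) y p"])
      show "((\<lambda>kl. f (fst kl) y q) \<longlongrightarrow> F y q) (G \<times>\<^sub>F G)" if "q \<in> I" for q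
        by (rule filterlim_compose[OF F[OF y(2) that] fstG])
    qed (use h(3) bh Fy p in auto)
    moreover have "((\<lambda>kl. h (snd kl) (F y) p) \<longlongrightarrow> y p) (G \<times>\<^sub>F G)"
      by (rule filterlim_compose[OF inv[OF y(2) Fy p] sndG])
    ultimately have "((\<lambda>kl. (h (snd kl) (f (fst kl) y) p - h (snd kl) (F y) p) + h (snd kl) (F y) p) \<longlongrightarrow> 0 + y p) (G \<times>\<^sub>F G)"
      by (rule tendsto_add)
    then have "((\<lambda>kl. h (snd kl) (f (fst kl) y) p) \<longlongrightarrow> y p) (G \<times>\<^sub>F G)" by simp
    then show "((\<lambda>kl. h (snd kl) (f (fst kl) y) p - y p) \<longlongrightarrow> 0) (G \<times>\<^sub>F G)"
      by (rule LIM_zero)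
  qed
  show FT: "F x \<in> T"
  proof -
    obtain r where r: "r > 0" "polydisc I x r \<subseteq> S" using S x unfolding pd_open_def by blast
    have "eventually (\<lambda>kl. \<forall>p\<in>I. dist (h (snd kl) (f (fst kl) x) p - x p) 0 < r/2) (G \<times>\<^sub>F G)"
      by (intro eventually_ball_finite I ballI tendstoD[OF null] x) (use r in auto)
    then obtain P Q where PQ: "eventually P G" "eventually Q G"
      "\<And>k l. P k \<Longrightarrow> Q l \<Longrightarrow> \<forall>p\<in>I. cmod (h l (f k x) p - x p) < r/2"
      unfolding eventually_prod_filter by auto
    \<comment> \<open>With \<open>l\<close> fixed, the points \<open>w k\<close> of \<open>S\<close>
      stay near \<open>x\<close> and cluster at some \<open>y\<close> in \<open>S\<close>. Since
      \<open>f l (w k)\<close> equals \<open>f k x\<close>, the limit \<open>F x\<close> is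
      \<open>f l y\<close>, a value in \<open>T\<close>.\<close>
    obtain l where l: "Q l" using eventually_happens'[OF G PQ(2)] by blast
    define w where "w = (\<lambda>k. h l (f k x))"
    have wS: "w k \<in> S" for k unfolding w_def by (intro h(1) f(1) x)
    have wP: "\<forall>p\<in>I. cmod (w k p - x p) < r/2" if "P k" for k using PQ(3)[OF that l] by (simp add: w_def)
    have "cmod (if p \<in> I then w k p else 0) \<le> \<bar>M\<bar>" for k p
      using bS[OF wS, of p k] by auto
    then obtain G' y where G': "G' \<le> G" "G' \<noteq> bot" "\<And>p. ((\<lambda>k. if p \<in> I then w k p else 0) \<longlongrightarrow> y p) G'"
      using pointwise_cluster[OF G, of "\<lambda>k p. if p \<in> I then w k p else 0" "\<lambda>_. \<bar>M\<bar>"] by metis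
    have w: "((\<lambda>k. w k p) \<longlongrightarrow> y p) G'" if "p \<in> I" for p using G'(3)[of p] that by simp
    have "cmod (y p - x p) \<le> r/2" if "p \<in> I" for p
    proof (rule tendsto_upperbound[OF _ _ G'(2)])
      show "((\<lambda>k. cmod (w k p - x p)) \<longlongrightarrow> cmod (y p - x p)) G'"
        by (intro tendsto_intros w that)
      show "\<forall>\<^sub>F k in G'. cmod (w k p - x p) \<le> r / 2"
        using filter_leD[OF G'(1) PQ(1)] by eventually_elim (use wP that in \<open>auto intro: less_imp_le\<close>)
    qed
    then have "y \<in> polydisc I x r" using r(1) by (force simp: mem_polydisc)
    then have y: "y \<in> S" using r by blast
    have "F x p = f l y p" if p: "p \<in> I" for p
    proof (rule tendsto_unique[OF G'(2)])
      show "((\<lambda>k. f k x p) \<longlongrightarrow> F x p) G'" by (rule tendsto_mono[OF G'(1) F[OF x p]])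
      have "((\<lambda>k. f l (w k) p - f l y p) \<longlongrightarrow> 0) G'"
        by (rule equicontinuous_null[OF I S]) (use f(3) bf w y p in auto)
      moreover have "f l (w k) p = f k x p" for k
        unfolding w_def by (rule h(2)[OF f(1)[OF x] p])
      ultimately show "((\<lambda>k. f k x p) \<longlongrightarrow> f l y p) G'" by (simp add: LIM_zero_iff)
    qed
    then show ?thesis using pd_open_cong[OF T f(1)[OF y]] by blast
  qed
  show "H (F x) p = x p" if "p \<in> I"
    using tendsto_unique[OF G H[OF FT that] inv[OF x FT that]] .
qed

section \<open>Taylor coefficients in one variable and Cartan's iteration\<close>

lemma taylor_coeff_null:
  assumes g: "g holomorphic_on ball 0 R" and \<rho>: "\<rho> > 0" "\<rho> \<le> R" and C: "\<And>z. 0 < cmod z \<Longrightarrow> cmod z < \<rho> \<Longrightarrow> cmod (g z) \<le> C * cmod z ^ n"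
    and l: "l < n"
  shows "taylor_coeff g l = 0"
proof -
  have b: "cmod (taylor_coeff g l) \<le> \<bar>C\<bar> * s" if s: "0 < s" "s < min \<rho> 1" for s
  proof -
    have sub: "cball (0::complex) s \<subseteq> ball 0 R" using s \<rho> by auto
    have "cmod ((deriv ^^ l) g 0) \<le> fact l * (\<bar>C\<bar> * s ^ n) / s ^ l"
    proof (rule Cauchy_inequality)
      show "g holomorphic_on ball 0 s" using g sub by (meson ball_subset_cball holomorphic_on_subset)
      show "continuous_on (cball 0 s) g"
        using holomorphic_on_imp_continuous_on[OF g] sub continuous_on_subset by blast
      fix z :: complex assume "cmod (0 - z) = s"
      then have "cmod (g z) \<le> C * s ^ n" using C[of z] s by simp
      also have "\<dots> \<le> \<bar>C\<bar> * s ^ n" using s by (intro mult_right_mono) auto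
      finally show "cmod (g z) \<le> \<bar>C\<bar> * s ^ n" .
    qed (use s in auto)
    then have "cmod (taylor_coeff g l) \<le> \<bar>C\<bar> * s ^ n / s ^ l"
      by (simp add: taylor_coeff_def norm_divide field_simps)
    also have "\<bar>C\<bar> * s ^ n / s ^ l = \<bar>C\<bar> * s ^ (n - l)"
      using s l by (simp add: power_diff)
    also have "\<dots> \<le> \<bar>C\<bar> * s ^ 1"
      using s l by (intro mult_left_mono power_decreasing) auto
    finally show ?thesis by simp
  qed
  have "cmod (taylor_coeff g l) \<le> 0"
  proof (rule tendsto_lowerbound)
    show "((\<lambda>s. \<bar>C\<bar> * s) \<longlongrightarrow> 0) (at_right (0::real))"
      by (auto intro!: tendsto_eq_intros)
    have "0 < min \<rho> 1" using \<rho> by simp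
    from eventually_at_right_real[OF this]
    show "\<forall>\<^sub>F s in at_right 0. cmod (taylor_coeff g l) \<le> \<bar>C\<bar> * s"
      by eventually_elim (rule b, auto)
  qed simp
  then show ?thesis by simp
qed

lemma taylor_remainder:
  assumes g: "g holomorphic_on ball 0 R" and R: "R > 1"
  obtains C where "C \<ge> 0" "\<And>z. cmod z \<le> 1 \<Longrightarrow> cmod (g z - (\<Sum>l<m. taylor_coeff g l * z ^ l)) \<le> C * cmod z ^ m"
proof
  have sm: "summable (\<lambda>l. cmod (taylor_coeff g l))" by (rule taylor_coeff_summable[OF g R])
  define C where "C = (\<Sum>l. cmod (taylor_coeff g (l + m)))"
  have smm: "summable (\<lambda>l. cmod (taylor_coeff g (l + m)))" using sm by (rule summable_ignore_initial_segment)
  show "(\<Sum>l. cmod (taylor_coeff g (l + m))) \<ge> 0" using smm by (intro suminf_nonneg) auto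
  fix z :: complex assume z: "cmod z \<le> 1"
  have sums: "(\<lambda>l. taylor_coeff g l * z ^ l) sums g z" by (rule taylor_coeff_sums[OF g]) (use z R in simp)
  then have "(\<lambda>l. taylor_coeff g (l + m) * z ^ (l + m)) sums (g z - (\<Sum>l<m. taylor_coeff g l * z ^ l))"
    by (rule sums_split_initial_segment)
  then have eq: "g z - (\<Sum>l<m. taylor_coeff g l * z ^ l) = (\<Sum>l. taylor_coeff g (l + m) * z ^ (l + m))"
    by (simp add: sums_iff)
  have le: "cmod (taylor_coeff g (l + m) * z ^ (l + m)) \<le> cmod (taylor_coeff g (l + m)) * cmod z ^ m" for l
    using z by (auto simp: norm_mult norm_power intro!: mult_left_mono power_decreasing)
  have "cmod (\<Sum>l. taylor_coeff g (l + m) * z ^ (l + m)) \<le> (\<Sum>l. cmod (taylor_coeff g (l + m)) * cmod z ^ m)"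
    by (rule norm_suminf_le[OF le]) (intro summable_mult2 smm)
  also have "\<dots> = (\<Sum>l. cmod (taylor_coeff g (l + m))) * cmod z ^ m"
    using smm by (rule suminf_mult2[symmetric])
  finally show "cmod (g z - (\<Sum>l<m. taylor_coeff g l * z ^ l)) \<le> (\<Sum>l. cmod (taylor_coeff g (l + m))) * cmod z ^ m"
    by (simp add: eq)
qed

lemma taylor_coeff_unique:
  assumes g: "g holomorphic_on ball 0 R" and R: "R > 1" and \<rho>: "\<rho> > 0"
    and C: "\<And>z. 0 < cmod z \<Longrightarrow> cmod z < \<rho> \<Longrightarrow> cmod (g z - b * z ^ m) \<le> C * cmod z ^ Suc m"
  shows "taylor_coeff g m = b"
proof -
  have hp: "(\<lambda>z. b * z ^ m) holomorphic_on ball 0 R" by (intro holomorphic_intros)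
  have "taylor_coeff (\<lambda>z. g z - b * z ^ m) m = 0"
    by (rule taylor_coeff_null[where \<rho> = "min \<rho> R" and R = R and C = C and n = "Suc m"])
      (use g \<rho> R C in \<open>auto intro!: holomorphic_intros\<close>)
  moreover have "taylor_coeff (\<lambda>z. g z - b * z ^ m) m = taylor_coeff g m - taylor_coeff (\<lambda>z. b * z ^ m) m"
    unfolding taylor_coeff_def
    by (subst higher_deriv_diff[OF g hp]) (use R in \<open>auto simp: diff_divide_distrib\<close>)
  moreover have "taylor_coeff (\<lambda>z. b * z ^ m) m = b"
  proof (rule LIMSEQ_unique)
    show "(\<lambda>k. root_average k 0 m (\<lambda>z. b * z ^ m)) \<longlonglongrightarrow> taylor_coeff (\<lambda>z. b * z ^ m) m"
      using root_average_limit[OF hp R, of 0 m] by simp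
    have "root_average k 0 m (\<lambda>z. b * z ^ m) = b * root_average k 0 m (\<lambda>z. z ^ m)" for k
      by (simp add: root_average_def sum_distrib_left mult.assoc)
    then have "eventually (\<lambda>k. root_average k 0 m (\<lambda>z. b * z ^ m) = b) sequentially"
      by (intro eventually_mono[OF eventually_gt_at_top[of 0]]) (simp add: root_average_power_equal)
    then show "(\<lambda>k. root_average k 0 m (\<lambda>z. b * z ^ m)) \<longlonglongrightarrow> b" by (rule tendsto_eventually)
  qed
  ultimately show ?thesis by simp
qed

lemma taylor_coeff_bound:
  assumes g: "g holomorphic_on ball 0 R" and R: "R > 1" and M: "\<And>z. z \<in> ball 0 R \<Longrightarrow> cmod (g z) \<le> M"
  shows "cmod (taylor_coeff g m) \<le> M"
proof -
  have sub: "cball (0::complex) 1 \<subseteq> ball 0 R" using R by auto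
  have "cmod ((deriv ^^ m) g 0) \<le> fact m * M / 1 ^ m"
  proof (rule Cauchy_inequality)
    show "g holomorphic_on ball 0 1" using g sub by (meson ball_subset_cball holomorphic_on_subset)
    show "continuous_on (cball 0 1) g"
      using holomorphic_on_imp_continuous_on[OF g] sub continuous_on_subset by blast
  qed (use M R in auto)
  then show ?thesis by (simp add: taylor_coeff_def norm_divide field_simps)
qed

text \<open>If \<open>a z^m\<close> is the first nonlinear term of \<open>G\<close> along a line, then the \<open>k\<close>-th iterate of
  \<open>G\<close> has the term \<open>k a z^m\<close> there; the iterates are uniformly bounded, so \<open>a = 0\<close>.\<close>

lemma Cartan_uniqueness:
  assumes I: "finite I" and S: "pd_open I S" and con: "pd_connected I S" and zero: "(\<lambda>p. 0) \<in> S"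
    and bS: "\<And>x p. x \<in> S \<Longrightarrow> p \<in> I \<Longrightarrow> cmod (x p) \<le> M"
    and GS: "\<And>x. x \<in> S \<Longrightarrow> G x \<in> S" and G: "\<And>p. p \<in> I \<Longrightarrow> chol I S (\<lambda>x. G x p)"
    and G0: "\<And>p. p \<in> I \<Longrightarrow> G (\<lambda>p. 0) p = 0"
    and dG: "\<And>p v. p \<in> I \<Longrightarrow> dd (\<lambda>x. G x p) (\<lambda>p. 0) v = v p"
    and x: "x \<in> S" "p \<in> I"
  shows "G x p = x p"
proof -
  define E where "E = (\<lambda>p x. G x p - x p)"
  have E: "chol I S (E p)" if "p \<in> I" for p
    unfolding E_def by (intro chol_diff chol_coord G S that)
  obtain r where r: "r > 0" "polydisc I (\<lambda>p. 0) r \<subseteq> S" using S zero unfolding pd_open_def by blast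
  define C0 where "C0 = 9 * (M + M) / r\<^sup>2"
  have M0: "M \<ge> 0" using bS[OF x] norm_ge_zero order_trans by blast
  have bE: "cmod (E p x) \<le> M + M" if "x \<in> S" "p \<in> I" for x p
    unfolding E_def using bS[OF that] bS[OF GS[OF that(1)] that(2)] by (intro norm_triangle_le_diff add_mono)
  have C0: "C0 \<ge> 0" using M0 by (simp add: C0_def)
  have ddE: "dd (E p) (\<lambda>p. 0) v = 0" if p: "p \<in> I" for p v
  proof -
    have "((\<lambda>z. G (\<lambda>q. 0 + z * v q) p - (0 + z * v p)) has_field_derivative (v p - v p)) (at 0)"
      by (rule DERIV_diff[OF has_field_derivative_dd[OF I G[OF p] zero, of v, unfolded dG[OF p]]])
        (auto intro!: derivative_eq_intros)
    then show ?thesis by (auto simp: dd_def E_def dest: DERIV_imp_deriv)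
  qed
  have quad: "cmod (E p y) \<le> C0 * \<delta>\<^sup>2" if p: "p \<in> I" and \<delta>: "0 < \<delta>" "\<delta> < r" "\<And>q. q \<in> I \<Longrightarrow> cmod (y q) \<le> \<delta>" for p y \<delta>
  proof -
    have "cmod (E p (\<lambda>q. 0 + y q) - E p (\<lambda>q. 0) - dd (E p) (\<lambda>q. 0) y) \<le> 9 * (M + M) / r\<^sup>2 * \<delta>\<^sup>2"
      by (rule dd_estimate[OF E[OF p] r(2)]) (use bE r p \<delta> in auto)
    moreover have "E p (\<lambda>q. 0) = 0" using G0[OF p] by (simp add: E_def)
    ultimately show ?thesis by (simp add: ddE[OF p] C0_def)
  qed
  \<comment> \<open>On the polydisc of radius \<open>4 \<delta>\<close> the quadratic bound is
    \<open>16 C0 \<delta>^2\<close>; times \<open>6\<close> and divided by the radius this is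
    \<open>24 C0 \<delta>\<close>. The point is that the Lipschitz constant of \<open>E\<close>
    shrinks with the distance to \<open>0\<close>.\<close>
  have lip: "cmod (E p y' - E p y) \<le> 24 * C0 * \<delta> * \<eta>"
    if p: "p \<in> I" and \<delta>: "0 < \<delta>" "4 * \<delta> < r" "\<And>q. q \<in> I \<Longrightarrow> cmod (y q) \<le> \<delta>" "\<And>q. q \<in> I \<Longrightarrow> cmod (y' q) \<le> \<delta>"
      and \<eta>: "\<eta> \<ge> 0" "\<And>q. q \<in> I \<Longrightarrow> cmod (y' q - y q) \<le> \<eta>" for p y y' \<delta> \<eta>
  proof -
    have "cmod (E p y' - E p y) \<le> 6 * (C0 * (4 * \<delta>)\<^sup>2) / (4 * \<delta>) * \<eta>"
    proof (rule chol_Lipschitz[OF E[OF p]])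
      show "polydisc I (\<lambda>q. 0) (4 * \<delta>) \<subseteq> S" using r(2) \<delta>(2) polydisc_mono[of "4 * \<delta>" r I] by fastforce
      fix y assume "y \<in> polydisc I (\<lambda>q. 0) (4 * \<delta>)"
      then show "cmod (E p y) \<le> C0 * (4 * \<delta>)\<^sup>2"
        using \<delta> by (intro quad p) (auto simp: mem_polydisc intro: less_imp_le)
    next
      show "y \<in> polydisc I (\<lambda>q. 0) (4 * \<delta> / 2)" "y' \<in> polydisc I (\<lambda>q. 0) (4 * \<delta> / 2)"
        using \<delta> by (force simp: mem_polydisc)+
    qed (use \<delta> \<eta> in auto)
    also have "6 * (C0 * (4 * \<delta>)\<^sup>2) / (4 * \<delta>) * \<eta> = 24 * C0 * \<delta> * \<eta>"
      using \<delta>(1) by (simp add: power2_eq_square)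
    finally show ?thesis .
  qed
  have near0: "E p v = 0" if p: "p \<in> I" and v: "v \<in> polydisc I (\<lambda>q. 0) (r/2)" for p v
  proof -
    define e where "e = (\<lambda>p z. E p (\<lambda>q. z * v q))"
    have zv: "(\<lambda>q. z * v q) \<in> polydisc I (\<lambda>q. 0) r" if "z \<in> ball 0 2" for z
      unfolding mem_polydisc
    proof
      fix q assume q: "q \<in> I"
      have "cmod (v q) < r / 2" using v q by (simp add: mem_polydisc)
      moreover have "cmod z * cmod (v q) \<le> 2 * cmod (v q)" using that by (intro mult_right_mono) auto
      ultimately show "cmod (z * v q - 0) < r" by (simp add: norm_mult)
    qed
    have zvS: "(\<lambda>q. z * v q) \<in> S" if "z \<in> ball 0 2" for z using zv[OF that] r by blast
    have he: "e p holomorphic_on ball 0 2" if "p \<in> I" for p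
      using chol_line[OF E[OF that], of "ball 0 2" "\<lambda>q. 0" v] zvS by (simp add: e_def)
    define V where "V = r / 2"
    have V: "V > 0" "\<And>q. q \<in> I \<Longrightarrow> cmod (v q) \<le> V" using v r by (auto simp: V_def mem_polydisc less_imp_le)
    \<comment> \<open>The count starts at \<open>2\<close> because \<open>E\<close> vanishes at
      \<open>0\<close> together with its first derivatives. Each step removes the lowest remaining
      coefficient of all coordinates simultaneously.\<close>
    have null: "\<forall>p\<in>I. \<forall>l<m+2. taylor_coeff (e p) l = 0" for m
    proof (induction m)
      case 0
      have "taylor_coeff (e p) l = 0" if p: "p \<in> I" and l: "l < 2" for p l
      proof (rule taylor_coeff_null[OF he[OF p], where n = 2 and \<rho> = 1 and C = "C0 * V\<^sup>2"])
        fix z :: complex assume z: "0 < cmod z" "cmod z < 1"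
        have "cmod (e p z) \<le> C0 * (V * cmod z)\<^sup>2"
          unfolding e_def
        proof (rule quad[OF p])
          show "cmod (z * v q) \<le> V * cmod z" if "q \<in> I" for q
            using V(2)[OF that] by (simp add: norm_mult mult.commute[of V] mult_left_mono)
          have "V * cmod z < V * 1" using V z by (intro mult_strict_left_mono) auto
          then show "V * cmod z < r" using r by (simp add: V_def)
        qed (use V z in auto)
        then show "cmod (e p z) \<le> C0 * V\<^sup>2 * cmod z ^ 2" by (simp add: power_mult_distrib)
      qed (use l in auto)
      then show ?case by simp
    next
      case (Suc m0)
      define m where "m = m0 + 2"
      have m: "m \<ge> 2" by (simp add: m_def)
      define a where "a = (\<lambda>p. taylor_coeff (e p) m)"
      have "\<exists>C\<ge>0. \<forall>z. cmod z \<le> 1 \<longrightarrow> cmod (e p z - a p * z ^ m) \<le> C * cmod z ^ Suc m" if p: "p \<in> I" for p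
      proof -
        obtain C where C: "C \<ge> 0" "\<And>z. cmod z \<le> 1 \<Longrightarrow> cmod (e p z - (\<Sum>l<Suc m. taylor_coeff (e p) l * z ^ l)) \<le> C * cmod z ^ Suc m"
          using taylor_remainder[OF he[OF p], of "Suc m"] by auto
        have "(\<Sum>l<Suc m. taylor_coeff (e p) l * z ^ l) = a p * z ^ m" for z
          using Suc p by (simp add: a_def m_def)
        then show ?thesis using C by metis
      qed
      then obtain C where C: "\<And>p. p \<in> I \<Longrightarrow> C p \<ge> 0"
          "\<And>p z. p \<in> I \<Longrightarrow> cmod z \<le> 1 \<Longrightarrow> cmod (e p z - a p * z ^ m) \<le> C p * cmod z ^ Suc m" by metis
      obtain A where A: "A > 0" "\<And>p. p \<in> I \<Longrightarrow> cmod (a p) \<le> A" using bounded_coords[OF I, of a] by blast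
      obtain C1 where C1: "C1 > 0" "\<And>p. p \<in> I \<Longrightarrow> cmod (complex_of_real (C p)) \<le> C1"
        using bounded_coords[OF I, of "\<lambda>p. complex_of_real (C p)"] by blast
      have eC1: "cmod (e p z - a p * z ^ m) \<le> C1 * cmod z ^ Suc m" if "p \<in> I" "cmod z \<le> 1" for p z
      proof -
        have "C p * cmod z ^ Suc m \<le> C1 * cmod z ^ Suc m"
          using C1(2)[OF that(1)] C(1)[OF that(1)] by (intro mult_right_mono) auto
        then show ?thesis using C(2)[OF that] by linarith
      qed
      have iter: "\<exists>K\<ge>0. \<exists>\<rho>>0. \<forall>z. 0 < cmod z \<longrightarrow> cmod z < \<rho> \<longrightarrow> (\<forall>p\<in>I. 
          cmod ((G ^^ k) (\<lambda>q. z * v q) p - z * v p - of_nat k * a p * z ^ m) \<le> K * cmod z ^ Suc m)" for k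
      proof (induction k)
        case 0
        show ?case by (rule exI[of _ 0]) (auto intro!: exI[of _ 1])
      next
        case (Suc k)
        then obtain K \<rho> where K: "K \<ge> 0" "\<rho> > 0" "\<And>z p. 0 < cmod z \<Longrightarrow> cmod z < \<rho> \<Longrightarrow> p \<in> I \<Longrightarrow>
           cmod ((G ^^ k) (\<lambda>q. z * v q) p - z * v p - of_nat k * a p * z ^ m) \<le> K * cmod z ^ Suc m" by metis
        define D where "D = real k * A + K"
        have D: "D \<ge> 0" using A K by (simp add: D_def)
        \<comment> \<open>The last bound keeps \<open>y\<close> and its iterate \<open>y'\<close>,
          both of size at most \<open>(V + D) |z|\<close>, within the range of
          \<open>lip\<close>.\<close>
        define \<rho>' where "\<rho>' = min \<rho> (min 1 (r / (4 * (V + D))))"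
        have \<rho>': "\<rho>' > 0" "\<rho>' \<le> \<rho>" "\<rho>' \<le> 1" "\<rho>' \<le> r / (4 * (V + D))"
          using K r V D by (auto simp: \<rho>'_def)
        have "cmod ((G ^^ Suc k) (\<lambda>q. z * v q) p - z * v p - of_nat (Suc k) * a p * z ^ m)
             \<le> (K + C1 + 24 * C0 * (V + D) * D) * cmod z ^ Suc m"
          if z: "0 < cmod z" "cmod z < \<rho>'" and p: "p \<in> I" for z p
        proof -
          define y where "y = (\<lambda>q. z * v q)"
          define y' where "y' = (G ^^ k) y"
          have z1: "cmod z < \<rho>" "cmod z \<le> 1" using z \<rho>' by auto
          have h1: "cmod (y' q - y q - of_nat k * a q * z ^ m) \<le> K * cmod z ^ Suc m" if "q \<in> I" for q
            using K(3)[OF z(1) z1(1) that] by (simp add: y_def y'_def)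
          have diff: "cmod (y' q - y q) \<le> D * cmod z ^ m" if q: "q \<in> I" for q
          proof -
            have "cmod (y' q - y q) \<le> cmod (y' q - y q - of_nat k * a q * z ^ m) + cmod (of_nat k * a q * z ^ m)"
              by (metis diff_add_cancel norm_triangle_ineq)
            also have "\<dots> \<le> K * cmod z ^ Suc m + real k * A * cmod z ^ m"
              using h1[OF q] A(2)[OF q] by (intro add_mono) (auto simp: norm_mult norm_power intro!: mult_right_mono mult_left_mono)
            also have "K * cmod z ^ Suc m \<le> K * cmod z ^ m"
              using K z1 by (intro mult_left_mono power_decreasing) auto
            finally show ?thesis by (simp add: D_def algebra_simps)
          qed
          have zm: "cmod z ^ m \<le> cmod z" using power_decreasing[of 1 m "cmod z"] z1 m by simp
          \<comment> \<open>Evaluating \<open>E\<close> at the iterate \<open>y'\<close> instead of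
            \<open>y\<close> costs an error of order \<open>m + 1\<close>: a Lipschitz constant of
            order \<open>|z|\<close> times a displacement of order \<open>|z|^m\<close>.\<close>
          have "cmod (E p y' - E p y) \<le> 24 * C0 * ((V + D) * cmod z) * (D * cmod z ^ m)"
          proof (rule lip[OF p])
            show "0 < (V + D) * cmod z" using V D z by simp
            have VD: "0 < 4 * (V + D)" using V D by simp
            have "cmod z < r / (4 * (V + D))" using z \<rho>'(4) by linarith
            then have "cmod z * (4 * (V + D)) < r" using VD by (simp only: pos_less_divide_eq)
            then show "4 * ((V + D) * cmod z) < r" by (simp only: mult_ac)
            show yq: "cmod (y q) \<le> (V + D) * cmod z" if "q \<in> I" for q
            proof -
              have "cmod (v q) \<le> V + D" using V(2)[OF that] D by simp
              then show ?thesis by (simp add: y_def norm_mult mult.commute[of "cmod z"] mult_right_mono)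
            qed
            show "cmod (y' q) \<le> (V + D) * cmod z" if "q \<in> I" for q
            proof -
              have "cmod (y' q) \<le> cmod (y q) + cmod (y' q - y q)" using norm_triangle_sub by blast
              also have "cmod (y q) \<le> V * cmod z" using V(2)[OF that] by (simp add: y_def norm_mult mult.commute[of V] mult_left_mono)
              also have "cmod (y' q - y q) \<le> D * cmod z" using diff[OF that] mult_left_mono[OF zm D] by linarith
              finally show ?thesis by (simp add: algebra_simps)
            qed
            show "0 \<le> D * cmod z ^ m" using D by simp
          qed (use diff in auto)
          moreover have "cmod (E p y - a p * z ^ m) \<le> C1 * cmod z ^ Suc m"
            using eC1[OF p z1(2)] by (simp add: e_def y_def)
          moreover have "(G ^^ Suc k) (\<lambda>q. z * v q) p - z * v p - of_nat (Suc k) * a p * z ^ m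
             = (y' p - y p - of_nat k * a p * z ^ m) + (E p y - a p * z ^ m) + (E p y' - E p y)"
            by (simp add: y'_def y_def E_def algebra_simps)
          ultimately have "cmod ((G ^^ Suc k) (\<lambda>q. z * v q) p - z * v p - of_nat (Suc k) * a p * z ^ m)
              \<le> K * cmod z ^ Suc m + C1 * cmod z ^ Suc m + 24 * C0 * ((V + D) * cmod z) * (D * cmod z ^ m)"
            using h1[OF p] by (metis add_mono norm_triangle_mono)
          then show ?thesis by (simp add: algebra_simps)
        qed
        moreover have "K + C1 + 24 * C0 * (V + D) * D \<ge> 0" using K C1 C0 V D by simp
        ultimately show ?case using \<rho>'(1) by meson
      qed
      have GkS: "(G ^^ k) x \<in> S" if "x \<in> S" for k x
        by (induction k) (use that GS in auto)
      have Gk: "chol I S (\<lambda>x. (G ^^ k) x p)" if "p \<in> I" for k p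
        using that
      proof (induction k arbitrary: p)
        case (Suc k)
        then show ?case
          using chol_compose[OF I I G[OF Suc.prems] Suc.IH S GkS] by simp
      qed (auto intro: chol_coord S)
      have "a p = 0" if p: "p \<in> I" for p
      proof (rule ccontr)
        assume ap: "a p \<noteq> 0"
        have "real k * cmod (a p) \<le> M + M" for k
        proof -
          define g where "g = (\<lambda>z. (G ^^ k) (\<lambda>q. z * v q) p - z * v p)"
          have hg: "g holomorphic_on ball 0 2"
            unfolding g_def using chol_line[OF Gk[OF p], of "ball 0 2" "\<lambda>q. 0" v k] zvS
            by (auto intro!: holomorphic_intros)
          obtain K \<rho> where "\<rho> > 0" "\<And>z. 0 < cmod z \<Longrightarrow> cmod z < \<rho> \<Longrightarrow>
             cmod (g z - of_nat k * a p * z ^ m) \<le> K * cmod z ^ Suc m" 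
            using iter[of k] p unfolding g_def by metis
          then have "taylor_coeff g m = of_nat k * a p"
            by (intro taylor_coeff_unique[OF hg]) auto
          moreover have "cmod (taylor_coeff g m) \<le> M + M"
          proof (rule taylor_coeff_bound[OF hg])
            fix z :: complex assume "z \<in> ball 0 2"
            then show "cmod (g z) \<le> M + M"
              unfolding g_def using bS[OF zvS p] bS[OF GkS[OF zvS] p]
              by (intro norm_triangle_le_diff add_mono) auto
          qed simp
          ultimately show ?thesis by (simp add: norm_mult)
        qed
        moreover obtain k where "real k * cmod (a p) > M + M"
          using ex_less_of_nat_mult[of "cmod (a p)" "M + M"] ap by auto
        ultimately show False by (meson not_le)
      qed
      then show ?case using Suc by (auto simp: a_def m_def less_Suc_eq)
    qed
    have "(\<lambda>l. taylor_coeff (e p) l * 1 ^ l) sums e p 1"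
      by (rule taylor_coeff_sums[OF he[OF p]]) simp
    moreover have "taylor_coeff (e p) l = 0" for l using null[of l] p by simp
    ultimately have "e p 1 = 0" by (simp add: sums_unique2[OF _ sums_zero])
    then show ?thesis by (simp add: e_def)
  qed
  have "E p x = 0"
    by (rule chol_identity[OF I E[OF x(2)] con zero _ _ x(1), of "r/2"]) (use r near0 x in auto)
  then show ?thesis by (simp add: E_def)
qed

text \<open>Undo the rotation: \<open>h (cnj u * f (u x))\<close> is a self-map of \<open>S\<close>
  that fixes \<open>0\<close> with the identity as derivative there, so Cartan's uniqueness theorem
  makes it the identity. Applying \<open>f\<close> gives the claim.\<close>

lemma biholomorphism_fixing_0_homogeneous:
  assumes S: "circled_domain I S" and T: "circled_domain I T"
    and fh: "mutual I S T f h" and hf: "mutual I T S h f" and f0: "\<And>p. p \<in> I \<Longrightarrow> f (\<lambda>p. 0) p = 0"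
    and x: "x \<in> S" and p: "p \<in> I" and u: "cmod u = 1"
  shows "f (\<lambda>p. u * x p) p = u * f x p"
proof -
  interpret S: circled_domain I S by (rule S)
  interpret T: circled_domain I T by (rule T)
  note f = mutualD[OF fh] and h = mutualD[OF hf]
  note I = S.fin
  define v where "v = cnj u"
  have v: "cmod v = 1" "u * v = 1" using u by (simp_all add: v_def complex_norm_square[symmetric])
  define R where "R = (\<lambda>x q. v * f (\<lambda>p. u * x p) q)"
  define G where "G = (\<lambda>x. h (R x))"
  have uS: "(\<lambda>p. u * x p) \<in> S" if "x \<in> S" for x by (rule S.rotate[OF that u])
  have RT: "R x \<in> T" if "x \<in> S" for x unfolding R_def by (intro T.rotate f uS that v)
  have fu: "chol I S (\<lambda>x. f (\<lambda>p. u * x p) q)" if "q \<in> I" for q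
    by (rule chol_compose[OF I I f(3)[OF that] _ S.opn uS]) (intro chol_mult chol_const chol_coord S.opn)
  have Rc: "chol I S (\<lambda>x. R x q)" if "q \<in> I" for q
    unfolding R_def by (intro chol_mult chol_const S.opn fu that)
  have R0: "R (\<lambda>p. 0) q = f (\<lambda>p. 0) q" if "q \<in> I" for q by (simp add: R_def f0[OF that])
  obtain M where M: "S \<subseteq> polydisc I (\<lambda>p. 0) M" using S.bdd by blast
  \<comment> \<open>At \<open>0\<close> the functions \<open>R\<close> and \<open>f\<close> take
    values that agree on \<open>I\<close> but may differ as functions, so the derivatives of
    \<open>h\<close> at these two representatives of one point have to be compared.\<close>
  have hf0: "dd (\<lambda>y. h y q) (R (\<lambda>p. 0)) w = dd (\<lambda>y. h y q) (f (\<lambda>p. 0)) w" if q: "q \<in> I" for q w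
  proof -
    obtain r where r: "r > 0" "polydisc I (f (\<lambda>p. 0)) r \<subseteq> T" using T.opn f(1)[OF S.zero] unfolding pd_open_def by blast
    obtain \<rho> where \<rho>: "\<rho> > 0" "\<And>z. z \<in> ball 0 \<rho> \<Longrightarrow> (\<lambda>p. f (\<lambda>p. 0) p + z * w p) \<in> polydisc I (f (\<lambda>p. 0)) r"
      using line_in_polydisc[OF I r(1), of "f (\<lambda>p. 0)" w] by blast
    have "eventually (\<lambda>z. z \<in> ball 0 \<rho>) (nhds (0::complex))"
      using \<rho>(1) by (intro eventually_nhds_in_open) auto
    then have "eventually (\<lambda>z. h (\<lambda>p. R (\<lambda>p. 0) p + z * w p) q = h (\<lambda>p. f (\<lambda>p. 0) p + z * w p) q) (nhds 0)"
    proof eventually_elim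
      case (elim z)
      then show ?case by (intro chol_cong_coords[OF h(3)[OF q]]) (use \<rho> r R0 in auto)
    qed
    then show ?thesis unfolding dd_def by (rule deriv_cong_ev) simp
  qed
  have GG: "G x q = x q" if xq: "x \<in> S" "q \<in> I" for x q
  proof (rule Cartan_uniqueness[OF I S.opn S.con S.zero, where M = M])
    show "cmod (y q) \<le> M" if "y \<in> S" "q \<in> I" for y q
      using M that by (force simp: mem_polydisc)
    show "G y \<in> S" if "y \<in> S" for y unfolding G_def by (intro h RT that)
    show "chol I S (\<lambda>x. G x q)" if "q \<in> I" for q
      unfolding G_def by (rule chol_compose[OF I I h(3)[OF that] Rc S.opn RT])
    show "G (\<lambda>p. 0) q = 0" if q: "q \<in> I" for q
    proof -
      have "h (R (\<lambda>p. 0)) q = h (f (\<lambda>p. 0)) q"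
        by (rule chol_cong_coords[OF h(3)[OF q] f(1)[OF S.zero]]) (rule R0)
      then show ?thesis using f(2)[OF S.zero q] by (simp add: G_def)
    qed
    fix q w assume q: "q \<in> I"
    have ddR: "dd (\<lambda>x. R x s) (\<lambda>p. 0) w = dd (\<lambda>x. f x s) (\<lambda>p. 0) w" if s: "s \<in> I" for s
    proof -
      have 1: "dd (\<lambda>x. R x s) (\<lambda>p. 0) w = v * dd (\<lambda>x. f (\<lambda>p. u * x p) s) (\<lambda>p. 0) w"
      proof -
        have "((\<lambda>z. R (\<lambda>p. 0 + z * w p) s) has_field_derivative v * dd (\<lambda>x. f (\<lambda>p. u * x p) s) (\<lambda>p. 0) w) (at 0)"
          unfolding R_def by (rule DERIV_cmult[OF has_field_derivative_dd[OF I fu[OF s] S.zero]])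
        then show ?thesis by (auto simp: dd_def dest: DERIV_imp_deriv)
      qed
      have "dd (\<lambda>x. f (\<lambda>p. u * x p) s) (\<lambda>p. 0) w = dd (\<lambda>x. f x s) (\<lambda>p. 0) (\<lambda>p. u * w p)"
        by (simp add: dd_def mult.left_commute[of _ u])
      also have "\<dots> = u * dd (\<lambda>x. f x s) (\<lambda>p. 0) w" by (rule dd_scale[OF I f(3)[OF s] S.zero])
      finally show ?thesis using 1 v by (simp add: mult.commute[of v] mult.left_commute[of v] mult.assoc[symmetric])
    qed
    have "dd (\<lambda>x. G x q) (\<lambda>p. 0) w = dd (\<lambda>y. h y q) (R (\<lambda>p. 0)) (\<lambda>s. dd (\<lambda>x. R x s) (\<lambda>p. 0) w)"
      unfolding G_def by (rule dd_compose[OF I I h(3)[OF q] Rc S.zero RT[OF S.zero]])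
    also have "\<dots> = dd (\<lambda>y. h y q) (f (\<lambda>p. 0)) (\<lambda>s. dd (\<lambda>x. R x s) (\<lambda>p. 0) w)" by (rule hf0[OF q])
    also have "\<dots> = dd (\<lambda>y. h y q) (f (\<lambda>p. 0)) (\<lambda>s. dd (\<lambda>x. f x s) (\<lambda>p. 0) w)"
      by (rule dd_cong[OF I h(3)[OF q] f(1)[OF S.zero]]) (rule ddR)
    also have "\<dots> = dd (\<lambda>x. h (f x) q) (\<lambda>p. 0) w"
      by (rule dd_compose[OF I I h(3)[OF q] f(3) S.zero f(1)[OF S.zero], symmetric])
    also have "\<dots> = w q" by (rule mutual_dd[OF I S.opn fh S.zero q])
    finally show "dd (\<lambda>x. G x q) (\<lambda>p. 0) w = w q" .
  qed (use xq in auto)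
  have "f (G x) p = R x p" unfolding G_def by (rule h(2)[OF RT[OF x] p])
  moreover have "f (G x) p = f x p"
    by (rule chol_cong_coords[OF f(3)[OF p] x]) (rule GG[OF x])
  ultimately have "u * f x p = u * v * f (\<lambda>p. u * x p) p" by (simp add: R_def)
  then show ?thesis using v by simp
qed

lemma biholomorphism_fixing_0_linear:
  assumes S: "circled_domain I S" and T: "circled_domain I T"
    and fh: "mutual I S T f h" and hf: "mutual I T S h f" and f0: "\<And>p. p \<in> I \<Longrightarrow> f (\<lambda>p. 0) p = 0"
    and x: "x \<in> S" and p: "p \<in> I"
  shows "f x p = dd (\<lambda>x. f x p) (\<lambda>p. 0) x"
  by (rule circled_domain.homogeneous_imp_linear[OF S mutualD(3)[OF fh p] x])
    (rule biholomorphism_fixing_0_homogeneous[OF S T fh hf f0 _ p])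

section \<open>Jacobian determinants\<close>

text \<open>Matrices over the index type \<open>'g\<close>, because determinants and Brouwer's
  theorem are wanted in \<open>complex^'g\<close>. They are unrelated to the matrices that form a
  tuple.\<close>

definition jac :: "(('g::finite \<Rightarrow> complex) \<Rightarrow> 'g \<Rightarrow> complex) \<Rightarrow> ('g \<Rightarrow> complex) \<Rightarrow> complex^'g^'g" where
  "jac f x = (\<chi> i j. dd (\<lambda>y. f y i) x (std_vec j))"

definition jdet :: "(('g::finite \<Rightarrow> complex) \<Rightarrow> 'g \<Rightarrow> complex) \<Rightarrow> ('g \<Rightarrow> complex) \<Rightarrow> complex" where
  "jdet f x = Determinants.det (jac f x)"

lemma dd_jac:
  assumes "\<And>i. chol UNIV S (\<lambda>x. f x i)" "x \<in> S"
  shows "dd (\<lambda>x. f x i) x v = (\<Sum>j\<in>UNIV. vec_nth (vec_nth (jac f x) i) j * v j)"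
  using dd_sum[OF finite_class.finite_UNIV assms(1) assms(2), of i v]
  by (simp add: jac_def mult.commute)

lemma jac_compose:
  assumes g: "\<And>i. chol UNIV T (\<lambda>x. g x i)" and f: "\<And>i. chol UNIV S (\<lambda>x. f x i)"
    and x: "x \<in> S" and fx: "f x \<in> T"
  shows "jac (\<lambda>x. g (f x)) x = jac g (f x) ** jac f x"
proof -
  have "dd (\<lambda>x. g (f x) i) x (std_vec j) = (\<Sum>k\<in>UNIV. vec_nth (vec_nth (jac g (f x)) i) k * vec_nth (vec_nth (jac f x) k) j)" for i j
    using dd_compose[OF finite_class.finite_UNIV finite_class.finite_UNIV g[of i] f x fx, of "std_vec j"]
    by (simp add: dd_jac[where f = g and S = T, OF g fx]) (simp add: jac_def)
  then show ?thesis by (simp add: jac_def matrix_matrix_mult_def vec_eq_iff)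
qed

lemma jdet_compose:
  assumes "\<And>i. chol UNIV T (\<lambda>x. g x i)" "\<And>i. chol UNIV S (\<lambda>x. f x i)" "x \<in> S" "f x \<in> T"
  shows "jdet (\<lambda>x. g (f x)) x = jdet g (f x) * jdet f x"
  by (simp add: jdet_def jac_compose[OF assms] Determinants.det_mul)

lemma jdet_mutual:
  fixes f h :: "('g::finite \<Rightarrow> complex) \<Rightarrow> 'g \<Rightarrow> complex"
  assumes S: "pd_open UNIV S" and fh: "mutual UNIV S T f h" and hf: "mutual UNIV T S h f" and x: "x \<in> S"
  shows "jdet h (f x) * jdet f x = 1"
proof -
  note f = mutualD[OF fh] and h = mutualD[OF hf]
  have "jac (\<lambda>x. h (f x)) x = Finite_Cartesian_Product.mat 1"
    by (auto simp: jac_def mutual_dd[OF finite_class.finite_UNIV S fh x] Finite_Cartesian_Product.mat_def vec_eq_iff)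
  then have "jdet (\<lambda>x. h (f x)) x = 1" by (simp add: jdet_def)
  then show ?thesis
    using jdet_compose[of T h S f x] f h x by simp
qed

lemma jdet_scale: "jdet (\<lambda>x p. u * x p) (x :: 'g::finite \<Rightarrow> complex) = u ^ CARD('g)"
proof -
  have "dd (\<lambda>y :: 'g \<Rightarrow> complex. u * y i) x (std_vec j) = (if i = j then u else 0)" for i j
    unfolding dd_def by (rule DERIV_imp_deriv) (auto intro!: derivative_eq_intros)
  then have "jac (\<lambda>x p. u * x p) x = (\<chi> i j. if i = j then u else 0)"
    by (simp add: jac_def)
  then show ?thesis
    by (simp add: jdet_def Determinants.det_diagonal)
qed

lemma chol_jdet:
  fixes f :: "('g::finite \<Rightarrow> complex) \<Rightarrow> 'g \<Rightarrow> complex"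
  assumes S: "pd_open UNIV S" and f: "\<And>i. chol UNIV S (\<lambda>x. f x i)"
  shows "chol UNIV S (jdet f)"
proof -
  have "chol UNIV S (\<lambda>x. \<Sum>p | p permutes (UNIV::'g set). of_int (sign p) * (\<Prod>i\<in>UNIV. dd (\<lambda>y. f y i) x (std_vec (p i))))"
    by (intro chol_sum chol_mult chol_prod chol_const chol_dd S f) simp
  then show ?thesis by (simp add: jdet_def[abs_def] Determinants.det_def jac_def)
qed

lemma det_bound:
  fixes A :: "complex^'g^'g"
  assumes "\<And>i j. cmod (vec_nth (vec_nth A i) j) \<le> K"
  shows "cmod (Determinants.det A) \<le> real (card {p. p permutes (UNIV::'g set)}) * K ^ CARD('g)"
proof -
  have "cmod (Determinants.det A) \<le> (\<Sum>p | p permutes (UNIV::'g set). K ^ CARD('g))"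
    unfolding Determinants.det_def
  proof (rule sum_norm_le)
    fix p :: "'g \<Rightarrow> 'g"
    have "cmod (\<Prod>i\<in>UNIV. vec_nth (vec_nth A i) (p i)) \<le> (\<Prod>i\<in>(UNIV::'g set). K)"
      unfolding prod_norm[symmetric] by (rule prod_mono) (use assms in auto)
    moreover have "cmod (of_int (sign p)) = 1" by (simp add: sign_def)
    ultimately show "cmod (of_int (sign p) * (\<Prod>i\<in>UNIV. vec_nth (vec_nth A i) (p i))) \<le> K ^ CARD('g)"
      by (simp add: norm_mult)
  qed
  then show ?thesis by simp
qed

lemma jdet_limit:
  fixes F :: "('g::finite \<Rightarrow> complex) \<Rightarrow> 'g \<Rightarrow> complex"
  assumes S: "pd_open UNIV S" and f: "\<And>k i. chol UNIV S (\<lambda>x. f k x i)"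
    and bf: "\<And>k x i. x \<in> S \<Longrightarrow> cmod (f k x i) \<le> M" and G: "G \<noteq> bot"
    and F: "\<And>x i. x \<in> S \<Longrightarrow> ((\<lambda>k. f k x i) \<longlongrightarrow> F x i) G" and x: "x \<in> S"
  shows "((\<lambda>k. jdet (f k) x) \<longlongrightarrow> jdet F x) G"
proof -
  have "((\<lambda>k. dd (\<lambda>y. f k y i) x v) \<longlongrightarrow> dd (\<lambda>y. F y i) x v) G" for i v
    by (rule loc_bounded_family_limit(2)[OF finite_class.finite_UNIV G
          loc_bounded_familyI[OF finite_class.finite_UNIV S, where M = M and \<phi> = "\<lambda>k x. f k x i"]])
      (use f bf F x in auto)
  then show ?thesis
    unfolding jdet_def Determinants.det_def jac_def by (simp, intro tendsto_intros) auto
qed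

lemma dd_bound:
  assumes hol: "chol I S \<phi>" and sub: "polydisc I x r \<subseteq> S" and r: "r > 0"
    and M: "\<And>y. y \<in> polydisc I x r \<Longrightarrow> cmod (\<phi> y) \<le> M" and v: "\<And>p. p \<in> I \<Longrightarrow> cmod (v p) \<le> 1"
  shows "cmod (dd \<phi> x v) \<le> 2 * M / r"
proof -
  have mem: "(\<lambda>p. x p + z * v p) \<in> polydisc I x r" if "z \<in> ball 0 r" for z
    unfolding mem_polydisc
  proof
    fix p assume p: "p \<in> I"
    have "cmod (z * v p) \<le> cmod z * 1" unfolding norm_mult by (intro mult_left_mono v p) simp
    then show "cmod (x p + z * v p - x p) < r" using that by simp
  qed
  define g where "g = (\<lambda>z. \<phi> (\<lambda>p. x p + z * v p))"
  have g: "g holomorphic_on ball 0 r"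
    unfolding g_def by (rule chol_line[OF hol]) (use mem sub in auto)
  have sub: "cball (0::complex) (r/2) \<subseteq> ball 0 r" using r by auto
  have "cmod ((deriv ^^ 1) g 0) \<le> fact 1 * M / (r/2) ^ 1"
  proof (rule Cauchy_inequality)
    show "g holomorphic_on ball 0 (r/2)" using g sub by (meson ball_subset_cball holomorphic_on_subset)
    show "continuous_on (cball 0 (r/2)) g"
      using holomorphic_on_imp_continuous_on[OF g] sub continuous_on_subset by blast
    fix z :: complex assume "cmod (0 - z) = r / 2"
    then show "cmod (g z) \<le> M" unfolding g_def using r by (intro M mem) auto
  qed (use r in auto)
  then show ?thesis by (simp add: g_def dd_def mult.commute)
qed

text \<open>The derivative at \<open>0\<close> of a self-map of \<open>S\<close> does not increase the supremum over \<open>S\<close> of the modulus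
  of any linear functional, so its powers are bounded.\<close>

lemma jdet_self_map:
  fixes A :: "('g::finite \<Rightarrow> complex) \<Rightarrow> 'g \<Rightarrow> complex"
  assumes S: "circled_domain UNIV S" and AS: "\<And>x. x \<in> S \<Longrightarrow> A x \<in> S" and A: "\<And>i. chol UNIV S (\<lambda>x. A x i)"
  shows "cmod (jdet A (\<lambda>p. 0)) \<le> 1"
proof -
  interpret circled_domain UNIV S by (rule S)
  define T where "T = jac A (\<lambda>p. 0)"
  \<comment> \<open>\<open>\<psi>\<close> is the functional with coefficients \<open>a\<close> after
    \<open>A\<close>. The functional after the derivative of \<open>A\<close> is the degree-one
    component of \<open>\<psi>\<close>, and components obey the bound on circles. The value of
    \<open>A\<close> at \<open>0\<close> contributes to degree zero alone.\<close>
  have step: "cmod (\<Sum>i\<in>UNIV. a i * (\<Sum>j\<in>UNIV. vec_nth (vec_nth T i) j * x j)) \<le> B"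
    if a: "\<And>x. x \<in> S \<Longrightarrow> cmod (\<Sum>i\<in>UNIV. a i * x i) \<le> B" and x: "x \<in> S" for a B x
  proof -
    define \<psi> where "\<psi> = (\<lambda>x. \<Sum>i\<in>UNIV. a i * A x i)"
    have \<psi>: "chol UNIV S \<psi>" unfolding \<psi>_def by (intro chol_sum chol_mult chol_const opn A)
    have "cmod (hom_part \<psi> 1 x) \<le> B"
      by (rule hom_part_bound[OF \<psi> x]) (simp add: \<psi>_def a AS rotate x)
    moreover have "hom_part \<psi> 1 x = (\<Sum>i\<in>UNIV. a i * dd (\<lambda>x. A x i) (\<lambda>p. 0) x)"
      unfolding hom_part_1 
      by (subst dd_def, rule DERIV_imp_deriv, unfold \<psi>_def)
        (intro DERIV_sum DERIV_cmult has_field_derivative_dd[OF fin A zero])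
    ultimately show ?thesis by (simp add: dd_jac[where f = A and S = S, OF A zero] T_def)
  qed
  \<comment> \<open>\<open>P n\<close> is the \<open>n\<close>-th power of the derivative. Its rows
    are functionals, to which \<open>step\<close> applies repeatedly, starting from the coordinate
    functionals.\<close>
  define P where "P = rec_nat (Finite_Cartesian_Product.mat 1) (\<lambda>_ Q. Q ** T)"
  have P: "P 0 = Finite_Cartesian_Product.mat 1" "P (Suc n) = P n ** T" for n by (simp_all add: P_def)
  obtain M where M: "S \<subseteq> polydisc UNIV (\<lambda>p. 0) M" using bdd by blast
  have Pb: "cmod (\<Sum>j\<in>UNIV. vec_nth (vec_nth (P n) i) j * x j) \<le> M" if "x \<in> S" for n i x
    using that
  proof (induction n arbitrary: x)
    case 0
    have "(\<Sum>j\<in>UNIV. vec_nth (vec_nth (P 0) i) j * x j) = x i"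
      by (simp add: P Finite_Cartesian_Product.mat_def if_distrib[of "\<lambda>c. c * _"] cong: if_cong)
    then show ?case using M 0 by (auto simp: mem_polydisc intro!: less_imp_le)
  next
    case (Suc n)
    have "(\<Sum>j\<in>UNIV. vec_nth (vec_nth (P (Suc n)) i) j * x j)
       = (\<Sum>j\<in>UNIV. \<Sum>k\<in>UNIV. vec_nth (vec_nth (P n) i) k * (vec_nth (vec_nth T k) j * x j))"
      by (simp add: P matrix_matrix_mult_def sum_distrib_right mult.assoc)
    also have "\<dots> = (\<Sum>k\<in>UNIV. vec_nth (vec_nth (P n) i) k * (\<Sum>j\<in>UNIV. vec_nth (vec_nth T k) j * x j))"
      unfolding sum_distrib_left by (rule sum.swap)
    finally show ?case using step[OF Suc.IH Suc.prems] by simp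
  qed
  obtain r where r: "r > 0" "polydisc UNIV (\<lambda>p. 0) r \<subseteq> S" by (rule zero_polydisc)
  have entry: "cmod (vec_nth (vec_nth (P n) i) j) \<le> M / (r/2)" for n i j
  proof -
    have "(\<lambda>p. of_real (r/2) * std_vec j p) \<in> S"
      using r by (intro subsetD[OF r(2)]) (auto simp: mem_polydisc)
    from Pb[OF this, of n i] have "cmod (vec_nth (vec_nth (P n) i) j * of_real (r/2)) \<le> M"
      by (simp add: if_distrib[of "\<lambda>c. _ * c"] cong: if_cong)
    then show ?thesis using r by (simp add: norm_mult field_simps)
  qed
  have detP: "Determinants.det (P n) = Determinants.det T ^ n" for n
    by (induction n) (simp_all add: P Determinants.det_mul)
  have bound: "cmod (Determinants.det T) ^ n \<le> real (card {p. p permutes (UNIV::'g set)}) * (M / (r/2)) ^ CARD('g)" for n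
    using det_bound[of "P n", OF entry] by (simp add: detP norm_power)
  show ?thesis
  proof (rule ccontr)
    assume "\<not> ?thesis"
    then have "1 < cmod (Determinants.det T)" by (simp add: jdet_def T_def)
    then obtain n where "real (card {p. p permutes (UNIV::'g set)}) * (M / (r/2)) ^ CARD('g) < cmod (Determinants.det T) ^ n"
      using real_arch_pow by blast
    then show False using bound[of n] by simp
  qed
qed

lemma has_real_derivative_norm_square:
  fixes F :: "real \<Rightarrow> complex"
  assumes "(F has_vector_derivative D) (at t)"
  shows "((\<lambda>\<theta>. (cmod (F \<theta>))\<^sup>2) has_real_derivative 2 * Re (cnj (F t) * D)) (at t)"
proof -
  have R: "((\<lambda>\<theta>. Re (F \<theta>)) has_real_derivative Re D) (at t)" and I: "((\<lambda>\<theta>. Im (F \<theta>)) has_real_derivative Im D) (at t)"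
    using bounded_linear.has_vector_derivative[OF bounded_linear_Re assms]
      bounded_linear.has_vector_derivative[OF bounded_linear_Im assms]
    by (simp_all add: has_real_derivative_iff_has_vector_derivative)
  have "((\<lambda>\<theta>. (Re (F \<theta>))\<^sup>2 + (Im (F \<theta>))\<^sup>2) has_real_derivative 2 * Re (cnj (F t) * D)) (at t)"
    by (rule DERIV_cong[OF DERIV_add[OF DERIV_power[OF R, of 2] DERIV_power[OF I, of 2]]]) (simp add: algebra_simps)
  then show ?thesis by (simp add: cmod_power2)
qed

lemma has_vector_derivative_circle:
  assumes "(g has_field_derivative D) (at 1)"
  shows "((\<lambda>\<theta>. g (cis \<theta>)) has_vector_derivative \<i> * D) (at 0)"
proof -
  have "((\<lambda>z. exp (\<i> * z)) has_field_derivative \<i>) (at (of_real 0))"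
    by (auto intro!: derivative_eq_intros)
  from has_vector_derivative_real_field[OF this] have "(cis has_vector_derivative \<i>) (at 0)"
    by (simp add: cis_conv_exp[abs_def])
  then have "(g \<circ> cis has_vector_derivative \<i> * D) (at 0)"
    by (rule field_vector_diff_chain_at) (use assms in simp)
  then show ?thesis by (simp add: o_def)
qed

lemma has_vector_derivative_radius:
  assumes "(g has_field_derivative D) (at 1)"
  shows "((\<lambda>t. g (of_real t)) has_vector_derivative D) (at 1)"
  by (rule has_vector_derivative_real_field) (use assms in simp)

definition sq_norm :: "('g::finite \<Rightarrow> complex) \<Rightarrow> real" where
  "sq_norm x = (\<Sum>i\<in>UNIV. (cmod (x i))\<^sup>2)"

definition rotated :: "(('g \<Rightarrow> complex) \<Rightarrow> 'g \<Rightarrow> complex) \<Rightarrow> (('g \<Rightarrow> complex) \<Rightarrow> 'g \<Rightarrow> complex) \<Rightarrow> complex \<Rightarrow>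
    ('g \<Rightarrow> complex) \<Rightarrow> 'g \<Rightarrow> complex" where
  "rotated f h u x = f (\<lambda>p. \<i> * h (\<lambda>p. u * f x p) p)"

text \<open>Let \<open>q = f 0\<close>. To first order \<open>rotated f h (cis \<theta>)\<close> maps \<open>0\<close> to \<open>q - \<theta> q\<close>. The weight
  \<open>exp (- sq_norm q)\<close> then increases, while the Jacobian determinant does not decrease to first order, by the
  maximum principle for \<open>\<zeta> \<mapsto> jdet h (\<zeta> q)\<close>.\<close>

lemma extremal_fixes_0:
  fixes f h :: "('g::finite \<Rightarrow> complex) \<Rightarrow> 'g \<Rightarrow> complex"
  assumes S: "circled_domain UNIV S" and T: "circled_domain UNIV T"
    and fh: "mutual UNIV S T f h" and hf: "mutual UNIV T S h f"
    and extremal: "\<And>u. cmod u = 1 \<Longrightarrow> cmod (jdet (rotated f h u) (\<lambda>p. 0)) * exp (- sq_norm (rotated f h u (\<lambda>p. 0)))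
        \<le> cmod (jdet f (\<lambda>p. 0)) * exp (- sq_norm (f (\<lambda>p. 0)))"
  shows "f (\<lambda>p. 0) = (\<lambda>p. 0)"
proof -
  interpret S: circled_domain UNIV S by (rule S)
  interpret T: circled_domain UNIV T by (rule T)
  note f = mutualD[OF fh, simplified] and h = mutualD[OF hf, simplified]
  note I = finite_class.finite_UNIV[where 'a = 'g]
  define o0 :: "'g \<Rightarrow> complex" where "o0 = (\<lambda>p. 0)"
  define q where "q = f o0"
  have oS: "o0 \<in> S" using S.zero by (simp add: o0_def)
  have qT: "q \<in> T" unfolding q_def by (rule f(1)[OF oS])
  have hq: "h q = o0" using f(2)[OF oS] by (auto simp: q_def)
  have rotT: "(\<lambda>p. u * x p) \<in> T" if "x \<in> T" "cmod u = 1" for x u by (rule T.rotate[OF that])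
  have rotS: "(\<lambda>p. u * x p) \<in> S" if "x \<in> S" "cmod u = 1" for x u by (rule S.rotate[OF that])
  have scS: "chol UNIV S (\<lambda>x. u * x i)" for u i by (intro chol_mult chol_const chol_coord S.opn) simp
  have scT: "chol UNIV T (\<lambda>x. u * x i)" for u i by (intro chol_mult chol_const chol_coord T.opn) simp
  define \<psi> where "\<psi> = jdet h"
  have \<psi>: "chol UNIV T \<psi>" unfolding \<psi>_def by (rule chol_jdet[OF T.opn h(3)])
  define a where "a = jdet f o0"
  have inv: "\<psi> (f x) * jdet f x = 1" if "x \<in> S" for x
    unfolding \<psi>_def by (rule jdet_mutual[OF S.opn fh hf that])
  have \<psi>q: "\<psi> q * a = 1" using inv[OF oS] by (simp add: q_def a_def)
  define \<kappa> where "\<kappa> = (\<lambda>z. \<psi> (\<lambda>p. z * q p))"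
  \<comment> \<open>The quarter turn of \<open>S\<close> transported to \<open>T\<close> by
    \<open>f\<close>. It fixes \<open>q\<close> because \<open>h q\<close> is
    \<open>0\<close>.\<close>
  define s where "s = (\<lambda>y. f (\<lambda>p. \<i> * h y p))"
  define \<kappa>2 where "\<kappa>2 = (\<lambda>z. \<psi> (s (\<lambda>p. z * q p)))"
  have ih: "(\<lambda>p. \<i> * h y p) \<in> S" if "y \<in> T" for y by (intro rotS h(1) that) simp
  have ihc: "chol UNIV T (\<lambda>y. \<i> * h y i)" for i by (intro chol_mult chol_const T.opn h(3))
  have sT: "s y \<in> T" if "y \<in> T" for y unfolding s_def by (intro f(1) ih that)
  have sc: "chol UNIV T (\<lambda>y. s y i)" for i unfolding s_def by (rule chol_compose[OF I I f(3) ihc T.opn ih])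
  have sq: "s q = q" by (simp only: s_def hq) (simp add: q_def o0_def)
  have \<kappa>1: "\<kappa> 1 = \<psi> q" "\<kappa>2 1 = \<psi> q" by (simp_all add: \<kappa>_def \<kappa>2_def sq)
  have \<kappa>ne: "\<kappa> 1 \<noteq> 0" using \<psi>q by (auto simp: \<kappa>1)
  obtain r where r: "r > 0" "polydisc UNIV q r \<subseteq> T" using T.opn qT unfolding pd_open_def by blast
  obtain \<rho> where \<rho>: "\<rho> > 0" "\<And>z. z \<in> ball 0 \<rho> \<Longrightarrow> (\<lambda>p. q p + z * q p) \<in> polydisc UNIV q r"
    using line_in_polydisc[OF I r(1), of q q] by blast
  have near: "(\<lambda>p. z * q p) \<in> T" if "z \<in> ball 1 \<rho>" for z
    using subsetD[OF r(2) \<rho>(2), of "z - 1"] that by (simp add: dist_norm norm_minus_commute algebra_simps)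
  define k where "k = dd \<psi> q q"
  have d\<kappa>: "(\<kappa> has_field_derivative k) (at 1)"
  proof -
    have "((\<lambda>z. \<psi> (\<lambda>p. z * q p)) has_field_derivative dd \<psi> (\<lambda>p. 1 * q p) (\<lambda>p. deriv (\<lambda>z. z * q p) 1)) (at 1)"
      by (rule chol_chain_rule[OF I \<psi>, of "ball 1 \<rho>" 1 "\<lambda>z p. z * q p"]) (use \<rho> qT in \<open>auto intro!: holomorphic_intros\<close>)
    then show ?thesis by (simp add: \<kappa>_def k_def)
  qed
  have dds: "dd (\<lambda>y. s y i) q q = \<i> * q i" for i
  proof -
    have "dd (\<lambda>y. s y i) q q = dd (\<lambda>x. f x i) (\<lambda>p. \<i> * h q p) (\<lambda>p. dd (\<lambda>y. \<i> * h y p) q q)"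
      unfolding s_def by (rule dd_compose[where \<phi> = "\<lambda>x. f x i" and f = "\<lambda>y p. \<i> * h y p", OF I I f(3) ihc qT ih[OF qT]])
    also have "(\<lambda>p. \<i> * h q p) = o0" by (simp add: hq o0_def)
    also have "(\<lambda>p. dd (\<lambda>y. \<i> * h y p) q q) = (\<lambda>p. \<i> * dd (\<lambda>y. h y p) q q)"
    proof
      fix p
      show "dd (\<lambda>y. \<i> * h y p) q q = \<i> * dd (\<lambda>y. h y p) q q"
        by (subst dd_def, rule DERIV_imp_deriv) (rule DERIV_cmult[OF has_field_derivative_dd[OF I h(3) qT]])
    qed
    also have "dd (\<lambda>x. f x i) o0 (\<lambda>p. \<i> * dd (\<lambda>y. h y p) q q) = \<i> * dd (\<lambda>x. f x i) o0 (\<lambda>p. dd (\<lambda>y. h y p) q q)"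
      by (rule dd_scale[OF I f(3) oS])
    also have "dd (\<lambda>x. f x i) o0 (\<lambda>p. dd (\<lambda>y. h y p) q q) = dd (\<lambda>y. f (h y) i) q q"
      using dd_compose[OF I I f(3) h(3) qT h(1)[OF qT], of i q] by (simp add: hq)
    also have "\<dots> = q i" by (rule mutual_dd[OF I T.opn hf qT]) simp
    finally show ?thesis .
  qed
  have ds: "((\<lambda>z. s (\<lambda>p. z * q p) i) has_field_derivative \<i> * q i) (at 1)" for i
  proof -
    have "((\<lambda>z. s (\<lambda>p. z * q p) i) has_field_derivative dd (\<lambda>y. s y i) (\<lambda>p. 1 * q p) (\<lambda>p. deriv (\<lambda>z. z * q p) 1)) (at 1)"
      by (rule chol_chain_rule[OF I sc, of "ball 1 \<rho>" 1 "\<lambda>z p. z * q p"]) (use \<rho> qT in \<open>auto intro!: holomorphic_intros\<close>)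
    then show ?thesis by (simp add: dds)
  qed
  have d\<kappa>2: "(\<kappa>2 has_field_derivative \<i> * k) (at 1)"
  proof -
    have "((\<lambda>z. \<psi> (s (\<lambda>p. z * q p))) has_field_derivative dd \<psi> (s (\<lambda>p. 1 * q p)) (\<lambda>i. deriv (\<lambda>z. s (\<lambda>p. z * q p) i) 1)) (at 1)"
    proof (rule chol_chain_rule[OF I \<psi>, of "ball 1 \<rho>" 1 "\<lambda>z. s (\<lambda>p. z * q p)"])
      show "(\<lambda>z. s (\<lambda>p. z * q p) i) holomorphic_on ball 1 \<rho>" for i
        by (rule chol_curve[OF sc]) (use near in \<open>auto intro!: holomorphic_intros\<close>)
    qed (use \<rho> qT in \<open>auto simp: sq\<close>)
    moreover have "deriv (\<lambda>z. s (\<lambda>p. z * q p) i) 1 = \<i> * q i" for i by (rule DERIV_imp_deriv[OF ds])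
    ultimately show ?thesis by (simp add: \<kappa>2_def sq k_def dd_scale[OF I \<psi> qT])
  qed
  \<comment> \<open>The self-map \<open>h (u * f x)\<close> of \<open>S\<close> has determinant
    \<open>\<kappa> u * u^g * a\<close> at \<open>0\<close>, of modulus at most \<open>1\<close>,
    while \<open>\<kappa> 1 * a\<close> equals \<open>1\<close>.\<close>
  have le1: "cmod (\<kappa> u) \<le> cmod (\<kappa> 1)" if u: "cmod u = 1" for u
  proof -
    have c1: "chol UNIV S (\<lambda>x. u * f x i)" for i by (intro chol_mult chol_const S.opn f(3))
    have "cmod (jdet (\<lambda>x. h (\<lambda>p. u * f x p)) (\<lambda>p. 0)) \<le> 1"
      by (rule jdet_self_map[OF S]) (intro h(1) rotT f(1) u chol_compose[OF I I h(3) c1 S.opn], assumption+)+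
    moreover have "jdet (\<lambda>x. h (\<lambda>p. u * f x p)) o0 = jdet h (\<lambda>p. u * f o0 p) * jdet (\<lambda>x p. u * f x p) o0"
      by (rule jdet_compose[OF h(3) c1 oS]) (intro rotT f(1) oS u)
    moreover have "jdet (\<lambda>x p. u * f x p) o0 = jdet (\<lambda>x p. u * x p) (f o0) * jdet f o0"
      by (rule jdet_compose[OF scT f(3) oS f(1)[OF oS]])
    ultimately have "cmod (\<kappa> u) * cmod a \<le> 1"
      by (simp add: jdet_scale norm_mult norm_power u \<kappa>_def \<psi>_def q_def a_def o0_def)
    also have "1 = cmod (\<kappa> 1) * cmod a" using \<psi>q by (metis \<kappa>1(1) norm_mult norm_one)
    finally show ?thesis using \<psi>q by (auto simp: mult_le_cancel_right)
  qed
  \<comment> \<open>On the unit circle \<open>|\<kappa>|\<close> is largest at \<open>1\<close>, so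
    its tangential derivative vanishes there.\<close>
  have circ0: "2 * Re (cnj (\<kappa> 1) * (\<i> * k)) = 0"
  proof (rule DERIV_local_max[of "\<lambda>\<theta>. (cmod (\<kappa> (cis \<theta>)))\<^sup>2" _ 0 1])
    show "((\<lambda>\<theta>. (cmod (\<kappa> (cis \<theta>)))\<^sup>2) has_real_derivative 2 * Re (cnj (\<kappa> 1) * (\<i> * k))) (at 0)"
      using has_real_derivative_norm_square[OF has_vector_derivative_circle[OF d\<kappa>]] by simp
  qed (auto intro!: power_mono le1)
  \<comment> \<open>A negative radial derivative would make \<open>|\<kappa>|\<close> exceed its
    maximum over the circle at points just inside. For small \<open>t\<close> these points lie in
    \<open>T\<close>, where \<open>circle_maximum_principle\<close> forbids it.\<close>
  have radial: "2 * Re (cnj (\<kappa> 1) * k) \<ge> 0"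
  proof (rule ccontr)
    assume "\<not> ?thesis"
    then have neg: "2 * Re (cnj (\<kappa> 1) * k) < 0" by simp
    have D: "((\<lambda>t. (cmod (\<kappa> (of_real t)))\<^sup>2) has_real_derivative 2 * Re (cnj (\<kappa> 1) * k)) (at 1)"
      using has_real_derivative_norm_square[OF has_vector_derivative_radius[OF d\<kappa>]] by simp
    obtain d where d: "d > 0" "\<And>t. 0 < t \<Longrightarrow> t < d \<Longrightarrow> (cmod (\<kappa> (of_real 1)))\<^sup>2 < (cmod (\<kappa> (of_real (1 - t))))\<^sup>2"
      using DERIV_neg_dec_left[OF D neg] by blast
    define t where "t = min (min d \<rho>) 1 / 2"
    have t: "0 < t" "t < d" "t < \<rho>" "t < 1" using d \<rho> by (auto simp: t_def)
    have tT: "(\<lambda>p. of_real (1 - t) * q p) \<in> T"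
      by (rule near) (use t in \<open>simp add: dist_norm\<close>)
    have "cmod (\<psi> (\<lambda>p. of_real (1 - t) * q p)) \<le> cmod (\<kappa> 1)"
    proof (rule T.circle_maximum_principle[OF \<psi> qT _ _ tT])
      show "cmod (\<psi> (\<lambda>p. u * q p)) \<le> cmod (\<kappa> 1)" if "cmod u = 1" for u
        using le1[OF that] by (simp add: \<kappa>_def)
    qed (unfold norm_of_real, use t in simp)
    then have "(cmod (\<kappa> (of_real (1 - t))))\<^sup>2 \<le> (cmod (\<kappa> 1))\<^sup>2" by (intro power_mono) (auto simp: \<kappa>_def)
    then show False using d(2)[OF t(1,2)] unfolding of_real_1 by linarith
  qed
  \<comment> \<open>By the chain rule the determinant of the competitor at \<open>0\<close> has
    modulus \<open>|\<kappa> u| |a| / |\<kappa>2 u|\<close>. Clearing the denominator and squaring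
    turns extremality into an inequality between differentiable functions of the angle.\<close>
  have ineq: "(cmod (\<kappa> u))\<^sup>2 * exp (2 * sq_norm q) \<le> (cmod (\<kappa>2 u))\<^sup>2 * exp (2 * sq_norm (s (\<lambda>p. u * q p)))"
    if u: "cmod u = 1" for u
  proof -
    have uqT: "(\<lambda>p. u * q p) \<in> T" by (rule rotT[OF qT u])
    have ufT: "(\<lambda>p. u * f x p) \<in> T" if "x \<in> S" for x by (rule rotT[OF f(1)[OF that] u])
    have c1: "chol UNIV S (\<lambda>x. u * f x i)" for i by (intro chol_mult chol_const S.opn f(3))
    have rot: "rotated f h u = (\<lambda>x. s (\<lambda>p. u * f x p))" by (rule ext) (simp add: rotated_def s_def)
    have j1: "jdet (rotated f h u) o0 = jdet s (\<lambda>p. u * q p) * (u ^ CARD('g) * a)"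
    proof -
      have "jdet (rotated f h u) o0 = jdet s (\<lambda>p. u * f o0 p) * jdet (\<lambda>x p. u * f x p) o0"
        unfolding rot by (rule jdet_compose[OF sc c1 oS ufT[OF oS]])
      also have "jdet (\<lambda>x p. u * f x p) o0 = jdet (\<lambda>x p. u * x p) (f o0) * jdet f o0"
        by (rule jdet_compose[OF scT f(3) oS f(1)[OF oS]])
      finally show ?thesis by (simp add: jdet_scale q_def a_def)
    qed
    have j2: "jdet s y = jdet f (\<lambda>p. \<i> * h y p) * (\<i> ^ CARD('g) * jdet h y)" if y: "y \<in> T" for y
    proof -
      have "jdet s y = jdet f (\<lambda>p. \<i> * h y p) * jdet (\<lambda>y p. \<i> * h y p) y"
        unfolding s_def by (rule jdet_compose[OF f(3) ihc y ih[OF y]])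
      also have "jdet (\<lambda>y p. \<i> * h y p) y = jdet (\<lambda>x p. \<i> * x p) (h y) * jdet h y"
        by (rule jdet_compose[OF scS h(3) y h(1)[OF y]])
      finally show ?thesis by (simp add: jdet_scale)
    qed
    have j3: "\<kappa>2 u * jdet f (\<lambda>p. \<i> * h (\<lambda>p. u * q p) p) = 1"
      unfolding \<kappa>2_def s_def by (rule inv[OF ih[OF uqT]])
    have "cmod (\<kappa>2 u) * cmod (jdet (rotated f h u) o0) = cmod (\<kappa>2 u * jdet f (\<lambda>p. \<i> * h (\<lambda>p. u * q p) p)) * (cmod (\<kappa> u) * cmod a)"
      by (simp add: j1 j2[OF uqT] norm_mult norm_power u \<kappa>_def \<psi>_def)
    then have eq: "cmod (\<kappa>2 u) * cmod (jdet (rotated f h u) o0) = cmod (\<kappa> u) * cmod a" by (simp add: j3)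
    define A where "A = exp (- sq_norm (s (\<lambda>p. u * q p)))"
    define B where "B = exp (- sq_norm q)"
    have "cmod (jdet (rotated f h u) o0) * A \<le> cmod a * B"
      using extremal[OF u] by (simp add: o0_def[symmetric] rot a_def A_def B_def q_def)
    then have "cmod (\<kappa>2 u) * (cmod (jdet (rotated f h u) o0) * A) \<le> cmod (\<kappa>2 u) * (cmod a * B)"
      by (rule mult_left_mono) simp
    then have "(cmod (\<kappa> u) * A) * cmod a \<le> (cmod (\<kappa>2 u) * B) * cmod a"
      using eq by (simp add: mult.assoc[symmetric]) (simp add: mult_ac)
    moreover have "cmod a > 0" using \<psi>q by auto
    ultimately have "cmod (\<kappa> u) * A \<le> cmod (\<kappa>2 u) * B" by (simp add: mult_le_cancel_right)
    then have "(cmod (\<kappa> u) * A)\<^sup>2 \<le> (cmod (\<kappa>2 u) * B)\<^sup>2"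
      by (intro power_mono) (auto simp: A_def)
    then have "(cmod (\<kappa> u))\<^sup>2 * A\<^sup>2 * (exp (2 * sq_norm q) * exp (2 * sq_norm (s (\<lambda>p. u * q p))))
        \<le> (cmod (\<kappa>2 u))\<^sup>2 * B\<^sup>2 * (exp (2 * sq_norm q) * exp (2 * sq_norm (s (\<lambda>p. u * q p))))"
      by (intro mult_right_mono) (auto simp: power_mult_distrib)
    moreover have AB: "A\<^sup>2 * exp (2 * sq_norm (s (\<lambda>p. u * q p))) = 1" "B\<^sup>2 * exp (2 * sq_norm q) = 1"
      by (simp_all add: A_def B_def power2_eq_square exp_add[symmetric])
    moreover have "(cmod (\<kappa> u))\<^sup>2 * A\<^sup>2 * (X * Y) = (cmod (\<kappa> u))\<^sup>2 * X * (A\<^sup>2 * Y)"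
        "(cmod (\<kappa>2 u))\<^sup>2 * B\<^sup>2 * (X * Y) = (cmod (\<kappa>2 u))\<^sup>2 * Y * (B\<^sup>2 * X)" for X Y
      by (simp_all only: mult_ac)
    ultimately show ?thesis by (simp only: mult_1_right)
  qed
  \<comment> \<open>Nonnegative by \<open>ineq\<close> and zero at \<open>\<theta> = 0\<close>, so
    its derivative there vanishes.\<close>
  define \<Delta> where "\<Delta> = (\<lambda>\<theta>. (cmod (\<kappa>2 (cis \<theta>)))\<^sup>2 * exp (2 * sq_norm (s (\<lambda>p. cis \<theta> * q p))) - (cmod (\<kappa> (cis \<theta>)))\<^sup>2 * exp (2 * sq_norm q))"
  define E where "E = exp (2 * sq_norm q)"
  have dN: "((\<lambda>\<theta>. sq_norm (s (\<lambda>p. cis \<theta> * q p))) has_real_derivative - 2 * sq_norm q) (at 0)"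
  proof -
    have "((\<lambda>\<theta>. (cmod (s (\<lambda>p. cis \<theta> * q p) i))\<^sup>2) has_real_derivative 2 * Re (cnj (s (\<lambda>p. cis 0 * q p) i) * (\<i> * (\<i> * q i)))) (at 0)" for i
      by (rule has_real_derivative_norm_square[OF has_vector_derivative_circle[OF ds]])
    moreover have "2 * Re (cnj (s (\<lambda>p. cis 0 * q p) i) * (\<i> * (\<i> * q i))) = - 2 * (cmod (q i))\<^sup>2" for i
      unfolding cmod_power2 by (simp add: sq power2_eq_square)
    ultimately have "((\<lambda>\<theta>. \<Sum>i\<in>UNIV. (cmod (s (\<lambda>p. cis \<theta> * q p) i))\<^sup>2) has_real_derivative (\<Sum>i\<in>UNIV. - 2 * (cmod (q i))\<^sup>2)) (at 0)"
      by (intro DERIV_sum) metis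
    then show ?thesis by (simp add: sq_norm_def sum_distrib_left sum_negf)
  qed
  have "(\<Delta> has_real_derivative (2 * Re (cnj (\<kappa> 1) * (\<i> * (\<i> * k)))) * E + (E * (2 * (- 2 * sq_norm q))) * (cmod (\<kappa> 1))\<^sup>2
       - 2 * Re (cnj (\<kappa> 1) * (\<i> * k)) * E) (at 0)"
  proof -
    have 1: "((\<lambda>\<theta>. (cmod (\<kappa>2 (cis \<theta>)))\<^sup>2) has_real_derivative 2 * Re (cnj (\<kappa> 1) * (\<i> * (\<i> * k)))) (at 0)"
      using has_real_derivative_norm_square[OF has_vector_derivative_circle[OF d\<kappa>2]] by (simp add: \<kappa>1)
    have 2: "((\<lambda>\<theta>. (cmod (\<kappa> (cis \<theta>)))\<^sup>2) has_real_derivative 2 * Re (cnj (\<kappa> 1) * (\<i> * k))) (at 0)"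
      using has_real_derivative_norm_square[OF has_vector_derivative_circle[OF d\<kappa>]] by simp
    have 3: "((\<lambda>\<theta>. exp (2 * sq_norm (s (\<lambda>p. cis \<theta> * q p)))) has_real_derivative E * (2 * (- 2 * sq_norm q))) (at 0)"
      using DERIV_chain2[OF DERIV_exp DERIV_cmult[OF dN, of 2]] by (simp add: sq E_def)
    have "(\<Delta> has_real_derivative (2 * Re (cnj (\<kappa> 1) * (\<i> * (\<i> * k)))) * exp (2 * sq_norm (s (\<lambda>p. cis 0 * q p))) +
        (E * (2 * (- 2 * sq_norm q))) * (cmod (\<kappa>2 (cis 0)))\<^sup>2 - 2 * Re (cnj (\<kappa> 1) * (\<i> * k)) * E) (at 0)"
      unfolding \<Delta>_def E_def[symmetric] by (rule DERIV_diff[OF DERIV_mult[OF 1 3] DERIV_cmult_right[OF 2]])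
    then show ?thesis by (simp add: sq E_def \<kappa>1)
  qed
  then have eq0: "(2 * Re (cnj (\<kappa> 1) * (\<i> * (\<i> * k)))) * E + (E * (2 * (- 2 * sq_norm q))) * (cmod (\<kappa> 1))\<^sup>2
       - 2 * Re (cnj (\<kappa> 1) * (\<i> * k)) * E = 0"
  proof (rule DERIV_local_min[of \<Delta> _ 0 1])
    have "\<Delta> 0 = 0" by (simp add: \<Delta>_def \<kappa>1 sq)
    then show "\<forall>y. \<bar>0 - y\<bar> < 1 \<longrightarrow> \<Delta> 0 \<le> \<Delta> y" using ineq by (simp add: \<Delta>_def)
  qed simp
  \<comment> \<open>The vanishing derivative reads
    \<open>- 2 * R = 4 * sq_norm q * |\<kappa> 1|^2\<close>, and \<open>R\<close> is nonnegative by
    the radial estimate. The two sides have opposite signs, which leaves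
    \<open>q = 0\<close>.\<close>
  define R where "R = Re (cnj (\<kappa> 1) * k)"
  have "2 * Re (cnj (\<kappa> 1) * (\<i> * (\<i> * k))) = - 2 * R" by (simp add: R_def)
  with eq0 have "(- 2 * R) * E + (E * (2 * (- 2 * sq_norm q))) * (cmod (\<kappa> 1))\<^sup>2 - 0 * E = 0"
    by (simp only: circ0)
  then have "E * (- 2 * R) = E * (4 * sq_norm q * (cmod (\<kappa> 1))\<^sup>2)" by (simp add: algebra_simps)
  moreover have "E \<noteq> 0" by (simp add: E_def)
  ultimately have "- 2 * R = 4 * sq_norm q * (cmod (\<kappa> 1))\<^sup>2" by (metis mult_left_cancel)
  moreover have "R \<ge> 0" using radial unfolding R_def by linarith
  ultimately have "sq_norm q * (cmod (\<kappa> 1))\<^sup>2 \<le> 0" by linarith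
  then have "sq_norm q \<le> 0" using \<kappa>ne by (simp add: mult_le_0_iff)
  then have "sq_norm q = 0" by (simp add: sq_norm_def sum_nonneg order_antisym)
  then have "q = (\<lambda>p. 0)" by (auto simp: sq_norm_def sum_nonneg_eq_0_iff)
  then show ?thesis by (simp add: q_def o0_def)
qed

text \<open>A nonzero Jacobian makes \<open>F\<close> cover a neighbourhood of \<open>F 0\<close>,
  stably under uniformly small perturbation. So some \<open>f k\<close> takes exactly the value
  \<open>F 0\<close>, and values of \<open>f k\<close> lie in \<open>T\<close>. The preimage is
  found as a Brouwer fixed point.\<close>

lemma limit_value_interior:
  fixes F :: "('g::finite \<Rightarrow> complex) \<Rightarrow> 'g \<Rightarrow> complex"
  assumes S: "pd_open UNIV S" and zero: "(\<lambda>p. 0) \<in> S" and fT: "\<And>k x. x \<in> S \<Longrightarrow> f k x \<in> T"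
    and f: "\<And>k i. chol UNIV S (\<lambda>x. f k x i)" and bf: "\<And>k x i. x \<in> S \<Longrightarrow> cmod (f k x i) \<le> M"
    and G: "G \<noteq> bot" and F: "\<And>x i. x \<in> S \<Longrightarrow> ((\<lambda>k. f k x i) \<longlongrightarrow> F x i) G"
    and J: "jdet F (\<lambda>p. 0) \<noteq> 0"
  shows "F (\<lambda>p. 0) \<in> T"
proof -
  note I = finite_class.finite_UNIV[where 'a = 'g]
  define q where "q = F (\<lambda>p. 0)"
  have Fc: "chol UNIV S (\<lambda>x. F x i)" for i
    by (rule loc_bounded_family_limit(1)[OF I G loc_bounded_familyI[OF I S, where M = M and \<phi> = "\<lambda>k x. f k x i"]])
      (use f bf F in auto)
  have bF: "cmod (F x i) \<le> M" if "x \<in> S" for x i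
    by (rule tendsto_upperbound[OF tendsto_norm[OF F[OF that]] _ G]) (use bf that in auto)
  define A where "A = jac F (\<lambda>p. 0)"
  obtain B where B: "A ** B = Finite_Cartesian_Product.mat 1" "B ** A = Finite_Cartesian_Product.mat 1"
    using J invertible_det_nz[of A] by (metis A_def jdet_def invertible_left_inverse matrix_left_right_inverse)
  obtain K0 where K0: "K0 > 0" "\<And>x. norm (B *v x) \<le> norm x * K0"
    using bounded_linear.pos_bounded[OF matrix_vector_mul_bounded_linear, of B] by blast
  obtain r where r: "r > 0" "polydisc UNIV (\<lambda>p. 0) r \<subseteq> S" using S zero unfolding pd_open_def by blast
  define C where "C = 9 * M / r\<^sup>2"
  have M0: "M \<ge> 0" using bF[OF zero] norm_ge_zero order_trans by blast
  have C0: "C \<ge> 0" using M0 by (simp add: C_def)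
  define N where "N = real CARD('g)"
  have N: "N > 0" by (simp add: N_def)
  \<comment> \<open>The quadratic remainder \<open>C \<rho>^2\<close> per coordinate, summed over
    \<open>N\<close> coordinates and passed through \<open>B\<close>, uses at most half of the
    radius \<open>\<rho>\<close>. The uniform error \<open>e\<close> below uses the other
    half.\<close>
  define \<rho> where "\<rho> = min (r/4) (1 / (2 * K0 * N * (C + 1)))"
  have \<rho>: "\<rho> > 0" "\<rho> < r/2" "\<rho> < r" "K0 * N * (C * \<rho>\<^sup>2) \<le> \<rho> / 2"
  proof -
    show p: "\<rho> > 0" using r K0 N C0 by (simp add: \<rho>_def add_nonneg_pos)
    show "\<rho> < r/2" "\<rho> < r" using r by (auto simp: \<rho>_def)
    have "\<rho> * (2 * K0 * N * (C + 1)) \<le> 1 / (2 * K0 * N * (C + 1)) * (2 * K0 * N * (C + 1))"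
      using K0 N C0 by (intro mult_right_mono) (auto simp: \<rho>_def)
    also have "\<dots> = 1" using K0 N C0 by simp
    finally have "K0 * N * (C + 1) * \<rho> \<le> 1/2" by (simp add: mult_ac)
    moreover have "K0 * N * C * \<rho> \<le> K0 * N * (C + 1) * \<rho>" using K0 N p by (intro mult_right_mono mult_left_mono) auto
    ultimately have "(K0 * N * C * \<rho>) * \<rho> \<le> 1/2 * \<rho>" using p by (intro mult_right_mono) auto
    then show "K0 * N * (C * \<rho>\<^sup>2) \<le> \<rho> / 2" by (simp add: power2_eq_square mult_ac)
  qed
  define e where "e = \<rho> / (2 * K0 * N)"
  have e: "e > 0" "K0 * N * e = \<rho> / 2" using \<rho> K0 N by (auto simp: e_def)
  define D where "D = cball (0::complex^'g) \<rho>"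
  have coord: "cmod (vec_nth w j) \<le> \<rho>" if "w \<in> D" for w j
    using that Finite_Cartesian_Product.norm_nth_le[of w j] by (simp add: D_def)
  have Dpd: "(\<lambda>j. vec_nth w j) \<in> polydisc UNIV (\<lambda>p. 0) (r/2)" if "w \<in> D" for w
    unfolding mem_polydisc using le_less_trans[OF coord[OF that] \<rho>(2)] by simp
  have DS: "(\<lambda>j. vec_nth w j) \<in> S" if "w \<in> D" for w
    using Dpd[OF that] r polydisc_mono[of "r/2" r UNIV "\<lambda>p. 0"] by auto
  define L where "L = 6 * M / r"
  have lip: "cmod (\<phi> (\<lambda>j. vec_nth x j) - \<phi> (\<lambda>j. vec_nth y j)) \<le> L * dist x y"
    if \<phi>: "chol UNIV S \<phi>" "\<And>x. x \<in> S \<Longrightarrow> cmod (\<phi> x) \<le> M" and xy: "x \<in> D" "y \<in> D" for \<phi> x y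
    unfolding L_def
    by (rule chol_Lipschitz[OF \<phi>(1) r(2)])
      (use \<phi>(2) r Dpd xy Finite_Cartesian_Product.norm_nth_le[of "x - y"] in \<open>auto simp: dist_norm\<close>)
  have "uniform_limit D (\<lambda>k w. f k (\<lambda>j. vec_nth w j) i) (\<lambda>w. F (\<lambda>j. vec_nth w j) i) G" for i
  proof (rule equi_Lipschitz_uniform_limit[where L = L])
    show "compact D" by (simp add: D_def)
    show "cmod (F (\<lambda>j. vec_nth x j) i - F (\<lambda>j. vec_nth y j) i) \<le> L * dist x y" if "x \<in> D" "y \<in> D" for x y
      by (rule lip[OF Fc bF that])
    show "eventually (\<lambda>k. \<forall>x\<in>D. \<forall>y\<in>D. cmod (f k (\<lambda>j. vec_nth x j) i - f k (\<lambda>j. vec_nth y j) i) \<le> L * dist x y) G"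
      by (intro always_eventually allI ballI lip[OF f bf])
    show "((\<lambda>k. f k (\<lambda>j. vec_nth w j) i) \<longlongrightarrow> F (\<lambda>j. vec_nth w j) i) G" if "w \<in> D" for w
      by (rule F[OF DS[OF that]])
  qed
  then have "eventually (\<lambda>k. \<forall>i\<in>UNIV. \<forall>w\<in>D. dist (f k (\<lambda>j. vec_nth w j) i) (F (\<lambda>j. vec_nth w j) i) < e) G"
    by (intro eventually_ball_finite I ballI uniform_limitD e)
  then obtain k where k: "\<And>i w. w \<in> D \<Longrightarrow> cmod (f k (\<lambda>j. vec_nth w j) i - F (\<lambda>j. vec_nth w j) i) < e"
    using eventually_happens'[OF G] by (force simp: dist_norm)
  \<comment> \<open>A fixed point \<open>w\<close> of \<open>B *v err w\<close> satisfies
    \<open>A *v w = err w\<close>, which by this definition says that \<open>f k\<close> takes the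
    value \<open>q\<close> at \<open>w\<close>.\<close>
  define err where "err = (\<lambda>w. \<chi> i. vec_nth (A *v w) i - (f k (\<lambda>j. vec_nth w j) i - q i))"
  have errb: "cmod (vec_nth (err w) i) \<le> C * \<rho>\<^sup>2 + e" if w: "w \<in> D" for w i
  proof -
    have "cmod (F (\<lambda>p. 0 + vec_nth w p) i - F (\<lambda>p. 0) i - dd (\<lambda>x. F x i) (\<lambda>p. 0) (\<lambda>j. vec_nth w j)) \<le> 9 * M / r\<^sup>2 * \<rho>\<^sup>2"
      by (rule dd_estimate[OF Fc r(2)]) (use bF r \<rho> coord[OF w] in auto)
    moreover have "dd (\<lambda>x. F x i) (\<lambda>p. 0) (\<lambda>j. vec_nth w j) = vec_nth (A *v w) i"
      by (simp add: dd_jac[where f = F and S = S, OF Fc zero] A_def matrix_vector_mult_def)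
    ultimately have 1: "cmod (F (\<lambda>p. vec_nth w p) i - q i - vec_nth (A *v w) i) \<le> C * \<rho>\<^sup>2"
      by (simp add: q_def C_def)
    define X where "X = F (\<lambda>p. vec_nth w p) i - q i - vec_nth (A *v w) i"
    define Y where "Y = f k (\<lambda>j. vec_nth w j) i - F (\<lambda>j. vec_nth w j) i"
    have "vec_nth (err w) i = - X - Y" by (simp add: err_def X_def Y_def)
    also have "cmod (- X - Y) \<le> cmod X + cmod Y" using norm_triangle_ineq4[of "- X" Y] by simp
    also have "\<dots> \<le> C * \<rho>\<^sup>2 + e" using 1 k[OF w, of i] by (simp add: X_def Y_def)
    finally show ?thesis .
  qed
  have Berr: "norm (B *v err w) \<le> \<rho>" if w: "w \<in> D" for w
  proof -
    have "norm (err w) \<le> (\<Sum>i\<in>UNIV. norm (vec_nth (err w) i))" by (simp add: norm_vec_def L2_set_le_sum)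
    also have "\<dots> \<le> (\<Sum>i\<in>(UNIV::'g set). C * \<rho>\<^sup>2 + e)" by (intro sum_mono errb w)
    also have "\<dots> = N * (C * \<rho>\<^sup>2 + e)" by (simp add: N_def)
    finally have "norm (B *v err w) \<le> N * (C * \<rho>\<^sup>2 + e) * K0"
      using K0 by (meson mult_right_mono less_imp_le order_trans)
    also have "\<dots> = K0 * N * (C * \<rho>\<^sup>2) + K0 * N * e" by (simp add: algebra_simps)
    also have "\<dots> \<le> \<rho>" using \<rho>(4) e(2) by simp
    finally show ?thesis .
  qed
  have cont: "continuous_on D (\<lambda>w. B *v err w)"
  proof -
    have fk: "continuous_on D (\<lambda>w. f k (\<lambda>j. vec_nth w j) i)" for i
    proof (rule lipschitz_on_continuous_on[where L = "\<bar>L\<bar>"], rule lipschitz_onI)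
      fix x y assume "x \<in> D" "y \<in> D"
      then show "dist (f k (\<lambda>j. vec_nth x j) i) (f k (\<lambda>j. vec_nth y j) i) \<le> \<bar>L\<bar> * dist x y"
        using lip[OF f bf, of x y k i] by (smt (verit) dist_norm mult_right_mono zero_le_dist)
    qed simp
    have "continuous_on D (\<lambda>w. vec_nth (A *v w) i)" for i
      by (intro bounded_linear.continuous_on[OF bounded_linear_vec_nth] linear_continuous_on matrix_vector_mul_bounded_linear)
    then have "continuous_on D err"
      unfolding err_def by (intro continuous_on_vec_lambda continuous_on_diff continuous_on_const fk)
    then show ?thesis
      by (rule bounded_linear.continuous_on[OF matrix_vector_mul_bounded_linear])
  qed
  obtain w where w: "w \<in> D" "B *v err w = w"
  proof (rule brouwer[of D "\<lambda>w. B *v err w"])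
    show "(\<lambda>w. B *v err w) \<in> D \<rightarrow> D" using Berr by (auto simp: D_def)
  qed (use cont \<rho> in \<open>auto simp: D_def\<close>)
  have "A *v (B *v err w) = A *v w" using w by simp
  then have "err w = A *v w" by (simp add: matrix_vector_mul_assoc B)
  then have "vec_nth (err w) i = vec_nth (A *v w) i" for i by simp
  then have "f k (\<lambda>j. vec_nth w j) i = q i" for i by (simp add: err_def)
  then have "f k (\<lambda>j. vec_nth w j) = q" by auto
  then show ?thesis using fT[OF DS[OF w(1)]] by (metis q_def)
qed

section \<open>Coordinates of matrix tuples\<close>

definition tuple_of :: "nat \<Rightarrow> ('g \<times> nat \<times> nat \<Rightarrow> complex) \<Rightarrow> 'g mtuple" where
  "tuple_of n x = (\<lambda>j. Matrix.mat n n (\<lambda>(i, k). x (j, i, k)))"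

text \<open>The full preimage, with the values outside \<open>coords n\<close> left free; in this
  form it can be open in the sense of \<open>pd_open (coords n)\<close>.\<close>

definition vectors :: "nat \<Rightarrow> 'g mtuple set \<Rightarrow> ('g \<times> nat \<times> nat \<Rightarrow> complex) set" where
  "vectors n S = {x. tuple_of n x \<in> S}"

definition lift :: "nat \<Rightarrow> ('g mtuple \<Rightarrow> 'g mtuple) \<Rightarrow> ('g \<times> nat \<times> nat \<Rightarrow> complex) \<Rightarrow> 'g \<times> nat \<times> nat \<Rightarrow> complex" where
  "lift n F x = coord (F (tuple_of n x))"

lemma mem_coords: "(j, i, k) \<in> coords n \<longleftrightarrow> i < n \<and> k < n"
  by (simp add: coords_def)

lemma tuple_of_mem [simp]: "tuple_of n x \<in> mat_tuples n"
  by (simp add: tuple_of_def mat_tuples_def)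

lemma coord_tuple_of [simp]: "p \<in> coords n \<Longrightarrow> coord (tuple_of n x) p = x p"
  by (cases p) (simp add: coord_def tuple_of_def mem_coords)

lemma mat_tuples_dim: "X \<in> mat_tuples n \<Longrightarrow> X j \<in> carrier_mat n n"
  by (simp add: mat_tuples_def)

lemma tuple_of_coord [simp]: "X \<in> mat_tuples n \<Longrightarrow> tuple_of n (coord X) = X"
proof
  fix j assume "X \<in> mat_tuples n"
  then have "X j \<in> carrier_mat n n" by (rule mat_tuples_dim)
  then show "tuple_of n (coord X) j = X j" by (intro eq_matI) (auto simp: tuple_of_def coord_def)
qed

lemma tuple_of_cong: "(\<And>p. p \<in> coords n \<Longrightarrow> x p = y p) \<Longrightarrow> tuple_of n x = tuple_of n y"
  by (rule ext, rule eq_matI) (auto simp: tuple_of_def mem_coords)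

lemma tuple_eqI:
  assumes "X \<in> mat_tuples n" "Y \<in> mat_tuples n" "\<And>p. p \<in> coords n \<Longrightarrow> coord X p = coord Y p"
  shows "X = Y"
  using tuple_of_cong[of n "coord X" "coord Y"] assms by simp

lemma tuple_of_eq: "X \<in> mat_tuples n \<Longrightarrow> (\<And>p. p \<in> coords n \<Longrightarrow> x p = coord X p) \<Longrightarrow> tuple_of n x = X"
  by (rule tuple_eqI) auto

lemma openin_tuple_topology:
  "openin (tuple_topology n) S \<longleftrightarrow> S \<subseteq> mat_tuples n \<and>
     (\<forall>X\<in>S. \<exists>r>0. \<forall>Y\<in>mat_tuples n. tuple_dist n X Y < r \<longrightarrow> Y \<in> S)"
proof -
  interpret Metric_space "mat_tuples n" "tuple_dist n" by (rule Metric_space_mat_tuples)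
  have "mball X r \<subseteq> S \<longleftrightarrow> (\<forall>Y\<in>mat_tuples n. tuple_dist n X Y < r \<longrightarrow> Y \<in> S)" if "X \<in> mat_tuples n" for X r
    using that by (auto simp: subset_iff)
  then have ex: "(\<exists>r>0. mball X r \<subseteq> S) \<longleftrightarrow> (\<exists>r>0. \<forall>Y\<in>mat_tuples n. tuple_dist n X Y < r \<longrightarrow> Y \<in> S)"
    if "X \<in> mat_tuples n" for X using that by simp
  show ?thesis
  proof (cases "S \<subseteq> mat_tuples n")
    case True
    then have "X \<in> S \<Longrightarrow> X \<in> mat_tuples n" for X by blast
    then show ?thesis
      unfolding tuple_topology_def openin_mtopology by (simp add: ex Ball_def[of S] True cong: imp_cong)
  next
    case False
    then show ?thesis unfolding tuple_topology_def openin_mtopology by simp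
  qed
qed

lemma topspace_tuple_topology: "topspace (tuple_topology n) = mat_tuples n"
proof -
  interpret Metric_space "mat_tuples n" "tuple_dist n" by (rule Metric_space_mat_tuples)
  show ?thesis by (simp add: tuple_topology_def)
qed

lemma coord_le_tuple_dist: "p \<in> coords n \<Longrightarrow> cmod (coord X p - coord Y p) \<le> tuple_dist n X Y"
  unfolding tuple_dist_def using member_le_L2_set[of "coords n" p "\<lambda>p. cmod (coord X p - coord Y p)"] by simp

lemma tuple_dist_le:
  assumes "\<And>p. p \<in> coords n \<Longrightarrow> cmod (coord X p - coord Y p) \<le> d"
  shows "tuple_dist n X (Y :: 'g::finite mtuple) \<le> real (card (coords n :: ('g \<times> nat \<times> nat) set)) * d"
proof -
  have "tuple_dist n X Y \<le> (\<Sum>p\<in>coords n. cmod (coord X p - coord Y p))"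
    unfolding tuple_dist_def by (rule L2_set_le_sum) simp
  also have "\<dots> \<le> (\<Sum>p\<in>(coords n :: ('g \<times> nat \<times> nat) set). d)" by (rule sum_mono) (rule assms)
  finally show ?thesis by simp
qed

lemma pd_open_vectors:
  fixes S :: "'g::finite mtuple set"
  assumes "openin (tuple_topology n) S" shows "pd_open (coords n) (vectors n S)"
  unfolding pd_open_def
proof
  fix x assume "x \<in> vectors n S"
  then obtain r where r: "r > 0" "\<And>Y. Y \<in> mat_tuples n \<Longrightarrow> tuple_dist n (tuple_of n x) Y < r \<Longrightarrow> Y \<in> S"
    using assms unfolding openin_tuple_topology vectors_def by blast
  define c where "c = real (card (coords n :: ('g \<times> nat \<times> nat) set))"
  define d where "d = r / (c + 1)"
  have c: "c \<ge> 0" by (simp add: c_def)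
  have d: "d > 0" "c * d < r" using r c by (auto simp: d_def field_simps)
  have "y \<in> vectors n S" if y: "y \<in> polydisc (coords n) x d" for y
    unfolding vectors_def mem_Collect_eq
  proof (rule r(2)[OF tuple_of_mem])
    have "tuple_dist n (tuple_of n x) (tuple_of n y) \<le> c * d"
      unfolding c_def by (rule tuple_dist_le) (use y in \<open>auto simp: mem_polydisc norm_minus_commute less_imp_le\<close>)
    then show "tuple_dist n (tuple_of n x) (tuple_of n y) < r" using d by simp
  qed
  then show "\<exists>r>0. polydisc (coords n) x r \<subseteq> vectors n S" using d by blast
qed

lemma openin_of_pd_open:
  fixes A :: "('g::finite \<times> nat \<times> nat \<Rightarrow> complex) set"
  assumes "pd_open (coords n) A"
  shows "openin (tuple_topology n) {X \<in> mat_tuples n. coord X \<in> A}"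
  unfolding openin_tuple_topology
proof (intro conjI ballI)
  fix X :: "'g mtuple" assume "X \<in> {X \<in> mat_tuples n. coord X \<in> A}"
  then obtain r where r: "r > 0" "polydisc (coords n) (coord X) r \<subseteq> A"
    using assms unfolding pd_open_def by blast
  have "coord Y \<in> A" if "tuple_dist n X Y < r" for Y
  proof (rule subsetD[OF r(2)])
    show "coord Y \<in> polydisc (coords n) (coord X) r"
      unfolding mem_polydisc using coord_le_tuple_dist[of _ n X Y] that
      by (metis le_less_trans norm_minus_commute)
  qed
  then show "\<exists>r>0. \<forall>Y\<in>mat_tuples n. tuple_dist n X Y < r \<longrightarrow> Y \<in> {X \<in> mat_tuples n. coord X \<in> A}"
    using r by blast
qed auto

lemma pd_connected_vectors:
  fixes S :: "'g::finite mtuple set"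
  assumes "connectedin (tuple_topology n) S" shows "pd_connected (coords n) (vectors n S)"
  unfolding pd_connected_def
proof (intro allI impI)
  fix A B :: "('g \<times> nat \<times> nat \<Rightarrow> complex) set"
  assume A: "pd_open (coords n) A" and B: "pd_open (coords n) B" and AB: "A \<union> B = vectors n S" "A \<inter> B = {}"
  define E where "E = (\<lambda>A. {X \<in> mat_tuples n :: 'g mtuple set. coord X \<in> A})"
  have S: "S \<subseteq> mat_tuples n" using assms by (auto simp: connectedin topspace_tuple_topology)
  have cov: "S \<subseteq> E A \<union> E B"
  proof
    fix X assume "X \<in> S"
    then have "X \<in> mat_tuples n" "coord X \<in> A \<union> B" using S by (auto simp: AB vectors_def)
    then show "X \<in> E A \<union> E B" by (auto simp: E_def)
  qed
  have "E A \<inter> E B \<inter> S = {}" using AB by (auto simp: E_def)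
  moreover have "openin (tuple_topology n) (E A)" "openin (tuple_topology n) (E B)"
    unfolding E_def by (intro openin_of_pd_open A B)+
  ultimately have "E A \<inter> S = {} \<or> E B \<inter> S = {}"
    using assms cov unfolding connectedin by blast
  \<comment> \<open>With \<open>x\<close> an open set contains the coordinate vector of
    \<open>tuple_of n x\<close>, which agrees with \<open>x\<close> on \<open>coords n\<close>. So a
    nonempty piece is visible among the tuples.\<close>
  moreover have "C = {}" if C: "pd_open (coords n) C" "C \<subseteq> vectors n S" "E C \<inter> S = {}" for C
  proof (rule ccontr)
    assume "C \<noteq> {}"
    then obtain x where x: "x \<in> C" by blast
    have "coord (tuple_of n x) \<in> C" by (rule pd_open_cong[OF C(1) x]) simp
    then have "tuple_of n x \<in> E C \<inter> S" using x C(2) by (auto simp: E_def vectors_def)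
    then show False using C(3) by blast
  qed
  ultimately show "A = {} \<or> B = {}" using A B AB by blast
qed

lemma chol_cong:
  assumes "chol I S \<phi>" "\<And>x. x \<in> S \<Longrightarrow> \<psi> x = \<phi> x" shows "chol I S \<psi>"
proof (rule cholI)
  fix x assume "x \<in> S"
  then obtain r M where r: "r > 0" "polydisc I x r \<subseteq> S" "\<And>y. y \<in> polydisc I x r \<Longrightarrow> cmod (\<phi> y) \<le> M"
    by (metis chol_bounded[OF assms(1)])
  then show "\<exists>r>0. \<exists>M. polydisc I x r \<subseteq> S \<and> (\<forall>y\<in>polydisc I x r. cmod (\<psi> y) \<le> M)"
    using assms(2) by (intro loc_boundI[where r = r and M = M]) auto
next
  fix \<Omega> :: "complex set" and c :: "complex \<Rightarrow> 'a \<Rightarrow> complex"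
  assume c: "open \<Omega>" "\<And>p. p \<in> I \<Longrightarrow> (\<lambda>z. c z p) holomorphic_on \<Omega>" "\<And>z. z \<in> \<Omega> \<Longrightarrow> c z \<in> S"
  have "(\<lambda>z. \<phi> (c z)) holomorphic_on \<Omega>" by (rule chol_curve[OF assms(1) c])
  then show "(\<lambda>z. \<psi> (c z)) holomorphic_on \<Omega>"
    by (rule holomorphic_transform) (simp add: assms(2) c(3))
qed

text \<open>Along a holomorphic curve every term of the power series is holomorphic, and the
  Weierstrass test gives uniform convergence near each parameter. Local boundedness is read off the
  bound \<open>M\<close>.\<close>

lemma analytic_fun_imp_chol:
  fixes S :: "'g::finite mtuple set"
  assumes S: "openin (tuple_topology n) S" and an: "analytic_fun n S \<phi>"
    and bd: "\<And>X. X \<in> S \<Longrightarrow> cmod (\<phi> X) \<le> M"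
  shows "chol (coords n) (vectors n S) (\<lambda>x. \<phi> (tuple_of n x))"
proof (rule cholI_bounded[OF pd_open_vectors[OF S], of _ M])
  show "cmod (\<phi> (tuple_of n x)) \<le> M" if "x \<in> vectors n S" for x
    using bd that by (auto simp: vectors_def)
  fix \<Omega> :: "complex set" and c :: "complex \<Rightarrow> 'g \<times> nat \<times> nat \<Rightarrow> complex"
  assume c: "open \<Omega>" "\<And>p. p \<in> coords n \<Longrightarrow> (\<lambda>z. c z p) holomorphic_on \<Omega>" "\<And>z. z \<in> \<Omega> \<Longrightarrow> c z \<in> vectors n S"
  show "(\<lambda>z. \<phi> (tuple_of n (c z))) holomorphic_on \<Omega>"
    unfolding holomorphic_on_open[OF c(1)]
  proof
    fix z0 assume z0: "z0 \<in> \<Omega>"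
    define x where "x = c z0"
    have x: "x \<in> vectors n S" unfolding x_def by (rule c(3)[OF z0])
    have xS: "tuple_of n x \<in> S" using x by (simp add: vectors_def)
    have "\<exists>r>0. \<exists>a. \<forall>X\<in>S. tuple_dist n (tuple_of n x) X < r \<longrightarrow>
        ((\<lambda>\<alpha>. a \<alpha> * (\<Prod>p\<in>coords n. (coord X p - coord (tuple_of n x) p) ^ \<alpha> p)) has_sum \<phi> X) (multi_indices n)"
      by (rule bspec[OF an[unfolded analytic_fun_def] xS])
    then obtain r a where r: "r > 0" and "\<forall>X\<in>S. tuple_dist n (tuple_of n x) X < r \<longrightarrow>
        ((\<lambda>\<alpha>. a \<alpha> * (\<Prod>p\<in>coords n. (coord X p - coord (tuple_of n x) p) ^ \<alpha> p)) has_sum \<phi> X) (multi_indices n)"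
      by (elim exE conjE) (rule that)
    note a = this(2)[rule_format]
    have a': "((\<lambda>\<alpha>. a \<alpha> * (\<Prod>p\<in>coords n. (y p - x p) ^ \<alpha> p)) has_sum \<phi> (tuple_of n y)) (multi_indices n)"
      if "y \<in> vectors n S" "tuple_dist n (tuple_of n x) (tuple_of n y) < r" for y
      using a[of "tuple_of n y"] that by (simp add: vectors_def)
    define K where "K = real (card (coords n :: ('g \<times> nat \<times> nat) set))"
    obtain s0 where s0: "s0 > 0" "polydisc (coords n) x s0 \<subseteq> vectors n S"
      using pd_open_vectors[OF S] x unfolding pd_open_def by blast
    define s where "s = min (s0 / 2) (r / (K + 1))"
    have K: "K \<ge> 0" by (simp add: K_def)
    have spos: "s > 0" using s0(1) r K by (simp add: s_def add_nonneg_pos)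
    have "s \<le> s0 / 2" unfolding s_def by (rule min.cobounded1)
    then have "s < s0" using s0(1) by linarith
    note s = spos this
    have "s \<le> r / (K + 1)" unfolding s_def by (rule min.cobounded2)
    then have "s * (K + 1) \<le> r" using K by (simp add: pos_le_divide_eq add_nonneg_pos)
    then have Ks: "K * s < r" using s by (simp add: algebra_simps)
    have dist: "y \<in> vectors n S \<and> tuple_dist n (tuple_of n x) (tuple_of n y) < r"
      if y: "\<And>p. p \<in> coords n \<Longrightarrow> cmod (y p - x p) \<le> s" for y
    proof
      show "y \<in> vectors n S" by (rule subsetD[OF s0(2)]) (use y s in \<open>force simp: mem_polydisc\<close>)
      have "tuple_dist n (tuple_of n x) (tuple_of n y) \<le> K * s"
        unfolding K_def by (rule tuple_dist_le) (use y in \<open>auto simp: norm_minus_commute\<close>)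
      then show "tuple_dist n (tuple_of n x) (tuple_of n y) < r" using Ks by simp
    qed
    \<comment> \<open>Convergence at the single point \<open>x + (s, ..., s)\<close> gives majorants
      for the whole polydisc of radius \<open>s\<close>, since unconditionally summable complex
      families are absolutely summable.\<close>
    define m where "m = (\<lambda>\<alpha>. cmod (a \<alpha> * (\<Prod>p\<in>coords n. complex_of_real s ^ \<alpha> p)))"
    have "((\<lambda>\<alpha>. a \<alpha> * (\<Prod>p\<in>coords n. ((x p + of_real s) - x p) ^ \<alpha> p)) has_sum \<phi> (tuple_of n (\<lambda>p. x p + of_real s))) (multi_indices n)"
      using dist[of "\<lambda>p. x p + of_real s"] s by (intro a') auto
    then have "(\<lambda>\<alpha>. a \<alpha> * (\<Prod>p\<in>coords n. complex_of_real s ^ \<alpha> p)) summable_on multi_indices n"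
      by (auto simp: summable_on_def)
    then have summ: "m summable_on multi_indices n"
      unfolding m_def by (simp only: summable_on_iff_abs_summable_on_complex)
    obtain \<rho> where \<rho>: "\<rho> > 0" "ball z0 \<rho> \<subseteq> \<Omega>" "\<And>z. z \<in> ball z0 \<rho> \<Longrightarrow> c z \<in> polydisc (coords n) x s"
      using curve_in_polydisc[of "coords n" \<Omega> z0 s c] c(1,2) z0 s(1) by (auto simp: x_def)
    define u where "u = (\<lambda>\<alpha> z. a \<alpha> * (\<Prod>p\<in>coords n. (c z p - x p) ^ \<alpha> p))"
    have le: "cmod (u \<alpha> z) \<le> m \<alpha>" if "z \<in> ball z0 \<rho>" for \<alpha> z
      unfolding u_def m_def norm_mult prod_norm[symmetric] norm_power
      using \<rho>(3)[OF that] s by (intro mult_left_mono prod_mono) (auto simp: mem_polydisc intro!: power_mono intro: less_imp_le)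
    have hs: "((\<lambda>\<alpha>. u \<alpha> z) has_sum \<phi> (tuple_of n (c z))) (multi_indices n)" if "z \<in> ball z0 \<rho>" for z
      unfolding u_def using dist[of "c z"] \<rho>(3)[OF that] by (intro a') (auto simp: mem_polydisc intro: less_imp_le)
    have ul: "uniform_limit (cball z0 (\<rho>/2)) (\<lambda>X z. \<Sum>\<alpha>\<in>X. u \<alpha> z) (\<lambda>z. \<phi> (tuple_of n (c z))) (finite_subsets_at_top (multi_indices n))"
      by (rule Weierstrass_m_test_general'[OF le hs summ]) (use \<rho>(1) in auto)
    have "u \<alpha> holomorphic_on ball z0 \<rho>" for \<alpha>
      unfolding u_def by (intro holomorphic_intros holomorphic_on_subset[OF c(2) \<rho>(2)])
    then have hX: "(\<lambda>z. \<Sum>\<alpha>\<in>X. u \<alpha> z) holomorphic_on ball z0 \<rho>" for X by (intro holomorphic_on_sum)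
    have sub: "cball z0 (\<rho>/2) \<subseteq> ball z0 \<rho>" "ball z0 (\<rho>/2) \<subseteq> ball z0 \<rho>" using \<rho>(1) by auto
    have "(\<lambda>z. \<phi> (tuple_of n (c z))) holomorphic_on ball z0 (\<rho>/2)"
    proof (rule holomorphic_uniform_limit[OF _ ul])
      show "\<forall>\<^sub>F X in finite_subsets_at_top (multi_indices n). continuous_on (cball z0 (\<rho>/2)) (\<lambda>z. \<Sum>\<alpha>\<in>X. u \<alpha> z) \<and>
          (\<lambda>z. \<Sum>\<alpha>\<in>X. u \<alpha> z) holomorphic_on ball z0 (\<rho>/2)"
        using hX sub holomorphic_on_imp_continuous_on[OF hX]
        by (intro always_eventually allI conjI) (blast intro: continuous_on_subset holomorphic_on_subset)+
    qed auto
    then show "\<exists>f'. ((\<lambda>z. \<phi> (tuple_of n (c z))) has_field_derivative f') (at z0)"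
      using \<rho>(1) by (meson centre_in_ball half_gt_zero holomorphic_derivI open_ball)
  qed
qed

lemma linear_imp_analytic_fun:
  fixes S :: "'g::finite mtuple set"
  assumes lin: "\<And>X. X \<in> S \<Longrightarrow> \<phi> X = (\<Sum>q\<in>coords n. a q * coord X q)"
  shows "analytic_fun n S \<phi>"
  unfolding analytic_fun_def
proof (intro ballI exI[of _ "1::real"] conjI)
  fix P assume P: "P \<in> S"
  \<comment> \<open>The expansion about \<open>P\<close> of a linear function: the value at
    \<open>P\<close> for the zero multi-index \<open>z\<close>, the coefficient \<open>a q\<close>
    for the unit multi-index \<open>e q\<close>. The series is a finite sum, so the radius
    \<open>1\<close> is an arbitrary choice.\<close>
  define e :: "'g \<times> nat \<times> nat \<Rightarrow> 'g \<times> nat \<times> nat \<Rightarrow> nat" where "e = (\<lambda>q p. if p = q then 1 else 0)"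
  define z :: "'g \<times> nat \<times> nat \<Rightarrow> nat" where "z = (\<lambda>p. 0)"
  define c where "c = (\<lambda>\<alpha>. (if \<alpha> = z then \<phi> P else 0) + (\<Sum>q\<in>coords n. if \<alpha> = e q then a q else 0))"
  have hs1: "((\<lambda>\<alpha>. if \<alpha> = \<beta> then v else 0) has_sum v) A" if "\<beta> \<in> A" for A \<beta> and v :: complex
    using has_sum_finite[of "{\<beta>}" "\<lambda>_. v"] that
    by (subst has_sum_cong_neutral[where T = "{\<beta>}" and g = "\<lambda>_. v"]) auto
  have hss: "((\<lambda>\<alpha>. \<Sum>q\<in>J. t q \<alpha>) has_sum (\<Sum>q\<in>J. v q)) A"
    if "finite J" "\<And>q. q \<in> J \<Longrightarrow> (t q has_sum v q) A" for J A and t :: "'g \<times> nat \<times> nat \<Rightarrow> _ \<Rightarrow> complex" and v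
    using that by (induction J) (auto intro: has_sum_add)
  have zI: "z \<in> multi_indices n" by (simp add: z_def multi_indices_def)
  have eI: "e q \<in> multi_indices n" if "q \<in> coords n" for q using that by (auto simp: e_def multi_indices_def)
  have "((\<lambda>\<alpha>. c \<alpha> * (\<Prod>p\<in>coords n. (coord X p - coord P p) ^ \<alpha> p)) has_sum \<phi> X) (multi_indices n)" if X: "X \<in> S" for X
  proof -
    have "((\<lambda>\<alpha>. (if \<alpha> = z then \<phi> P else 0) + (\<Sum>q\<in>coords n. if \<alpha> = e q then a q * (coord X q - coord P q) else 0)) has_sum
      (\<phi> P + (\<Sum>q\<in>coords n. a q * (coord X q - coord P q)))) (multi_indices n)"
      by (intro has_sum_add hss hs1 zI eI) auto
    also have "\<phi> P + (\<Sum>q\<in>coords n. a q * (coord X q - coord P q)) = \<phi> X"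
      by (simp add: lin[OF P] lin[OF X] sum_subtractf algebra_simps)
    also have "(\<lambda>\<alpha>. (if \<alpha> = z then \<phi> P else 0) + (\<Sum>q\<in>coords n. if \<alpha> = e q then a q * (coord X q - coord P q) else 0))
       = (\<lambda>\<alpha>. c \<alpha> * (\<Prod>p\<in>coords n. (coord X p - coord P p) ^ \<alpha> p))"
    proof
      fix \<alpha>
      have "(\<Prod>p\<in>coords n. (coord X p - coord P p) ^ e q p) = coord X q - coord P q" if "q \<in> coords n" for q
      proof -
        have "(\<Prod>p\<in>coords n. (coord X p - coord P p) ^ e q p) = (\<Prod>p\<in>coords n. if p = q then coord X p - coord P p else 1)"
          by (intro prod.cong refl) (simp add: e_def)
        then show ?thesis using that by simp
      qed
      then show "(if \<alpha> = z then \<phi> P else 0) + (\<Sum>q\<in>coords n. if \<alpha> = e q then a q * (coord X q - coord P q) else 0)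
          = c \<alpha> * (\<Prod>p\<in>coords n. (coord X p - coord P p) ^ \<alpha> p)"
        unfolding c_def distrib_right sum_distrib_right
        by (intro arg_cong2[where f = "(+)"] sum.cong refl) (auto simp: z_def)
    qed
    finally show ?thesis .
  qed
  then show "\<exists>c. \<forall>X\<in>S. tuple_dist n P X < 1 \<longrightarrow>
      ((\<lambda>\<alpha>. c \<alpha> * (\<Prod>p\<in>coords n. (coord X p - coord P p) ^ \<alpha> p)) has_sum \<phi> X) (multi_indices n)"
    by blast
qed simp

section \<open>Adjoints, direct sums and scalar multiples in coordinates\<close>

lemma mat_adjoint_dim [simp]:
  "dim_row (mat_adjoint A) = dim_col A" "dim_col (mat_adjoint A) = dim_row A"
  by (simp_all add: mat_adjoint_def)

lemma mat_adjoint_index: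
  "i < dim_col A \<Longrightarrow> j < dim_row A \<Longrightarrow> mat_adjoint A $$ (i, j) = cnj (A $$ (j, i))"
  by (simp add: mat_adjoint_def mat_of_rows_def)

text \<open>Positivity tested on the \<open>i\<close>-th unit vector bounds by \<open>C^2\<close>
  the total squared length of the \<open>i\<close>-th rows of all \<open>X j\<close>. The absolute
  value is there because \<open>C\<close> may be negative.\<close>

lemma row_gram_less_entry:
  fixes X :: "'g::finite mtuple"
  assumes X: "X \<in> mat_tuples n" and C: "row_gram_less C n X" and p: "p \<in> coords n"
  shows "cmod (coord X p) \<le> \<bar>C\<bar>"
proof -
  obtain j i k where p': "p = (j, i, k)" "i < n" "k < n" using p by (cases p) (auto simp: mem_coords)
  define A where "A = complex_of_real (C\<^sup>2) \<cdot>\<^sub>m 1\<^sub>m n - row_gram n X"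
  have A: "A \<in> carrier_mat n n" by (auto simp: A_def row_gram_def)
  have Xd: "X j \<in> carrier_mat n n" for j by (rule mat_tuples_dim[OF X])
  define v :: "complex Matrix.vec" where "v = Matrix.unit_vec n i"
  have v: "v \<in> carrier_vec n" "v \<noteq> 0\<^sub>v n" using p' by (auto simp: v_def)
  have "0 < (A *\<^sub>v v) \<bullet>c v" using C v unfolding row_gram_less_def pos_def_mat_def A_def by blast
  also have "(A *\<^sub>v v) \<bullet>c v = A $$ (i, i)"
  proof -
    have "conjugate v = v" by (rule eq_vecI) (auto simp: v_def Matrix.unit_vec_def)
    then show ?thesis using A p' by (simp add: v_def)
  qed
  also have "A $$ (i, i) = complex_of_real (C\<^sup>2) - (\<Sum>j\<in>UNIV. (X j * mat_adjoint (X j)) $$ (i, i))"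
    using p' by (simp add: A_def row_gram_def)
  also have "(\<Sum>j\<in>UNIV. (X j * mat_adjoint (X j)) $$ (i, i)) = (\<Sum>j\<in>UNIV. complex_of_real (\<Sum>l<n. (cmod (X j $$ (i, l)))\<^sup>2))"
  proof (rule sum.cong[OF refl])
    fix j
    have d: "dim_row (X j) = n" "dim_col (X j) = n" using Xd by auto
    have "(X j * mat_adjoint (X j)) $$ (i, i) = (\<Sum>l = 0..<n. X j $$ (i, l) * cnj (X j $$ (i, l)))"
      using p' d by (simp add: scalar_prod_def mat_adjoint_index)
    then show "(X j * mat_adjoint (X j)) $$ (i, i) = complex_of_real (\<Sum>l<n. (cmod (X j $$ (i, l)))\<^sup>2)"
      by (simp only: of_real_sum complex_norm_square atLeast0LessThan)
  qed
  finally have "0 < C\<^sup>2 - (\<Sum>j\<in>UNIV. \<Sum>l<n. (cmod (X j $$ (i, l)))\<^sup>2)"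
    by (simp add: less_complex_def)
  moreover have "(cmod (X j $$ (i, k)))\<^sup>2 \<le> (\<Sum>l<n. (cmod (X j $$ (i, l)))\<^sup>2)"
    using p' by (intro member_le_sum) auto
  moreover have "\<dots> \<le> (\<Sum>j\<in>UNIV. \<Sum>l<n. (cmod (X j $$ (i, l)))\<^sup>2)"
    by (rule member_le_sum[of j UNIV "\<lambda>j. \<Sum>l<n. (cmod (X j $$ (i, l)))\<^sup>2"]) (auto intro: sum_nonneg)
  ultimately have "(cmod (X j $$ (i, k)))\<^sup>2 \<le> \<bar>C\<bar>\<^sup>2" by simp
  then have "cmod (X j $$ (i, k)) \<le> \<bar>C\<bar>" by (rule power2_le_imp_le) simp
  then show ?thesis by (simp add: p' coord_def)
qed

lemma zero_mem_nc_nbhd: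
  assumes "\<epsilon> > 0" shows "tuple_of n (\<lambda>p. 0) \<in> (nc_nbhd \<epsilon> n :: 'g::finite mtuple set)"
proof -
  define Z where "Z = (tuple_of n (\<lambda>p. 0) :: 'g mtuple)"
  have Z: "Z j = 0\<^sub>m n n" for j by (rule eq_matI) (auto simp: Z_def tuple_of_def)
  have g: "row_gram n Z = 0\<^sub>m n n"
    by (rule eq_matI) (auto simp: row_gram_def Z scalar_prod_def mat_adjoint_index)
  define A where "A = complex_of_real (\<epsilon>\<^sup>2) \<cdot>\<^sub>m 1\<^sub>m n - row_gram n Z"
  have A: "A = complex_of_real (\<epsilon>\<^sup>2) \<cdot>\<^sub>m 1\<^sub>m n" by (rule eq_matI) (auto simp: A_def g)
  have "pos_def_mat n A"
    unfolding pos_def_mat_def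
  proof (intro conjI ballI impI)
    show "A \<in> carrier_mat n n" by (simp add: A)
    show "mat_adjoint A = A"
      by (rule eq_matI) (auto simp: A mat_adjoint_index)
    fix v :: "complex Matrix.vec" assume v: "v \<in> carrier_vec n" "v \<noteq> 0\<^sub>v n"
    have "A *\<^sub>v v = complex_of_real (\<epsilon>\<^sup>2) \<cdot>\<^sub>v v"
      using v by (intro eq_vecI) (auto simp: A)
    moreover have "0 < v \<bullet>c v" using v by simp
    ultimately show "0 < (A *\<^sub>v v) \<bullet>c v" using v assms by (simp add: less_complex_def)
  qed
  then show ?thesis by (simp add: nc_nbhd_def row_gram_less_def A_def Z_def)
qed

lemma coord_dsum:
  assumes "X \<in> mat_tuples n" "Y \<in> mat_tuples m" "i < n + m" "k < n + m"
  shows "coord (dsum_tuple X Y) (j, i, k) =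
     (if i < n then if k < n then coord X (j, i, k) else 0
      else if k < n then 0 else coord Y (j, i - n, k - n))"
proof -
  have "X j \<in> carrier_mat n n" "Y j \<in> carrier_mat m m" using assms by (auto simp: mat_tuples_def)
  then show ?thesis using assms by (auto simp: coord_def dsum_tuple_def dsum_mat_def)
qed

lemma dsum_mem: "X \<in> mat_tuples n \<Longrightarrow> Y \<in> mat_tuples m \<Longrightarrow> dsum_tuple X Y \<in> mat_tuples (n + m)"
  by (auto simp: mat_tuples_def dsum_tuple_def dsum_mat_def)

lemma dsum_zero:
  "dsum_tuple (tuple_of n (\<lambda>p. 0)) (tuple_of m (\<lambda>p. 0)) = (tuple_of (n + m) (\<lambda>p. 0) :: 'g::finite mtuple)"
proof (rule tuple_eqI[of _ "n + m"])
  fix p :: "'g \<times> nat \<times> nat" assume "p \<in> coords (n + m)"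
  then obtain j i k where p: "p = (j, i, k)" "i < n + m" "k < n + m" by (cases p) (auto simp: mem_coords)
  then have "i < n \<or> i - n < m" "k < n \<or> k - n < m" by auto
  then show "coord (dsum_tuple (tuple_of n (\<lambda>p. 0)) (tuple_of m (\<lambda>p. 0))) p = coord (tuple_of (n + m) (\<lambda>p. 0)) p"
    using p by (auto simp: coord_dsum[where n = n and m = m] mem_coords)
qed (auto simp: dsum_mem)

lemma tuple_mult_entry:
  assumes "X \<in> mat_tuples n" "\<Gamma> \<in> carrier_mat n n" "i < n" "k < n"
  shows "(X j * \<Gamma>) $$ (i, k) = (\<Sum>l<n. coord X (j, i, l) * \<Gamma> $$ (l, k))"
    "(\<Gamma> * X j) $$ (i, k) = (\<Sum>l<n. \<Gamma> $$ (i, l) * coord X (j, l, k))"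
proof -
  have d: "X j \<in> carrier_mat n n" using assms by (auto simp: mat_tuples_def)
  show "(X j * \<Gamma>) $$ (i, k) = (\<Sum>l<n. coord X (j, i, l) * \<Gamma> $$ (l, k))"
    "(\<Gamma> * X j) $$ (i, k) = (\<Sum>l<n. \<Gamma> $$ (i, l) * coord X (j, l, k))"
    using d assms by (auto simp: scalar_prod_def coord_def atLeast0LessThan)
qed

abbreviation zero_tuple :: "nat \<Rightarrow> 'g mtuple" where
  "zero_tuple n \<equiv> tuple_of n (\<lambda>p. 0)"

definition scale_tuple :: "complex \<Rightarrow> 'g mtuple \<Rightarrow> 'g mtuple" where
  "scale_tuple u X = (\<lambda>j. u \<cdot>\<^sub>m X j)"

lemma scale_tuple_mem [simp]: "X \<in> mat_tuples n \<Longrightarrow> scale_tuple u X \<in> mat_tuples n"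
  by (simp add: scale_tuple_def mat_tuples_def)

lemma coord_scale_tuple: "X \<in> mat_tuples n \<Longrightarrow> p \<in> coords n \<Longrightarrow> coord (scale_tuple u X) p = u * coord X p"
proof (cases p)
  case (fields j i k)
  assume "X \<in> mat_tuples n" "p \<in> coords n"
  then show ?thesis using mat_tuples_dim[of X n j] by (auto simp: fields coord_def scale_tuple_def mem_coords)
qed

section \<open>Pairs of mutually inverse free maps\<close>

text \<open>The form in which the hypotheses enter the argument: the matrix inequality as a bound on
  entries, the neighbourhood of \<open>0\<close> as membership of the zero tuple, and one constant
  \<open>M\<close> for all levels, which both domains can share.\<close>

definition admissible :: "real \<Rightarrow> (nat \<Rightarrow> 'g::finite mtuple set) \<Rightarrow> bool" where
  "admissible M U \<longleftrightarrow> nc_domain U \<and> circular U \<and> (\<forall>n>0. zero_tuple n \<in> U n) \<and>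
     (\<forall>n>0. \<forall>X\<in>U n. \<forall>p\<in>coords n. cmod (coord X p) \<le> M)"

lemma admissibleD:
  assumes "admissible M U" "n > 0"
  shows "U n \<subseteq> mat_tuples n" "openin (tuple_topology n) (U n)" "connectedin (tuple_topology n) (U n)"
    "zero_tuple n \<in> U n" "\<And>X p. X \<in> U n \<Longrightarrow> p \<in> coords n \<Longrightarrow> cmod (coord X p) \<le> M"
    "\<And>X Y m. m > 0 \<Longrightarrow> X \<in> U n \<Longrightarrow> Y \<in> U m \<Longrightarrow> dsum_tuple X Y \<in> U (n + m)"
  using assms by (auto simp: admissible_def nc_domain_def nc_set_def)

lemma admissible_scale:
  assumes "admissible M U" "n > 0" "X \<in> U n" "cmod u = 1" shows "scale_tuple u X \<in> U n"
proof -
  have "u \<noteq> 0" using assms(4) by auto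
  then have "cis (Arg u) = u" using cis_Arg[of u] assms(4) by (simp add: sgn_eq)
  then have "u = exp (\<i> * complex_of_real (Arg u))" by (simp add: cis_conv_exp)
  then show ?thesis
    using assms unfolding admissible_def circular_def scale_tuple_def by metis
qed

lemma admissible_circled:
  fixes U :: "nat \<Rightarrow> 'g::finite mtuple set"
  assumes U: "admissible M U" and n: "n > 0"
  shows "circled_domain (coords n) (vectors n (U n))"
proof
  note D = admissibleD[OF U n]
  show "pd_open (coords n) (vectors n (U n))" by (rule pd_open_vectors[OF D(2)])
  show "pd_connected (coords n) (vectors n (U n))" by (rule pd_connected_vectors[OF D(3)])
  show "(\<lambda>p. 0) \<in> vectors n (U n)" using D(4) by (simp add: vectors_def)
  have "tuple_of n (\<lambda>p. u * x p) = scale_tuple u (tuple_of n x)" for u and x :: "'g \<times> nat \<times> nat \<Rightarrow> complex"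
    by (rule tuple_of_eq) (simp_all add: coord_scale_tuple[where n = n])
  then show "circled (vectors n (U n))"
    unfolding circled_def vectors_def using admissible_scale[OF U n] by simp
  have "vectors n (U n) \<subseteq> polydisc (coords n) (\<lambda>p. 0) (M + 1)"
  proof
    fix x assume x: "x \<in> vectors n (U n)"
    have "cmod (x p) < M + 1" if "p \<in> coords n" for p
      using D(5)[of "tuple_of n x" p] x that by (simp add: vectors_def)
    then show "x \<in> polydisc (coords n) (\<lambda>p. 0) (M + 1)" by (simp add: mem_polydisc)
  qed
  then show "\<exists>R. vectors n (U n) \<subseteq> polydisc (coords n) (\<lambda>p. 0) R" by blast
qed simp

text \<open>A free biholomorphism together with its inverse, analyticity being replaced by
  \<open>chol\<close> in coordinates. This form is stable under composition and suited to pointwise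
  limits; power series return at the end, when the maps are linear.\<close>

definition free_pair :: "(nat \<Rightarrow> 'g::finite mtuple set) \<Rightarrow> (nat \<Rightarrow> 'g mtuple set) \<Rightarrow>
    (nat \<Rightarrow> 'g mtuple \<Rightarrow> 'g mtuple) \<Rightarrow> (nat \<Rightarrow> 'g mtuple \<Rightarrow> 'g mtuple) \<Rightarrow> bool" where
  "free_pair U D f h \<longleftrightarrow> free_map U D f \<and> free_map D U h \<and>
     (\<forall>n>0. \<forall>X\<in>U n. h n (f n X) = X) \<and> (\<forall>n>0. \<forall>Y\<in>D n. f n (h n Y) = Y) \<and>
     (\<forall>n>0. \<forall>p\<in>coords n. chol (coords n) (vectors n (U n)) (\<lambda>x. lift n (f n) x p)) \<and>
     (\<forall>n>0. \<forall>p\<in>coords n. chol (coords n) (vectors n (D n)) (\<lambda>x. lift n (h n) x p))"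

lemma free_pair_sym: "free_pair U D f h \<Longrightarrow> free_pair D U h f"
  by (simp add: free_pair_def)

lemma free_mapD:
  assumes "free_map U V f" "n > 0"
  shows "X \<in> U n \<Longrightarrow> f n X \<in> V n"
    "m > 0 \<Longrightarrow> X \<in> U n \<Longrightarrow> Y \<in> U m \<Longrightarrow> f (n + m) (dsum_tuple X Y) = dsum_tuple (f n X) (f m Y)"
    "X \<in> U n \<Longrightarrow> Y \<in> U n \<Longrightarrow> \<Gamma> \<in> carrier_mat n n \<Longrightarrow> invertible_mat \<Gamma> \<Longrightarrow> (\<And>j. X j * \<Gamma> = \<Gamma> * Y j) \<Longrightarrow>
       f n X j * \<Gamma> = \<Gamma> * f n Y j"
proof -
  show "f n X \<in> V n" if "X \<in> U n"
    using assms that by (auto simp: free_map_def)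
  show "f (n + m) (dsum_tuple X Y) = dsum_tuple (f n X) (f m Y)" if "m > 0" "X \<in> U n" "Y \<in> U m"
    using assms that by (simp add: free_map_def)
  have "\<forall>X\<in>U n. \<forall>Y\<in>U n. \<forall>\<Gamma>\<in>carrier_mat n n. invertible_mat \<Gamma> \<and> (\<forall>j. X j * \<Gamma> = \<Gamma> * Y j) \<longrightarrow>
      (\<forall>j. f n X j * \<Gamma> = \<Gamma> * f n Y j)"
    by (rule mp[OF spec[OF conjunct2[OF conjunct2[OF assms(1)[unfolded free_map_def]]]] assms(2)])
  then show "f n X j * \<Gamma> = \<Gamma> * f n Y j"
    if "X \<in> U n" "Y \<in> U n" "\<Gamma> \<in> carrier_mat n n" "invertible_mat \<Gamma>" "\<And>j. X j * \<Gamma> = \<Gamma> * Y j"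
    using that by simp
qed

lemma free_pairD:
  assumes "free_pair U D f h" "n > 0"
  shows "X \<in> U n \<Longrightarrow> f n X \<in> D n" "X \<in> U n \<Longrightarrow> h n (f n X) = X"
    "p \<in> coords n \<Longrightarrow> chol (coords n) (vectors n (U n)) (\<lambda>x. lift n (f n) x p)"
    "m > 0 \<Longrightarrow> X \<in> U n \<Longrightarrow> Y \<in> U m \<Longrightarrow> f (n + m) (dsum_tuple X Y) = dsum_tuple (f n X) (f m Y)"
proof -
  have f: "free_map U D f" using assms(1) by (simp add: free_pair_def)
  show "X \<in> U n \<Longrightarrow> f n X \<in> D n" by (rule free_mapD(1)[OF f assms(2)])
  show "m > 0 \<Longrightarrow> X \<in> U n \<Longrightarrow> Y \<in> U m \<Longrightarrow> f (n + m) (dsum_tuple X Y) = dsum_tuple (f n X) (f m Y)"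
    by (rule free_mapD(2)[OF f assms(2)])
  show "X \<in> U n \<Longrightarrow> h n (f n X) = X"
    and "p \<in> coords n \<Longrightarrow> chol (coords n) (vectors n (U n)) (\<lambda>x. lift n (f n) x p)"
    using assms by (auto simp: free_pair_def)
qed

lemma lift_vectors:
  assumes "S \<subseteq> mat_tuples n" "F (tuple_of n x) \<in> S"
  shows "tuple_of n (lift n F x) = F (tuple_of n x)" "lift n F x \<in> vectors n S"
  using assms by (auto simp: lift_def vectors_def)

lemma free_pair_mutual:
  assumes D: "admissible M D" and fh: "free_pair U D f h" and n: "n > 0"
  shows "mutual (coords n) (vectors n (U n)) (vectors n (D n)) (lift n (f n)) (lift n (h n))"
  unfolding mutual_def
proof (intro conjI ballI)
  note f = free_pairD[OF fh n]
  fix x assume "x \<in> vectors n (U n)"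
  then have x: "tuple_of n x \<in> U n" by (simp add: vectors_def)
  note l = lift_vectors[where F = "f n", OF admissibleD(1)[OF D n] f(1)[OF x]]
  show "lift n (f n) x \<in> vectors n (D n)" by (rule l(2))
  show "lift n (h n) (lift n (f n) x) p = x p" if "p \<in> coords n" for p
    using l(1) f(2)[OF x] that by (simp add: lift_def[of n "h n"])
qed (rule free_pairD(3)[OF fh n])

lemma free_map_compose:
  assumes f: "free_map U V f" and g: "free_map V W g"
  shows "free_map U W (\<lambda>n X. g n (f n X))"
  unfolding free_map_def
proof (intro conjI allI impI ballI image_subsetI)
  fix n :: nat assume n: "0 < n"
  note F = free_mapD[OF f n] and G = free_mapD[OF g n]
  show "g n (f n X) \<in> W n" if "X \<in> U n" for X using F(1) G(1) that by blast
  show "g (n + m) (f (n + m) (dsum_tuple X Y)) = dsum_tuple (g n (f n X)) (g m (f m Y))"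
    if "0 < m" "X \<in> U n" "Y \<in> U m" for m X Y
    using F(2)[OF that] G(2)[OF that(1) F(1)[OF that(2)] free_mapD(1)[OF f that(1,3)]] by simp
  show "g n (f n X) j * \<Gamma> = \<Gamma> * g n (f n Y) j"
    if "X \<in> U n" "Y \<in> U n" "\<Gamma> \<in> carrier_mat n n" "invertible_mat \<Gamma> \<and> (\<forall>j. X j * \<Gamma> = \<Gamma> * Y j)" for X Y \<Gamma> j
  proof (rule G(3)[OF F(1) F(1)])
    show "f n X j * \<Gamma> = \<Gamma> * f n Y j" for j
      by (rule F(3)) (use that in auto)
  qed (use that in auto)
qed

lemma lift_compose_chol:
  fixes S T :: "'g::finite mtuple set"
  assumes T: "T \<subseteq> mat_tuples n" and S: "pd_open (coords n) (vectors n S)"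
    and fT: "\<And>X. X \<in> S \<Longrightarrow> f X \<in> T"
    and f: "\<And>p. p \<in> coords n \<Longrightarrow> chol (coords n) (vectors n S) (\<lambda>x. lift n f x p)"
    and g: "chol (coords n) (vectors n T) (\<lambda>x. lift n g x p)"
  shows "chol (coords n) (vectors n S) (\<lambda>x. lift n (\<lambda>X. g (f X)) x p)"
proof (rule chol_cong)
  have fx: "f (tuple_of n x) \<in> T" if "x \<in> vectors n S" for x using that fT by (simp add: vectors_def)
  show "chol (coords n) (vectors n S) (\<lambda>x. lift n g (lift n f x) p)"
    by (rule chol_compose[OF _ _ g f S]) (use lift_vectors(2)[where F = f, OF T fx] in auto)
  show "lift n (\<lambda>X. g (f X)) x p = lift n g (lift n f x) p" if "x \<in> vectors n S" for x
    using lift_vectors(1)[where F = f, OF T fx[OF that]] by (simp add: lift_def)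
qed

lemma free_pair_compose:
  assumes U: "admissible M U" and V: "admissible M V" and W: "admissible M W"
    and fh: "free_pair U V f h" and gk: "free_pair V W g k"
  shows "free_pair U W (\<lambda>n X. g n (f n X)) (\<lambda>n Y. h n (k n Y))"
proof -
  note hf = free_pair_sym[OF fh] and kg = free_pair_sym[OF gk]
  have "chol (coords n) (vectors n (U n)) (\<lambda>x. lift n (\<lambda>X. g n (f n X)) x p)" if "n > 0" "p \<in> coords n" for n p
    by (rule lift_compose_chol[where f = "f n" and g = "g n", OF admissibleD(1)[OF V that(1)] pd_open_vectors[OF admissibleD(2)[OF U that(1)]]])
      (use free_pairD[OF fh that(1)] free_pairD[OF gk that(1)] that in auto)
  moreover have "chol (coords n) (vectors n (W n)) (\<lambda>x. lift n (\<lambda>X. h n (k n X)) x p)" if "n > 0" "p \<in> coords n" for n p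
    by (rule lift_compose_chol[where f = "k n" and g = "h n", OF admissibleD(1)[OF V that(1)] pd_open_vectors[OF admissibleD(2)[OF W that(1)]]])
      (use free_pairD[OF kg that(1)] free_pairD[OF hf that(1)] that in auto)
  moreover have "free_map U W (\<lambda>n X. g n (f n X))" "free_map W U (\<lambda>n Y. h n (k n Y))"
    using fh gk by (auto simp: free_pair_def intro: free_map_compose)
  moreover have "h n (k n (g n (f n X))) = X" if "n > 0" "X \<in> U n" for n X
    using free_pairD[OF fh that(1)] free_pairD[OF gk that(1)] that by simp
  moreover have "g n (f n (h n (k n Y))) = Y" if "n > 0" "Y \<in> W n" for n Y
    using free_pairD[OF kg that(1)] free_pairD[OF hf that(1)] that by simp
  ultimately show ?thesis unfolding free_pair_def by blast
qed

lemma dsum_scale: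
  fixes X Y :: "'g::finite mtuple"
  assumes "X \<in> mat_tuples n" "Y \<in> mat_tuples m"
  shows "scale_tuple u (dsum_tuple X Y) = dsum_tuple (scale_tuple u X) (scale_tuple u Y)"
proof (rule tuple_eqI[of _ "n + m"])
  fix p :: "'g \<times> nat \<times> nat" assume "p \<in> coords (n + m)"
  then obtain j i k where p: "p = (j, i, k)" "i < n + m" "k < n + m" by (cases p) (auto simp: mem_coords)
  have X: "coord (scale_tuple u X) (j, i, k) = u * coord X (j, i, k)" if "i < n" "k < n"
    by (rule coord_scale_tuple[OF assms(1)]) (use that in \<open>simp add: mem_coords\<close>)
  have Y: "coord (scale_tuple u Y) (j, i - n, k - n) = u * coord Y (j, i - n, k - n)" if "\<not> i < n" "\<not> k < n"
    by (rule coord_scale_tuple[OF assms(2)]) (use that p in \<open>auto simp: mem_coords\<close>)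
  have "coord (scale_tuple u (dsum_tuple X Y)) p = u * coord (dsum_tuple X Y) p"
    by (rule coord_scale_tuple[OF dsum_mem[OF assms]]) (use p in \<open>simp add: mem_coords\<close>)
  also have "\<dots> = coord (dsum_tuple (scale_tuple u X) (scale_tuple u Y)) p"
    unfolding p(1) coord_dsum[OF assms p(2,3)] coord_dsum[OF scale_tuple_mem[OF assms(1)] scale_tuple_mem[OF assms(2)] p(2,3)]
    by (simp add: X Y)
  finally show "coord (scale_tuple u (dsum_tuple X Y)) p = coord (dsum_tuple (scale_tuple u X) (scale_tuple u Y)) p" .
qed (use assms in \<open>auto simp: dsum_mem\<close>)

lemma free_pair_scale:
  assumes U: "admissible M U" and u: "cmod u = 1"
  shows "free_pair U U (\<lambda>n. scale_tuple u) (\<lambda>n. scale_tuple (cnj u))"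
proof -
  have fm: "free_map U U (\<lambda>n. scale_tuple w)" if "cmod w = 1" for w
    unfolding free_map_def
  proof (intro conjI allI impI ballI image_subsetI)
    fix n :: nat assume n: "0 < n"
    show "scale_tuple w X \<in> U n" if "X \<in> U n" for X by (rule admissible_scale[OF U n that \<open>cmod w = 1\<close>])
    show "scale_tuple w (dsum_tuple X Y) = dsum_tuple (scale_tuple w X) (scale_tuple w Y)"
      if "0 < m" "X \<in> U n" "Y \<in> U m" for m X Y
      using that n admissibleD(1)[OF U] by (intro dsum_scale[of _ n _ m]) auto
    show "scale_tuple w X j * \<Gamma> = \<Gamma> * scale_tuple w Y j"
      if "X \<in> U n" "Y \<in> U n" "\<Gamma> \<in> carrier_mat n n" "invertible_mat \<Gamma> \<and> (\<forall>j. X j * \<Gamma> = \<Gamma> * Y j)" for X Y \<Gamma> j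
    proof -
      have "X j \<in> carrier_mat n n" "Y j \<in> carrier_mat n n"
        using that admissibleD(1)[OF U n] by (auto simp: mat_tuples_def)
      then show ?thesis using that
        by (simp add: scale_tuple_def mult_smult_assoc_mat[of _ n n _ n] mult_smult_distrib[of _ n n _ n])
    qed
  qed
  have ch: "chol (coords n) (vectors n (U n)) (\<lambda>x. lift n (scale_tuple w) x p)" if "n > 0" "p \<in> coords n" for n p w
  proof (rule chol_cong)
    have op: "pd_open (coords n) (vectors n (U n))" by (rule pd_open_vectors[OF admissibleD(2)[OF U that(1)]])
    show "chol (coords n) (vectors n (U n)) (\<lambda>x. w * x p)"
      by (intro chol_mult chol_const chol_coord op that)
    show "lift n (scale_tuple w) x p = w * x p" if "x \<in> vectors n (U n)" for x
      using \<open>p \<in> coords n\<close> by (simp add: lift_def coord_scale_tuple[where n = n])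
  qed
  have inv: "scale_tuple v (scale_tuple w X) = X" if "v * w = 1" "X \<in> mat_tuples n" for v w n and X :: "'a mtuple"
    using that by (intro tuple_eqI[of _ n]) (auto simp: coord_scale_tuple[where n = n] mult.assoc[symmetric])
  have "u * cnj u = 1" using u by (simp add: complex_norm_square[symmetric])
  then have "scale_tuple (cnj u) (scale_tuple u X) = X" "scale_tuple u (scale_tuple (cnj u) X) = X"
    if "n > 0" "X \<in> U n" for n X
    using inv[of "cnj u" u X n] inv[of u "cnj u" X n] admissibleD(1)[OF U that(1)] that(2)
    by (auto simp: mult.commute[of "cnj u"])
  then show ?thesis
    unfolding free_pair_def using fm u ch by simp
qed

section \<open>The first level as a domain in \<open>C^g\<close>\<close>

text \<open>\<open>coords 1\<close> is a copy of \<open>'g\<close>, and determinants want the type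
  itself as index set. All matrix positions receive the same value, of which level one reads the
  position \<open>(0, 0)\<close>.\<close>

definition spread :: "('g \<Rightarrow> complex) \<Rightarrow> 'g \<times> nat \<times> nat \<Rightarrow> complex" where
  "spread x = (\<lambda>p. x (fst p))"

definition collapse :: "('g \<times> nat \<times> nat \<Rightarrow> complex) \<Rightarrow> 'g \<Rightarrow> complex" where
  "collapse y = (\<lambda>j. y (j, 0, 0))"

lemma spread_apply: "spread x p = x (fst p)"
  by (simp add: spread_def)

lemma coords_1: "p \<in> coords (Suc 0) \<longleftrightarrow> (\<exists>j. p = (j, 0, 0))"
  by (cases p) (auto simp: mem_coords)

lemma spread_collapse: "p \<in> coords 1 \<Longrightarrow> spread (collapse y) p = y p"
  by (auto simp: coords_1 spread_def collapse_def)

lemma collapse_spread [simp]: "collapse (spread x) = x"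
  by (simp add: spread_def collapse_def)

lemma spread_polydisc: "y \<in> polydisc UNIV x r \<Longrightarrow> spread y \<in> polydisc I (spread x) r"
  by (simp add: mem_polydisc spread_def)

lemma collapse_polydisc: "y \<in> polydisc (coords 1) x r \<Longrightarrow> collapse y \<in> polydisc UNIV (collapse x) r"
  by (auto simp: mem_polydisc collapse_def coords_1)

lemma pd_open_spread:
  assumes "pd_open I S" shows "pd_open UNIV (spread -` S)"
  unfolding pd_open_def
proof
  fix x assume "x \<in> spread -` S"
  then obtain r where "r > 0" "polydisc I (spread x) r \<subseteq> S" using assms unfolding pd_open_def by blast
  then show "\<exists>r>0. polydisc UNIV x r \<subseteq> spread -` S" using spread_polydisc by blast
qed

lemma pd_open_collapse:
  assumes "pd_open UNIV A" shows "pd_open (coords 1) (collapse -` A)"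
  unfolding pd_open_def
proof
  fix x assume "x \<in> collapse -` A"
  then obtain r where "r > 0" "polydisc UNIV (collapse x) r \<subseteq> A" using assms unfolding pd_open_def by blast
  then show "\<exists>r>0. polydisc (coords 1) x r \<subseteq> collapse -` A" using collapse_polydisc by blast
qed

lemma spread_circled:
  fixes S :: "('g::finite \<times> nat \<times> nat \<Rightarrow> complex) set"
  assumes "circled_domain (coords 1) S" shows "circled_domain UNIV (spread -` S)"
proof -
  interpret circled_domain "coords 1" S by (rule assms)
  have mem: "spread (collapse y) \<in> S \<longleftrightarrow> y \<in> S" for y
    using pd_open_cong[OF opn, of y "spread (collapse y)"] pd_open_cong[OF opn, of "spread (collapse y)" y]
    by (auto simp: spread_collapse)
  show ?thesis
  proof
    show "pd_open UNIV (spread -` S)" by (rule pd_open_spread[OF opn])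
    show "pd_connected UNIV (spread -` S)"
      unfolding pd_connected_def
    proof (intro allI impI)
      fix A B :: "('g \<Rightarrow> complex) set"
      assume A: "pd_open UNIV A" and B: "pd_open UNIV B" and AB: "A \<union> B = spread -` S" "A \<inter> B = {}"
      have "collapse -` A \<union> collapse -` B = S" using AB(1) mem by (auto simp: set_eq_iff)
      moreover have "collapse -` A \<inter> collapse -` B = {}" using AB(2) by auto
      ultimately have "collapse -` A = {} \<or> collapse -` B = {}"
        using con pd_open_collapse[OF A] pd_open_collapse[OF B] unfolding pd_connected_def by blast
      then show "A = {} \<or> B = {}" by (metis all_not_in_conv collapse_spread vimage_eq)
    qed
    show "circled (spread -` S)" using rotate unfolding circled_def by (auto simp: spread_def)
    show "(\<lambda>p. 0) \<in> spread -` S" using zero by (simp add: spread_def)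
    obtain R where R: "S \<subseteq> polydisc (coords 1) (\<lambda>p. 0) R" using bdd by blast
    have "spread -` S \<subseteq> polydisc UNIV (\<lambda>p. 0) R"
    proof
      fix x assume "x \<in> spread -` S"
      then have "spread x \<in> polydisc (coords 1) (\<lambda>p. 0) R" using R by auto
      from collapse_polydisc[OF this] show "x \<in> polydisc UNIV (\<lambda>p. 0) R" by (simp add: collapse_def[of "\<lambda>p. 0"])
    qed
    then show "\<exists>R. spread -` S \<subseteq> polydisc UNIV (\<lambda>p. 0) R" by blast
  qed simp
qed

lemma spread_mutual:
  fixes S T :: "('g::finite \<times> nat \<times> nat \<Rightarrow> complex) set"
  assumes S: "pd_open (coords 1) S" and T: "pd_open (coords 1) T"
    and fh: "mutual (coords 1) S T f h" and hf: "mutual (coords 1) T S h f"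
  shows "mutual UNIV (spread -` S) (spread -` T) (\<lambda>x. collapse (f (spread x))) (\<lambda>y. collapse (h (spread y)))"
  unfolding mutual_def
proof (intro conjI ballI)
  note f = mutualD[OF fh] and h = mutualD[OF hf]
  fix x :: "'g \<Rightarrow> complex" assume "x \<in> spread -` S"
  then have x: "spread x \<in> S" by simp
  show "collapse (f (spread x)) \<in> spread -` T"
    using pd_open_cong[OF T f(1)[OF x], of "spread (collapse (f (spread x)))"] spread_collapse[of _ "f (spread x)"] by auto
  fix j
  have "h (spread (collapse (f (spread x)))) (j, 0, 0) = h (f (spread x)) (j, 0, 0)"
    by (rule chol_cong_coords[OF h(3) f(1)[OF x]]) (auto simp: coords_1 spread_collapse)
  also have "\<dots> = spread x (j, 0, 0)" by (rule f(2)[OF x]) (simp add: coords_1)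
  finally show "collapse (h (spread (collapse (f (spread x))))) j = x j" by (simp add: collapse_def spread_def)
next
  fix j
  have op: "pd_open UNIV (spread -` S)" by (rule pd_open_spread[OF S])
  have "chol UNIV (spread -` S) (\<lambda>x. f (spread x) (j, 0, 0))"
  proof (rule chol_compose[OF _ _ mutualD(3)[OF fh] _ op])
    show "chol UNIV (spread -` S) (\<lambda>x. spread x p)" for p
      using chol_coord[OF op, of "fst p"] by (simp only: spread_apply UNIV_I)
  qed (auto simp: coords_1)
  then show "chol UNIV (spread -` S) (\<lambda>x. collapse (f (spread x)) j)" by (simp add: collapse_def)
qed

abbreviation level1 :: "(nat \<Rightarrow> 'g::finite mtuple set) \<Rightarrow> ('g \<Rightarrow> complex) set" where
  "level1 U \<equiv> spread -` vectors 1 (U 1)"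

definition lift1 :: "(nat \<Rightarrow> 'g mtuple \<Rightarrow> 'g mtuple) \<Rightarrow> ('g \<Rightarrow> complex) \<Rightarrow> 'g \<Rightarrow> complex" where
  "lift1 f x = collapse (lift 1 (f 1) (spread x))"

lemma lift1_mutual:
  assumes U: "admissible M U" and D: "admissible M D" and fh: "free_pair U D f h"
  shows "mutual UNIV (level1 U) (level1 D) (lift1 f) (lift1 h)"
  unfolding lift1_def
  by (rule spread_mutual[OF pd_open_vectors[OF admissibleD(2)[OF U]] pd_open_vectors[OF admissibleD(2)[OF D]]
        free_pair_mutual[OF D fh] free_pair_mutual[OF U free_pair_sym[OF fh]]]) simp_all

lemma level1_circled: "admissible M U \<Longrightarrow> circled_domain UNIV (level1 U)"
  by (rule spread_circled[OF admissible_circled]) simp_all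

section \<open>Limits of free biholomorphisms\<close>

text \<open>\<open>F\<close> has to give tuples of the right size everywhere, so that its entries
  can be handled before its values are known to lie in the target.\<close>

definition converges :: "'k filter \<Rightarrow> (nat \<Rightarrow> 'g::finite mtuple set) \<Rightarrow> ('k \<Rightarrow> nat \<Rightarrow> 'g mtuple \<Rightarrow> 'g mtuple) \<Rightarrow>
    (nat \<Rightarrow> 'g mtuple \<Rightarrow> 'g mtuple) \<Rightarrow> bool" where
  "converges G U f F \<longleftrightarrow> (\<forall>n X. F n X \<in> mat_tuples n) \<and>
     (\<forall>n>0. \<forall>X\<in>U n. \<forall>p\<in>coords n. ((\<lambda>k. coord (f k n X) p) \<longlongrightarrow> coord (F n X) p) G)"

text \<open>One cluster filter serves both maps, all levels, all points and all entries, so that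
  identities relating them survive the limit.\<close>

lemma free_pairs_cluster:
  fixes U D :: "nat \<Rightarrow> 'g::finite mtuple set"
  assumes U: "admissible M U" and D: "admissible M D" and fh: "\<And>k::nat. free_pair U D (f k) (h k)"
  obtains G F H where "G \<le> sequentially" "G \<noteq> bot" "converges G U f F" "converges G D h H"
proof -
  \<comment> \<open>The Boolean selects \<open>f\<close> or \<open>h\<close>; the value
    \<open>0\<close> fills the index quadruples at which no bound is available.\<close>
  define K where "K = (\<lambda>k (b, n, X, p). if n > 0 \<and> p \<in> coords n \<and> X \<in> (if b then U n else D n)
     then coord ((if b then f k else h k) n X) p else 0)"
  have bound: "cmod (K k a) \<le> \<bar>M\<bar>" for k a
  proof -
    obtain b n X p where a: "a = (b, n, X, p)" by (cases a) auto
    have "cmod (coord (f k n X) p) \<le> \<bar>M\<bar>" if "n > 0" "p \<in> coords n" "X \<in> U n"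
      using admissibleD(5)[OF D that(1) free_pairD(1)[OF fh that(1,3)] that(2), of k] by linarith
    moreover have "cmod (coord (h k n X) p) \<le> \<bar>M\<bar>" if "n > 0" "p \<in> coords n" "X \<in> D n"
      using admissibleD(5)[OF U that(1) free_pairD(1)[OF free_pair_sym[OF fh] that(1,3)] that(2), of k] by linarith
    ultimately show ?thesis by (simp add: K_def a)
  qed
  then obtain G g where G: "G \<le> sequentially" "G \<noteq> bot" and g: "\<And>a. ((\<lambda>k. K k a) \<longlongrightarrow> g a) G"
    using pointwise_cluster[of sequentially K "\<lambda>_. \<bar>M\<bar>", OF trivial_limit_sequentially bound] by blast
  have "converges G U f (\<lambda>n X. tuple_of n (\<lambda>p. g (True, n, X, p)))"
    unfolding converges_def
  proof (intro conjI allI impI ballI)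
    fix n and X :: "'g mtuple" and p :: "'g \<times> nat \<times> nat" assume a: "0 < n" "X \<in> U n" "p \<in> coords n"
    then show "((\<lambda>k. coord (f k n X) p) \<longlongrightarrow> coord (tuple_of n (\<lambda>p. g (True, n, X, p))) p) G"
      using g[of "(True, n, X, p)"] by (simp add: K_def)
  qed simp
  moreover have "converges G D h (\<lambda>n X. tuple_of n (\<lambda>p. g (False, n, X, p)))"
    unfolding converges_def
  proof (intro conjI allI impI ballI)
    fix n and X :: "'g mtuple" and p :: "'g \<times> nat \<times> nat" assume a: "0 < n" "X \<in> D n" "p \<in> coords n"
    then show "((\<lambda>k. coord (h k n X) p) \<longlongrightarrow> coord (tuple_of n (\<lambda>p. g (False, n, X, p))) p) G"
      using g[of "(False, n, X, p)"] by (simp add: K_def)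
  qed simp
  ultimately show thesis by (rule that[OF G])
qed

lemma convergesD:
  assumes "converges G U f F"
  shows "F n X \<in> mat_tuples n"
    "n > 0 \<Longrightarrow> X \<in> U n \<Longrightarrow> p \<in> coords n \<Longrightarrow> ((\<lambda>k. coord (f k n X) p) \<longlongrightarrow> coord (F n X) p) G"
  using assms by (auto simp: converges_def)

lemma converges_dsum:
  fixes U D :: "nat \<Rightarrow> 'g::finite mtuple set"
  assumes U: "admissible M U" and D: "admissible M D" and f: "\<And>k. free_map U D (f k)" and G: "G \<noteq> bot"
    and F: "converges G U f F" and n: "n > 0" "m > 0" and X: "X \<in> U n" and Y: "Y \<in> U m"
  shows "F (n + m) (dsum_tuple X Y) = dsum_tuple (F n X) (F m Y)"
proof (rule tuple_eqI[of _ "n + m"])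
  note c = convergesD[OF F]
  fix p :: "'g \<times> nat \<times> nat" assume pc: "p \<in> coords (n + m)"
  then obtain j i k where p: "p = (j, i, k)" "i < n + m" "k < n + m" by (cases p) (auto simp: mem_coords)
  then have ik: "i < n \<or> i - n < m" "k < n \<or> k - n < m" by auto
  have fm: "f l n X \<in> mat_tuples n" "f l m Y \<in> mat_tuples m" for l
    using free_mapD(1)[OF f n(1) X] free_mapD(1)[OF f n(2) Y] admissibleD(1)[OF D] n by blast+
  have "((\<lambda>l. coord (f l (n + m) (dsum_tuple X Y)) p) \<longlongrightarrow> coord (F (n + m) (dsum_tuple X Y)) p) G"
    using n by (intro c(2) admissibleD(6)[OF U n(1) n(2)] X Y pc) simp
  moreover have "coord (f l (n + m) (dsum_tuple X Y)) p = (if i < n then if k < n then coord (f l n X) (j, i, k) else 0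
      else if k < n then 0 else coord (f l m Y) (j, i - n, k - n))" for l
    unfolding free_mapD(2)[OF f n X Y] p(1) by (rule coord_dsum[OF fm p(2,3)])
  moreover have "((\<lambda>l. if i < n then if k < n then coord (f l n X) (j, i, k) else 0
      else if k < n then 0 else coord (f l m Y) (j, i - n, k - n)) \<longlongrightarrow> coord (dsum_tuple (F n X) (F m Y)) p) G"
    unfolding p(1) coord_dsum[OF c(1) c(1) p(2,3)] using ik c(2)[OF n(1) X] c(2)[OF n(2) Y]
    by (auto simp: mem_coords)
  ultimately show "coord (F (n + m) (dsum_tuple X Y)) p = coord (dsum_tuple (F n X) (F m Y)) p"
    using tendsto_unique[OF G] by simp
qed (auto intro: convergesD(1)[OF F] dsum_mem)

text \<open>For fixed \<open>\<Gamma>\<close> both products are linear in the entries of the values,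
  so the identity passes to the limit entry by entry.\<close>

lemma converges_intertwine:
  fixes U D :: "nat \<Rightarrow> 'g::finite mtuple set"
  assumes D: "admissible M D" and f: "\<And>k. free_map U D (f k)" and G: "G \<noteq> bot"
    and F: "converges G U f F" and n: "n > 0" and X: "X \<in> U n" and Y: "Y \<in> U n"
    and \<Gamma>: "\<Gamma> \<in> carrier_mat n n" "invertible_mat \<Gamma>" and XY: "\<And>j. X j * \<Gamma> = \<Gamma> * Y j"
  shows "F n X j * \<Gamma> = \<Gamma> * F n Y j"
proof -
  note c = convergesD[OF F]
  have dim: "F n X j \<in> carrier_mat n n" "F n Y j \<in> carrier_mat n n" by (rule mat_tuples_dim[OF c(1)])+
  show ?thesis
  proof (rule eq_matI)
    fix i k assume "i < dim_row (\<Gamma> * F n Y j)" "k < dim_col (\<Gamma> * F n Y j)"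
    then have ik: "i < n" "k < n" using \<Gamma> dim by auto
    have fm: "f l n X \<in> mat_tuples n" "f l n Y \<in> mat_tuples n" for l
      using free_mapD(1)[OF f n] X Y admissibleD(1)[OF D n] by blast+
    have "((\<lambda>l. (f l n X j * \<Gamma>) $$ (i, k)) \<longlongrightarrow> (F n X j * \<Gamma>) $$ (i, k)) G"
      unfolding tuple_mult_entry(1)[OF fm(1) \<Gamma>(1) ik] tuple_mult_entry(1)[OF c(1) \<Gamma>(1) ik]
      by (intro tendsto_intros c(2) n X) (use ik in \<open>simp add: mem_coords\<close>)
    moreover have "((\<lambda>l. (\<Gamma> * f l n Y j) $$ (i, k)) \<longlongrightarrow> (\<Gamma> * F n Y j) $$ (i, k)) G"
      unfolding tuple_mult_entry(2)[OF fm(2) \<Gamma>(1) ik] tuple_mult_entry(2)[OF c(1) \<Gamma>(1) ik]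
      by (intro tendsto_intros c(2) n Y) (use ik in \<open>simp add: mem_coords\<close>)
    moreover have "f l n X j * \<Gamma> = \<Gamma> * f l n Y j" for l
      by (rule free_mapD(3)[OF f n X Y \<Gamma> XY])
    ultimately show "(F n X j * \<Gamma>) $$ (i, k) = (\<Gamma> * F n Y j) $$ (i, k)"
      using tendsto_unique[OF G] by simp
  qed (use \<Gamma> dim in auto)
qed

lemma vectors_bound:
  fixes U :: "nat \<Rightarrow> 'g::finite mtuple set"
  assumes "admissible M U" "n > 0" "x \<in> vectors n (U n)" shows "\<forall>p\<in>coords n. cmod (x p) \<le> M"
proof
  fix p :: "'g \<times> nat \<times> nat" assume "p \<in> coords n"
  then show "cmod (x p) \<le> M"
    using admissibleD(5)[OF assms(1,2), of "tuple_of n x" p] assms(3) by (simp add: vectors_def)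
qed

text \<open>\<open>mutual_limit\<close> wants one interior value per level. \<open>base\<close> is
  that value at the first level, and direct sums of zero tuples provide it at every other
  level.\<close>

lemma free_pair_converges:
  fixes U D :: "nat \<Rightarrow> 'g::finite mtuple set"
  assumes U: "admissible M U" and D: "admissible M D" and fh: "\<And>k. free_pair U D (f k) (h k)" and G: "G \<noteq> bot"
    and F: "converges G U f F" and H: "converges G D h H" and base: "F 1 (zero_tuple 1) \<in> D 1"
  shows "free_pair U D F H"
proof -
  have hf: "free_pair D U (h k) (f k)" for k by (rule free_pair_sym[OF fh])
  have fm: "free_map U D (f k)" and hm: "free_map D U (h k)" for k using fh[of k] by (auto simp: free_pair_def)
  have z: "F n (zero_tuple n) \<in> D n" if "n > 0" for n
    using that
  proof (induction n rule: nat_induct_non_zero)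
    case 1
    then show ?case using base by simp
  next
    case (Suc n)
    have "F (n + 1) (dsum_tuple (zero_tuple n) (zero_tuple 1)) = dsum_tuple (F n (zero_tuple n)) (F 1 (zero_tuple 1))"
      by (rule converges_dsum[OF U D fm G F]) (use Suc admissibleD(4)[OF U] in auto)
    moreover have "dsum_tuple (F n (zero_tuple n)) (F 1 (zero_tuple 1)) \<in> D (n + 1)"
      by (rule admissibleD(6)[OF D]) (use Suc base in auto)
    ultimately show ?case by (simp add: dsum_zero)
  qed
  have conv: "((\<lambda>k. lift n (f k n) x p) \<longlongrightarrow> lift n (F n) x p) G" if "n > 0" "x \<in> vectors n (U n)" "p \<in> coords n" for n x p
    using convergesD(2)[OF F that(1) _ that(3)] that(2) by (simp add: lift_def vectors_def)
  have convH: "((\<lambda>k. lift n (h k n) x p) \<longlongrightarrow> lift n (H n) x p) G" if "n > 0" "x \<in> vectors n (D n)" "p \<in> coords n" for n x p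
    using convergesD(2)[OF H that(1) _ that(3)] that(2) by (simp add: lift_def vectors_def)
  have main: "(\<forall>X\<in>U n. F n X \<in> D n \<and> H n (F n X) = X) \<and> (\<forall>Y\<in>D n. H n Y \<in> U n \<and> F n (H n Y) = Y) \<and>
      (\<forall>p\<in>coords n. chol (coords n) (vectors n (U n)) (\<lambda>x. lift n (F n) x p)) \<and>
      (\<forall>p\<in>coords n. chol (coords n) (vectors n (D n)) (\<lambda>x. lift n (H n) x p))" if n: "n > 0" for n
  proof -
    interpret S: circled_domain "coords n" "vectors n (U n)" by (rule admissible_circled[OF U n])
    interpret T: circled_domain "coords n" "vectors n (D n)" by (rule admissible_circled[OF D n])
    note m = free_pair_mutual[OF D fh n] and m' = free_pair_mutual[OF U hf n]
    have tF: "tuple_of n (lift n (F n) x) = F n (tuple_of n x)" for x by (simp add: lift_def convergesD(1)[OF F])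
    have tH: "tuple_of n (lift n (H n) x) = H n (tuple_of n x)" for x by (simp add: lift_def convergesD(1)[OF H])
    have F0: "lift n (F n) (\<lambda>p. 0) \<in> vectors n (D n)" using z[OF n] by (simp add: vectors_def tF)
    note lim = mutual_limit[where f = "\<lambda>k. lift n (f k n)" and h = "\<lambda>k. lift n (h k n)" and F = "lift n (F n)" and H = "lift n (H n)" and ?x0.0 = "\<lambda>p. 0",
        OF S.fin S.opn S.con T.opn vectors_bound[OF U n] vectors_bound[OF D n] m m' G
        conv[OF n] convH[OF n] S.zero F0]
    have lim1: "lift n (F n) x \<in> vectors n (D n)" if "x \<in> vectors n (U n)" for x
      using that by - (rule lim(1); assumption)
    have lim2: "lift n (H n) (lift n (F n) x) p = x p" if "x \<in> vectors n (U n)" "p \<in> coords n" for x p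
      using that by - (rule lim(2); assumption)
    \<comment> \<open>In the reverse direction the base point is the image of \<open>0\<close> under
      \<open>F\<close>, already known to lie in the target; \<open>H\<close> sends it back to
      \<open>0\<close>, an interior point of the source.\<close>
    have "lift n (H n) (lift n (F n) (\<lambda>p. 0)) \<in> vectors n (U n)"
      by (rule pd_open_cong[OF S.opn S.zero]) (simp add: lim2[OF S.zero])
    note lim' = mutual_limit[where f = "\<lambda>k. lift n (h k n)" and h = "\<lambda>k. lift n (f k n)" and F = "lift n (H n)" and H = "lift n (F n)" and ?x0.0 = "lift n (F n) (\<lambda>p. 0)",
        OF T.fin T.opn T.con S.opn vectors_bound[OF D n] vectors_bound[OF U n] m' m G
        convH[OF n] conv[OF n] F0 this]
    have lim'1: "lift n (H n) y \<in> vectors n (U n)" if "y \<in> vectors n (D n)" for y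
      using that by - (rule lim'(1); assumption)
    have lim'2: "lift n (F n) (lift n (H n) y) p = y p" if "y \<in> vectors n (D n)" "p \<in> coords n" for y p
      using that by - (rule lim'(2); assumption)
    have "F n X \<in> D n \<and> H n (F n X) = X" if X: "X \<in> U n" for X
    proof -
      have Xm: "X \<in> mat_tuples n" using X admissibleD(1)[OF U n] by blast
      have x: "coord X \<in> vectors n (U n)" using X Xm by (simp add: vectors_def)
      have "F n X \<in> D n" using lim1[OF x] Xm by (simp add: vectors_def tF)
      moreover have "tuple_of n (lift n (H n) (lift n (F n) (coord X))) = X"
        by (rule tuple_of_eq[OF Xm]) (simp add: lim2[OF x])
      ultimately show ?thesis using Xm by (simp add: tF tH)
    qed
    moreover have "H n Y \<in> U n \<and> F n (H n Y) = Y" if Y: "Y \<in> D n" for Y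
    proof -
      have Ym: "Y \<in> mat_tuples n" using Y admissibleD(1)[OF D n] by blast
      have y: "coord Y \<in> vectors n (D n)" using Y Ym by (simp add: vectors_def)
      have "H n Y \<in> U n" using lim'1[OF y] Ym by (simp add: vectors_def tH)
      moreover have "tuple_of n (lift n (F n) (lift n (H n) (coord Y))) = Y"
        by (rule tuple_of_eq[OF Ym]) (simp add: lim'2[OF y])
      ultimately show ?thesis using Ym by (simp add: tF tH)
    qed
    moreover have "chol (coords n) (vectors n (U n)) (\<lambda>x. lift n (F n) x p)" if p: "p \<in> coords n" for p
      by (rule loc_bounded_family_limit(1)[OF S.fin G loc_bounded_familyI[OF S.fin S.opn, where M = M and \<phi> = "\<lambda>k x. lift n (f k n) x p"]])
        (use mutualD[OF m] vectors_bound[OF D n] conv[OF n] p in auto)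
    moreover have "chol (coords n) (vectors n (D n)) (\<lambda>x. lift n (H n) x p)" if p: "p \<in> coords n" for p
      by (rule loc_bounded_family_limit(1)[OF T.fin G loc_bounded_familyI[OF T.fin T.opn, where M = M and \<phi> = "\<lambda>k x. lift n (h k n) x p"]])
        (use mutualD[OF m'] vectors_bound[OF U n] convH[OF n] p in auto)
    ultimately show ?thesis by blast
  qed
  have "free_map U D F"
    unfolding free_map_def
    by (intro conjI allI impI ballI image_subsetI converges_dsum[OF U D fm G F] converges_intertwine[OF D fm G F])
      (use main in auto)
  moreover have "free_map D U H"
    unfolding free_map_def
    by (intro conjI allI impI ballI image_subsetI converges_dsum[OF D U hm G H] converges_intertwine[OF U hm G H])
      (use main in auto)
  ultimately show ?thesis unfolding free_pair_def using main by blast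
qed

lemma dd_local_cong:
  assumes I: "finite I" and S: "pd_open I S" and x: "x \<in> S" and eq: "\<And>y. y \<in> S \<Longrightarrow> \<phi> y = \<psi> y"
  shows "dd \<phi> x v = dd \<psi> x v"
proof -
  obtain r where r: "r > 0" "polydisc I x r \<subseteq> S" using S x unfolding pd_open_def by blast
  obtain \<rho> where \<rho>: "\<rho> > 0" "\<And>z. z \<in> ball 0 \<rho> \<Longrightarrow> (\<lambda>p. x p + z * v p) \<in> polydisc I x r"
    using line_in_polydisc[OF I r(1), of x v] by blast
  have "eventually (\<lambda>z. z \<in> ball 0 \<rho>) (nhds (0::complex))"
    using \<rho>(1) by (intro eventually_nhds_in_open) auto
  then have "eventually (\<lambda>z. \<phi> (\<lambda>p. x p + z * v p) = \<psi> (\<lambda>p. x p + z * v p)) (nhds 0)"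
    by eventually_elim (use \<rho> r eq in auto)
  then show ?thesis unfolding dd_def by (rule deriv_cong_ev) simp
qed

lemma jdet_local_cong:
  assumes "pd_open UNIV S" "x \<in> S" "\<And>y. y \<in> S \<Longrightarrow> f y = g y"
  shows "jdet f x = jdet g x"
proof -
  have "dd (\<lambda>y. f y i) x v = dd (\<lambda>y. g y i) x v" for i v
    by (rule dd_local_cong[OF finite_class.finite_UNIV assms(1,2)]) (simp add: assms(3))
  then show ?thesis by (simp add: jdet_def jac_def)
qed

section \<open>The extremal free map\<close>

definition weight :: "(nat \<Rightarrow> 'g::finite mtuple \<Rightarrow> 'g mtuple) \<Rightarrow> real" where
  "weight f = cmod (jdet (lift1 f) (\<lambda>p. 0)) * exp (- sq_norm (lift1 f (\<lambda>p. 0)))"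

lemma lift1_eq: "lift1 f x j = coord (f 1 (tuple_of 1 (spread x))) (j, 0, 0)"
  by (simp add: lift1_def lift_def collapse_def)

lemma spread_zero [simp]: "spread (\<lambda>p. 0) = (\<lambda>p. 0)"
  by (simp add: spread_def)

lemma tuple_of_spread_scale:
  assumes "X \<in> mat_tuples 1"
  shows "tuple_of 1 (spread (\<lambda>p. u * collapse (coord X) p)) = scale_tuple u (X :: 'g::finite mtuple)"
proof (rule tuple_of_eq)
  fix p :: "'g \<times> nat \<times> nat" assume p: "p \<in> coords 1"
  then obtain j where "p = (j, 0, 0)" using coords_1[of p] by auto
  then show "spread (\<lambda>p. u * collapse (coord X) p) p = coord (scale_tuple u X) p"
    using coord_scale_tuple[OF assms p] by (simp add: spread_def collapse_def)
qed (use assms in simp)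

text \<open>Cauchy estimates on a polydisc around \<open>0\<close> bound the entries of the Jacobian
  by \<open>2 * M / r\<close>, uniformly in \<open>f\<close>, and the exponential is at most
  \<open>1\<close>.\<close>

lemma weight_bounded:
  fixes U D :: "nat \<Rightarrow> 'g::finite mtuple set"
  assumes U: "admissible M U" and D: "admissible M D"
  shows "\<exists>K. \<forall>f h. free_pair U D f h \<longrightarrow> weight f \<le> K"
proof -
  interpret S: circled_domain UNIV "level1 U" by (rule level1_circled[OF U])
  obtain r where r: "r > 0" "polydisc UNIV (\<lambda>p. 0) r \<subseteq> level1 U" by (rule S.zero_polydisc)
  define K where "K = real (card {p. p permutes (UNIV::'g set)}) * (2 * M / r) ^ CARD('g)"
  have "weight f \<le> K" if fh: "free_pair U D f h" for f h
  proof -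
    note m = mutualD[OF lift1_mutual[OF U D fh], simplified]
    have b: "cmod (lift1 f x i) \<le> M" if "x \<in> level1 U" for x i
    proof -
      have "spread (lift1 f x) \<in> vectors 1 (D 1)" using m(1)[of x] that by simp
      from vectors_bound[OF D _ this] have "cmod (spread (lift1 f x) (i, 0, 0)) \<le> M" by (simp add: coords_1)
      then show ?thesis by (simp add: spread_def)
    qed
    have "cmod (jdet (lift1 f) (\<lambda>p. 0)) \<le> K"
      unfolding jdet_def K_def
    proof (rule det_bound)
      fix i j
      have "cmod (dd (\<lambda>y. lift1 f y i) (\<lambda>p. 0) (std_vec j)) \<le> 2 * M / r"
        by (rule dd_bound[OF mutualD(3)[OF lift1_mutual[OF U D fh]] r(2,1)]) (use b r in auto)
      then show "cmod (vec_nth (vec_nth (jac (lift1 f) (\<lambda>p. 0)) i) j) \<le> 2 * M / r" by (simp add: jac_def)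
    qed
    moreover have "exp (- sq_norm (lift1 f (\<lambda>p. 0))) \<le> 1" by (simp add: sq_norm_def sum_nonneg)
    ultimately show ?thesis
      unfolding weight_def using mult_mono[of _ K _ 1] by (smt (verit) exp_ge_zero mult_cancel_left1 mult_left_le norm_ge_zero)
  qed
  then show ?thesis by blast
qed

lemma weight_pos:
  fixes U D :: "nat \<Rightarrow> 'g::finite mtuple set"
  assumes U: "admissible M U" and D: "admissible M D" and fh: "free_pair U D f h"
  shows "weight f > 0"
proof -
  interpret S: circled_domain UNIV "level1 U" by (rule level1_circled[OF U])
  have "jdet (lift1 h) (lift1 f (\<lambda>p. 0)) * jdet (lift1 f) (\<lambda>p. 0) = 1"
    by (rule jdet_mutual[OF S.opn lift1_mutual[OF U D fh] lift1_mutual[OF D U free_pair_sym[OF fh]] S.zero])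
  then have "jdet (lift1 f) (\<lambda>p. 0) \<noteq> 0" by auto
  then show ?thesis by (simp add: weight_def)
qed

text \<open>Derivatives converge along with bounded holomorphic maps, so the weight does too. A
  positive limit weight means a nonzero limiting Jacobian, which by
  \<open>limit_value_interior\<close> keeps the value at \<open>0\<close> off the boundary.\<close>

lemma weight_limit:
  fixes U D :: "nat \<Rightarrow> 'g::finite mtuple set"
  assumes U: "admissible M U" and D: "admissible M D" and fh: "\<And>k. free_pair U D (f k) (h k)" and G: "G \<noteq> bot"
    and F: "converges G U f F"
  shows "((\<lambda>k. weight (f k)) \<longlongrightarrow> weight F) G" "weight F > 0 \<Longrightarrow> F 1 (zero_tuple 1) \<in> D 1"
proof -
  interpret S: circled_domain UNIV "level1 U" by (rule level1_circled[OF U])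
  interpret T: circled_domain UNIV "level1 D" by (rule level1_circled[OF D])
  have m: "mutual UNIV (level1 U) (level1 D) (lift1 (f k)) (lift1 (h k))" for k by (rule lift1_mutual[OF U D fh])
  have lim: "((\<lambda>k. lift1 (f k) x i) \<longlongrightarrow> lift1 F x i) G" if "x \<in> level1 U" for x i
  proof -
    have "tuple_of 1 (spread x) \<in> U 1" using that by (simp add: vectors_def)
    then show ?thesis unfolding lift1_eq by (intro convergesD(2)[OF F]) (simp_all add: coords_1)
  qed
  have b: "cmod (lift1 (f k) x i) \<le> M" if "x \<in> level1 U" for k x i
  proof -
    have "spread (lift1 (f k) x) \<in> vectors 1 (D 1)" using mutualD(1)[OF m that] by simp
    from vectors_bound[OF D _ this] have "cmod (spread (lift1 (f k) x) (i, 0, 0)) \<le> M" by (simp add: coords_1)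
      then show ?thesis by (simp add: spread_def)
  qed
  have c: "chol UNIV (level1 U) (\<lambda>x. lift1 (f k) x i)" for k i by (rule mutualD(3)[OF m]) simp
  show "((\<lambda>k. weight (f k)) \<longlongrightarrow> weight F) G"
    unfolding weight_def sq_norm_def
    by (intro tendsto_intros jdet_limit[OF S.opn c b G lim S.zero] lim[OF S.zero])
  assume "weight F > 0"
  then have J: "jdet (lift1 F) (\<lambda>p. 0) \<noteq> 0" by (auto simp: weight_def)
  have "lift1 F (\<lambda>p. 0) \<in> level1 D"
    by (rule limit_value_interior[where f = "\<lambda>k. lift1 (f k)" and F = "lift1 F", OF S.opn S.zero mutualD(1)[OF m] c b G lim J])
  then have "tuple_of 1 (spread (lift1 F (\<lambda>p. 0))) \<in> D 1" by (simp add: vectors_def)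
  also have "tuple_of 1 (spread (lift1 F (\<lambda>p. 0))) = F 1 (zero_tuple 1)"
    using tuple_of_spread_scale[of "F 1 (zero_tuple 1)" 1] convergesD(1)[OF F, of 1 "zero_tuple 1"]
    by (simp add: lift1_def lift_def scale_tuple_def fun_eq_iff) (auto simp: mat_tuples_def)
  finally show "F 1 (zero_tuple 1) \<in> D 1" .
qed

text \<open>The supremum is positive because one free pair exists. This positivity keeps the cluster
  point of a maximizing sequence from degenerating.\<close>

lemma exists_maximal_weight:
  fixes U D :: "nat \<Rightarrow> 'g::finite mtuple set"
  assumes U: "admissible M U" and D: "admissible M D" and fh0: "free_pair U D f0 h0"
  obtains F H where "free_pair U D F H" "\<And>f h. free_pair U D f h \<Longrightarrow> weight f \<le> weight F"
proof -
  define W where "W = {weight f | f h. free_pair U D f h}"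
  have W0: "weight f0 \<in> W" using fh0 by (auto simp: W_def)
  obtain K where K: "\<And>f h. free_pair U D f h \<Longrightarrow> weight f \<le> K" using weight_bounded[OF U D] by blast
  then have bddW: "bdd_above W" by (auto simp: W_def intro!: bdd_aboveI)
  define s where "s = Sup W"
  have le: "weight f \<le> s" if "free_pair U D f h" for f h
    unfolding s_def by (rule cSup_upper[OF _ bddW]) (use that in \<open>auto simp: W_def\<close>)
  have "s > 0" using le[OF fh0] weight_pos[OF U D fh0] by simp
  have "\<exists>f h. free_pair U D f h \<and> s - 1 / real (Suc k) < weight f" for k
  proof -
    have "s - 1 / real (Suc k) < Sup W" by (simp add: s_def)
    then obtain w where "w \<in> W" "s - 1 / real (Suc k) < w"
      using less_cSup_iff[of W] bddW W0 by blast
    then show ?thesis by (auto simp: W_def)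
  qed
  then have "\<forall>k. \<exists>f h. free_pair U D f h \<and> s - 1 / real (Suc k) < weight f" ..
  then obtain f where "\<forall>k. \<exists>h. free_pair U D (f k) h \<and> s - 1 / real (Suc k) < weight (f k)"
    unfolding choice_iff by blast
  then obtain h where fh: "\<And>k. free_pair U D (f k) (h k)" and w: "\<And>k. s - 1 / real (Suc k) < weight (f k)"
    unfolding choice_iff by blast
  obtain G F H where G: "G \<le> sequentially" "G \<noteq> bot" and F: "converges G U f F" and H: "converges G D h H"
    by (rule free_pairs_cluster[OF U D fh])
  have "(\<lambda>k. weight (f k)) \<longlonglongrightarrow> s"
  proof (rule tendsto_sandwich)
    show "\<forall>\<^sub>F k in sequentially. s - 1 / real (Suc k) \<le> weight (f k)" using w by (auto intro: less_imp_le always_eventually)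
    show "\<forall>\<^sub>F k in sequentially. weight (f k) \<le> s" using le[OF fh] by auto
    have "(\<lambda>k. s - 1 / real (Suc k)) \<longlonglongrightarrow> s - 0"
      using LIMSEQ_inverse_real_of_nat by (intro tendsto_diff tendsto_const) (simp add: inverse_eq_divide)
    then show "(\<lambda>k. s - 1 / real (Suc k)) \<longlonglongrightarrow> s" by simp
  qed simp
  then have "((\<lambda>k. weight (f k)) \<longlongrightarrow> s) G" by (rule tendsto_mono[OF G(1)])
  then have s: "weight F = s" using tendsto_unique[OF G(2) weight_limit(1)[OF U D fh G(2) F]] by blast
  show thesis
  proof (rule that)
    show "free_pair U D F H"
      by (rule free_pair_converges[OF U D fh G(2) F H weight_limit(2)[OF U D fh G(2) F]]) (use s \<open>s > 0\<close> in simp)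
  qed (use le s in blast)
qed

lemma maximal_weight_fixes_0:
  fixes U D :: "nat \<Rightarrow> 'g::finite mtuple set"
  assumes U: "admissible M U" and D: "admissible M D" and fh: "free_pair U D f h"
    and max: "\<And>g k. free_pair U D g k \<Longrightarrow> weight g \<le> weight f" and n: "n > 0"
  shows "f n (zero_tuple n) = zero_tuple n"
proof -
  interpret S: circled_domain UNIV "level1 U" by (rule level1_circled[OF U])
  note m = lift1_mutual[OF U D fh] and m' = lift1_mutual[OF D U free_pair_sym[OF fh]]
  have hf: "free_pair D U h f" by (rule free_pair_sym[OF fh])
  have Dm: "D 1 \<subseteq> mat_tuples 1" and Um: "U 1 \<subseteq> mat_tuples 1"
    using admissibleD(1)[OF D, of 1] admissibleD(1)[OF U, of 1] by auto
  have "lift1 f (\<lambda>p. 0) = (\<lambda>p. 0)"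
  proof (rule extremal_fixes_0[OF level1_circled[OF U] level1_circled[OF D] m m'])
    fix u :: complex assume u: "cmod u = 1"
    define g where "g = (\<lambda>n X. f n (scale_tuple \<i> (h n (scale_tuple u (f n X)))))"
    note p1 = free_pair_compose[OF U D D fh free_pair_scale[OF D u]]
    note p2 = free_pair_compose[OF U D U p1 hf]
    note p3 = free_pair_compose[OF U U U p2 free_pair_scale[OF U norm_ii]]
    have "weight g \<le> weight f"
      unfolding g_def by (rule max[OF free_pair_compose[OF U U D p3 fh]])
    \<comment> \<open>Level-one coordinates turn \<open>scale_tuple\<close> into scalar
      multiplication, so the competitor agrees with \<open>rotated\<close> on
      \<open>level1 U\<close>. Outside that set nothing is claimed, hence the local comparison of
      determinants below.\<close>
    moreover have eq: "lift1 g x = rotated (lift1 f) (lift1 h) u x" if x: "x \<in> level1 U" for x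
    proof -
      define X where "X = tuple_of 1 (spread x)"
      have X: "X \<in> U 1" using x by (simp add: X_def vectors_def)
      have fX: "f 1 X \<in> D 1" by (rule free_pairD(1)[OF fh _ X]) simp
      have uX: "scale_tuple u (f 1 X) \<in> D 1" by (rule admissible_scale[OF D _ fX u]) simp
      have hX: "h 1 (scale_tuple u (f 1 X)) \<in> U 1" by (rule free_pairD(1)[OF hf _ uX]) simp
      have 1: "lift1 f x = collapse (coord (f 1 X))" by (simp add: lift1_def lift_def X_def)
      have "tuple_of 1 (spread (\<lambda>p. u * lift1 f x p)) = scale_tuple u (f 1 X)"
        unfolding 1 by (rule tuple_of_spread_scale) (use fX Dm in blast)
      then have 2: "lift1 h (\<lambda>p. u * lift1 f x p) = collapse (coord (h 1 (scale_tuple u (f 1 X))))"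
        by (simp only: lift1_def[of h] lift_def)
      have "tuple_of 1 (spread (\<lambda>p. \<i> * lift1 h (\<lambda>p. u * lift1 f x p) p)) = scale_tuple \<i> (h 1 (scale_tuple u (f 1 X)))"
        unfolding 2 by (rule tuple_of_spread_scale) (use hX Um in blast)
      then have "lift1 f (\<lambda>p. \<i> * lift1 h (\<lambda>p. u * lift1 f x p) p) = collapse (coord (f 1 (scale_tuple \<i> (h 1 (scale_tuple u (f 1 X))))))"
        by (simp only: lift1_def[of f "\<lambda>p. \<i> * _ p"] lift_def)
      then show ?thesis by (simp add: rotated_def g_def lift1_def lift_def X_def)
    qed
    moreover have "jdet (lift1 g) (\<lambda>p. 0) = jdet (rotated (lift1 f) (lift1 h) u) (\<lambda>p. 0)"
      by (rule jdet_local_cong[OF S.opn S.zero eq])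
    ultimately show "cmod (jdet (rotated (lift1 f) (lift1 h) u) (\<lambda>p. 0)) * exp (- sq_norm (rotated (lift1 f) (lift1 h) u (\<lambda>p. 0)))
        \<le> cmod (jdet (lift1 f) (\<lambda>p. 0)) * exp (- sq_norm (lift1 f (\<lambda>p. 0)))"
      unfolding weight_def eq[OF S.zero] by (simp only:)
  qed
  then have "coord (f 1 (zero_tuple 1)) (j, 0, 0) = 0" for j
    using lift1_eq[of f "\<lambda>p. 0" j] by simp
  moreover have fD: "f 1 (zero_tuple 1) \<in> D 1" by (rule free_pairD(1)[OF fh _ admissibleD(4)[OF U]]) simp_all
  ultimately have base: "f 1 (zero_tuple 1) = zero_tuple 1"
    using Dm by (intro tuple_eqI[of _ 1]) (auto simp: coords_1)
  show ?thesis
    using n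
  proof (induction n rule: nat_induct_non_zero)
    case 1
    then show ?case using base by simp
  next
    case (Suc n)
    have "f (n + 1) (dsum_tuple (zero_tuple n) (zero_tuple 1)) = dsum_tuple (f n (zero_tuple n)) (f 1 (zero_tuple 1))"
      by (rule free_pairD(4)[OF fh]) (use Suc admissibleD(4)[OF U] in auto)
    then show ?case using Suc base by (simp add: dsum_zero)
  qed
qed

section \<open>Linearity of the extremal pair and the conclusion\<close>

text \<open>\<open>a\<close> is the derivative at \<open>0\<close> expressed in standard vectors; a
  biholomorphism of bounded circular domains that fixes \<open>0\<close> equals its
  derivative.\<close>

lemma free_pair_linear:
  fixes U D :: "nat \<Rightarrow> 'g::finite mtuple set"
  assumes U: "admissible M U" and D: "admissible M D" and fh: "free_pair U D f h" and n: "n > 0"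
    and f0: "f n (zero_tuple n) = zero_tuple n"
  shows "\<exists>a. \<forall>X\<in>U n. \<forall>p\<in>coords n. coord (f n X) p = (\<Sum>q\<in>coords n. a p q * coord X q)"
proof -
  interpret S: circled_domain "coords n" "vectors n (U n)" by (rule admissible_circled[OF U n])
  define a where "a = (\<lambda>p q. dd (\<lambda>x. lift n (f n) x p) (\<lambda>p. 0) (std_vec q))"
  note m = free_pair_mutual[OF D fh n] and m' = free_pair_mutual[OF U free_pair_sym[OF fh] n]
  have "coord (f n X) p = (\<Sum>q\<in>coords n. a p q * coord X q)" if X: "X \<in> U n" and p: "p \<in> coords n" for X p
  proof -
    have Xm: "X \<in> mat_tuples n" using X admissibleD(1)[OF U n] by blast
    have x: "coord X \<in> vectors n (U n)" using X Xm by (simp add: vectors_def)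
    have "lift n (f n) (coord X) p = dd (\<lambda>x. lift n (f n) x p) (\<lambda>p. 0) (coord X)"
      by (rule biholomorphism_fixing_0_linear[OF admissible_circled[OF U n] admissible_circled[OF D n] m m' _ x p])
        (simp add: lift_def f0)
    also have "\<dots> = (\<Sum>q\<in>coords n. coord X q * a p q)"
      unfolding a_def by (rule dd_sum[OF S.fin mutualD(3)[OF m p] S.zero])
    finally show ?thesis using Xm by (simp add: lift_def mult.commute)
  qed
  then show ?thesis by blast
qed

lemma linear_analytic_tuple_map:
  assumes "\<forall>X\<in>S. \<forall>p\<in>coords n. coord (F X) p = (\<Sum>q\<in>coords n. a p q * coord X q)"
  shows "analytic_tuple_map n S F"
  unfolding analytic_tuple_map_def using assms by (auto intro!: linear_imp_analytic_fun)

text \<open>\<open>levelwise_linear\<close> asks for a linear map on all tuples, beyond the domain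
  itself; the coefficient matrix of the restricted map defines the extension.\<close>

lemma linear_tuple_map_matrix:
  fixes a :: "'g::finite \<times> nat \<times> nat \<Rightarrow> 'g \<times> nat \<times> nat \<Rightarrow> complex"
  shows "linear_tuple_map n (\<lambda>X. tuple_of n (\<lambda>p. \<Sum>q\<in>coords n. a p q * coord X q))"
  unfolding linear_tuple_map_def
proof (intro conjI ballI allI)
  fix X Y :: "'g mtuple" assume X: "X \<in> mat_tuples n" and Y: "Y \<in> mat_tuples n"
  have add: "coord (\<lambda>j. V j + W j) p = coord V p + coord W p"
    if "V \<in> mat_tuples n" "W \<in> mat_tuples n" "p \<in> coords n" for V W :: "'g mtuple" and p
    using mat_tuples_dim[OF that(1), of "fst p"] mat_tuples_dim[OF that(2), of "fst p"] that(3)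
    by (cases p) (auto simp: coord_def mem_coords)
  show "tuple_of n (\<lambda>p. \<Sum>q\<in>coords n. a p q * coord (\<lambda>j. X j + Y j) q) =
      (\<lambda>j. tuple_of n (\<lambda>p. \<Sum>q\<in>coords n. a p q * coord X q) j + tuple_of n (\<lambda>p. \<Sum>q\<in>coords n. a p q * coord Y q) j)"
  proof (rule tuple_of_eq)
    show "(\<lambda>j. tuple_of n (\<lambda>p. \<Sum>q\<in>coords n. a p q * coord X q) j + tuple_of n (\<lambda>p. \<Sum>q\<in>coords n. a p q * coord Y q) j) \<in> mat_tuples n"
      by (simp add: mat_tuples_def tuple_of_def)
  qed (simp add: add X Y sum.distrib distrib_left)
next
  fix c and X :: "'g mtuple" assume X: "X \<in> mat_tuples n"
  have "tuple_of n (\<lambda>p. \<Sum>q\<in>coords n. a p q * coord (scale_tuple c X) q) =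
      scale_tuple c (tuple_of n (\<lambda>p. \<Sum>q\<in>coords n. a p q * coord X q))"
    by (rule tuple_of_eq) (simp_all add: coord_scale_tuple[where n = n] X sum_distrib_left mult.left_commute)
  then show "tuple_of n (\<lambda>p. \<Sum>q\<in>coords n. a p q * coord (\<lambda>j. c \<cdot>\<^sub>m X j) q) =
      (\<lambda>j. c \<cdot>\<^sub>m tuple_of n (\<lambda>p. \<Sum>q\<in>coords n. a p q * coord X q) j)"
    by (simp add: scale_tuple_def)
qed simp

text \<open>The bound on the target domain turns the coordinates of an analytic map into bounded
  functions, as the passage from power series to \<open>chol\<close> requires.\<close>

lemma free_biholomorphism_imp_free_pair:
  fixes U D :: "nat \<Rightarrow> 'g::finite mtuple set"
  assumes U: "admissible M U" and D: "admissible M D" and f: "free_biholomorphism U D f"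
  shows "\<exists>h. free_pair U D f h"
proof -
  have c: "chol (coords n) (vectors n (V n)) (\<lambda>x. lift n (g n) x p)"
    if "admissible M V" "admissible M W" "free_analytic_map V W g" "n > 0" "p \<in> coords n"
    for V W :: "nat \<Rightarrow> 'g mtuple set" and g n p
    unfolding lift_def
  proof (rule analytic_fun_imp_chol[OF admissibleD(2)[OF that(1,4)]])
    show "analytic_fun n (V n) (\<lambda>X. coord (g n X) p)"
      using that by (auto simp: free_analytic_map_def analytic_tuple_map_def)
    fix X assume "X \<in> V n"
    then have "g n X \<in> W n" using that(3,4) by (auto simp: free_analytic_map_def intro: free_mapD(1))
    then show "cmod (coord (g n X) p) \<le> M" using admissibleD(5)[OF that(2,4)] that(5) by blast
  qed
  obtain h where "free_analytic_map U D f" "free_analytic_map D U h"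
    "\<forall>n>0. \<forall>X\<in>U n. h n (f n X) = X" "\<forall>n>0. \<forall>Y\<in>D n. f n (h n Y) = Y"
    using f unfolding free_biholomorphism_def by blast
  then have "free_pair U D f h"
    unfolding free_pair_def using c[OF U D] c[OF D U] by (auto simp: free_analytic_map_def)
  then show ?thesis by blast
qed

lemma admissible_exists:
  fixes U :: "nat \<Rightarrow> 'g::finite mtuple set"
  assumes "nc_domain U" "nc_bounded U" "circular U" "contains_nc_nbhd_0 U"
  shows "\<exists>M0. \<forall>M\<ge>M0. admissible M U"
proof -
  obtain C where C: "\<And>n X. n > 0 \<Longrightarrow> X \<in> U n \<Longrightarrow> row_gram_less C n X"
    using assms(2) unfolding nc_bounded_def by blast
  obtain \<epsilon> where \<epsilon>: "\<epsilon> > 0" "\<And>n. n > 0 \<Longrightarrow> nc_nbhd \<epsilon> n \<subseteq> U n"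
    using assms(4) unfolding contains_nc_nbhd_0_def by blast
  have "admissible M U" if "M \<ge> \<bar>C\<bar>" for M
    unfolding admissible_def
  proof (intro conjI allI impI ballI assms)
    fix n :: nat assume n: "0 < n"
    show "zero_tuple n \<in> U n" using \<epsilon>(2)[OF n] zero_mem_nc_nbhd[OF \<epsilon>(1)] by blast
    fix X :: "'g mtuple" and p :: "'g \<times> nat \<times> nat" assume X: "X \<in> U n" and p: "p \<in> coords n"
    have "X \<in> mat_tuples n" using assms(1) n X by (auto simp: nc_domain_def nc_set_def)
    from row_gram_less_entry[OF this C[OF n X] p] show "cmod (coord X p) \<le> M" using that by linarith
  qed
  then show ?thesis by blast
qed

theorem theorem5p2:
  fixes U D :: "nat \<Rightarrow> ('g::finite \<Rightarrow> complex mat) set"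
  assumes "nc_domain U" and "nc_domain D"
    and "nc_bounded U" and "nc_bounded D"
    and "circular U" and "circular D"
    and "contains_nc_nbhd_0 U" and "contains_nc_nbhd_0 D"
    and "freely_biholomorphic U D"
  shows "\<exists>\<Lambda>. free_biholomorphism D U \<Lambda> \<and> levelwise_linear D \<Lambda>"
proof -
  obtain M1 M2 where "\<forall>M\<ge>M1. admissible M U" "\<forall>M\<ge>M2. admissible M D"
    using admissible_exists[of U] admissible_exists[of D] assms by blast
  then have U: "admissible (max M1 M2) U" and D: "admissible (max M1 M2) D" by auto
  obtain f0 h0 where fh0: "free_pair U D f0 h0"
    using assms(9) free_biholomorphism_imp_free_pair[OF U D] unfolding freely_biholomorphic_def by blast
  obtain F H where FH: "free_pair U D F H" and max: "\<And>f h. free_pair U D f h \<Longrightarrow> weight f \<le> weight F"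
    by (rule exists_maximal_weight[OF U D fh0]) blast
  have HF: "free_pair D U H F" by (rule free_pair_sym[OF FH])
  have F0: "F n (zero_tuple n) = zero_tuple n" if "n > 0" for n
    by (rule maximal_weight_fixes_0[OF U D FH max that])
  \<comment> \<open>The inverse fixes \<open>0\<close> as well, so linearity holds in both
    directions: for \<open>H\<close> it is the conclusion, and for \<open>F\<close> it yields
    analyticity of the inverse of \<open>H\<close>.\<close>
  have H0: "H n (zero_tuple n) = zero_tuple n" if "n > 0" for n
    using free_pairD(2)[OF FH that admissibleD(4)[OF U that]] F0[OF that] by simp
  have linF: "\<exists>a. \<forall>X\<in>U n. \<forall>p\<in>coords n. coord (F n X) p = (\<Sum>q\<in>coords n. a p q * coord X q)" if "n > 0" for n
    by (rule free_pair_linear[OF U D FH that F0[OF that]])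
  have linH: "\<exists>a. \<forall>Y\<in>D n. \<forall>p\<in>coords n. coord (H n Y) p = (\<Sum>q\<in>coords n. a p q * coord Y q)" if "n > 0" for n
    by (rule free_pair_linear[OF D U HF that H0[OF that]])
  \<comment> \<open>\<open>F\<close> arose as a pointwise limit and is known to be holomorphic along
    curves; linearity restores the power series that a free analytic map must have.\<close>
  have "analytic_tuple_map n (U n) (F n)" if "n > 0" for n
    using linF[OF that] linear_analytic_tuple_map[of "U n" n "F n"] by blast
  then have aF: "free_analytic_map U D F" using FH by (simp add: free_analytic_map_def free_pair_def)
  have "analytic_tuple_map n (D n) (H n)" if "n > 0" for n
    using linH[OF that] linear_analytic_tuple_map[of "D n" n "H n"] by blast
  then have aH: "free_analytic_map D U H" using FH by (simp add: free_analytic_map_def free_pair_def)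
  have "free_biholomorphism D U H"
    unfolding free_biholomorphism_def using aF aH free_pairD(2)[OF FH] free_pairD(2)[OF HF] by (intro conjI exI[of _ F]) simp_all
  moreover have "levelwise_linear D H"
    unfolding levelwise_linear_def
  proof (intro allI impI)
    fix n :: nat assume n: "0 < n"
    obtain a where a: "\<And>Y p. Y \<in> D n \<Longrightarrow> p \<in> coords n \<Longrightarrow> coord (H n Y) p = (\<Sum>q\<in>coords n. a p q * coord Y q)"
      using linH[OF n] by blast
    have "H n Y = tuple_of n (\<lambda>p. \<Sum>q\<in>coords n. a p q * coord Y q)" if "Y \<in> D n" for Y
    proof (rule tuple_of_eq[symmetric])
      show "H n Y \<in> mat_tuples n" using free_pairD(1)[OF HF n that] admissibleD(1)[OF U n] by blast
    qed (simp add: a that)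
    then show "\<exists>L. linear_tuple_map n L \<and> (\<forall>Y\<in>D n. H n Y = L Y)"
      using linear_tuple_map_matrix[of n a] by blast
  qed
  ultimately show ?thesis by (intro exI conjI)
qed

end
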